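(* Let $\alpha\in(0,2)$, let $\Phi_\alpha$ be the self-similar profile defined in the context, and let $$u_\alpha(x,t)=\Phi_\alpha\!\left(\frac{x}{t^{1/(\alpha+1)}}\right)\quad (x\in\mathbb{R},\ t>0),\qquad u_\alpha(x,0)=H(x).$$ Then $u_\alpha$ is a viscosity solution on $\mathbb{R}\times[0,+\infty)$ of $$u_t=-|u_x|\,\Lambda^\alpha u \ \text{ on } \mathbb{R}\times(0,+\infty),\qquad u(x,0)=H(x),$$ where $H$ is the Heaviside function ($H(x)=0$ for $x<0$, $H(x)=1$ for $x>0$), and it is unique in the sense that if $u$ is another viscosity solution of this initial value problem, then $u=u_\alpha$ on $(\mathbb{R}\times[0,+\infty))\setminus\{(0,0)\}$.
   Context: Operator. For $\alpha\in(0,2)$, $\Lambda^\alpha$ is given on Schwartz functions by $\widehat{(\Lambda^\alpha w)}(\xi)=|\xi|^\alpha\widehat w(\xi)$, and on bounded sufficiently smooth functions by the Lévy–Khintchine formula $$-\Lambda^\alpha w(x)=C(\alpha)\int_{\mathbb{R}}\left\{w(x+z)-w(x)-z\,w'(x)\mathbf 1_{\{|z|\le 1\}}\right\}\frac{dz}{|z|^{1+\alpha}},$$ with the constant $C(\alpha)>0$ for which the two definitions agree. Profile. Let $K(\alpha)=\Gamma(1/2)\left[2^\alpha\Gamma(1+\alpha/2)\Gamma((1+\alpha)/2)\right]^{-1}$, $v(x)=K(\alpha)(1-|x|^2)^{\alpha/2}$ for $|x|<1$ and $v(x)=0$ for $|x|\ge1$, $U(x)=\int_0^x v(y)\,dy$,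 $M=\int_0^1 v(y)\,dy$, and $y_\alpha=\left(\frac{\alpha+1}{2M}\right)^{1/(\alpha+1)}$. The self-similar profile is $\Phi_\alpha(y)=\frac{1}{2M}\left\{U(y/y_\alpha)+M\right\}$. It is nondecreasing, of regularity $C^{1+\alpha/2}$ on $\mathbb{R}$, analytic on $(-y_\alpha,y_\alpha)$, equal to $0$ on $(-\infty,-y_\alpha)$ and to $1$ on $(y_\alpha,+\infty)$, and $(\Lambda^\alpha\Phi_\alpha)(y)=y/(\alpha+1)$ for $y\in(-y_\alpha,y_\alpha)$. The value of $H$ (hence of $u_\alpha(\cdot,0)$) at $0$ is any fixed number in $[0,1]$; it plays no role. Envelopes. For a locally bounded function $u$, $u^*(x,t)=\limsup_{y\to x,\,s\to t}u(y,s)$ and $u_*(x,t)=\liminf_{y\to x,\,s\to t}u(y,s)$ are its upper and lower semicontinuous envelopes (over $(y,s)\in\mathbb{R}\times[0,+\infty)$, including $(x,t)$ itself); similarly for functions of $x$ only. Viscosity solutions. A bounded upper (resp. lower) semicontinuous function $u:\mathbb{R}\times[0,+\infty)\to\mathbb{R}$ is a viscosity subsolution (resp. supersolution) of $u_t=-|u_x|\Lambda^\alpha u$ on $\mathbb{R}\times(0,+\infty)$ if for every $(x_0,t_0)$ with $t_0>0$, every $\tau\in(0,t_0)$ and every test function $\phi\in C^2(\mathbb{R}\times(0,+\infty))\cap L^\infty(\mathbb{R}\times(0,+\infty))$ such that $u-\phi$ attains a maximum (resp. minimum) over $\mathbb{R}\times(t_0-\tau,t_0+\tau)$ at $(x_0,t_0)$,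 one has $$\partial_t\phi(x_0,t_0)+|\phi_x(x_0,t_0)|\,(\Lambda^\alpha\phi(\cdot,t_0))(x_0)\le 0\quad(\text{resp. }\ge0),$$ with $\Lambda^\alpha\phi$ given by the Lévy–Khintchine formula. It is a subsolution (resp. supersolution) of the initial value problem with datum $u_0$ on $\mathbb{R}\times[0,+\infty)$ if moreover $u(\cdot,0)\le u_0^*$ (resp. $u(\cdot,0)\ge(u_0)_*$). A function $u$ is a viscosity solution of the equation (resp. of the initial value problem) if $u^*$ is a viscosity subsolution and $u_*$ is a viscosity supersolution. *)

theory Defs
  imports "HOL-Analysis.Analysis"
begin

section \<open>The operator \<open>\<Lambda>\<^sup>\<alpha>\<close>\<close>

definition schwartz :: "(real \<Rightarrow> real) \<Rightarrow> bool" where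
  "schwartz w \<longleftrightarrow>
     (\<forall>n x. (deriv ^^ n) w field_differentiable at x) \<and>
     (\<forall>m n. \<exists>B. \<forall>x. \<bar>x\<bar> ^ m * \<bar>(deriv ^^ n) w x\<bar> \<le> B)"

text \<open>The Fourier transform is taken in angular frequency. With this convention the constant
  \<open>profile_const\<close> below is the one for which \<open>\<Lambda>\<^sup>\<alpha> v = 1\<close> on \<open>(-1,1)\<close>.\<close>

definition fourier :: "(real \<Rightarrow> real) \<Rightarrow> real \<Rightarrow> complex" where
  "fourier w \<xi> = (LINT x|lborel. cis (- (x * \<xi>)) * complex_of_real (w x))"

text \<open>The Levy-Khintchine formula with constant \<open>C\<close> in front of the integral, with the sign of
  \<open>\<Lambda>\<^sup>\<alpha>\<close> (not of \<open>-\<Lambda>\<^sup>\<alpha>\<close>). The point \<open>z = 0\<close> is a null set; the integrand is \<open>0\<close> there.\<close>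

definition levy_khintchine :: "real \<Rightarrow> real \<Rightarrow> (real \<Rightarrow> real) \<Rightarrow> real \<Rightarrow> real" where
  "levy_khintchine C \<alpha> w x =
     - (C * (LINT z|lborel.
          (w (x + z) - w x - z * deriv w x * indicator {-1..1} z) / \<bar>z\<bar> powr (1 + \<alpha>)))"

text \<open>The positive constant for which the Levy-Khintchine formula agrees on Schwartz functions
  with the Fourier multiplier \<open>\<bar>\<xi>\<bar>\<^sup>\<alpha>\<close>. Real-valued Schwartz functions suffice, since both
  sides are linear.\<close>

definition levy_const :: "real \<Rightarrow> real" where
  "levy_const \<alpha> = (THE C. C > 0 \<and>
     (\<forall>w. schwartz w \<longrightarrow>
        (\<forall>\<xi>. fourier (levy_khintchine C \<alpha> w) \<xi> = complex_of_real (\<bar>\<xi>\<bar> powr \<alpha>) * fourier w \<xi>)))"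

definition frac_lap :: "real \<Rightarrow> (real \<Rightarrow> real) \<Rightarrow> real \<Rightarrow> real" where
  "frac_lap \<alpha> w x = levy_khintchine (levy_const \<alpha>) \<alpha> w x"

section \<open>The self-similar profile\<close>

definition profile_const :: "real \<Rightarrow> real" where
  "profile_const \<alpha> =
     Gamma (1/2) / (2 powr \<alpha> * Gamma (1 + \<alpha>/2) * Gamma ((1 + \<alpha>)/2))"

definition profile_v :: "real \<Rightarrow> real \<Rightarrow> real" where
  "profile_v \<alpha> x = (if \<bar>x\<bar> < 1 then profile_const \<alpha> * (1 - \<bar>x\<bar>\<^sup>2) powr (\<alpha>/2) else 0)"

text \<open>This is the oriented integral: for \<open>x < 0\<close> it equals minus the integral over \<open>(x,0)\<close>.\<close>

definition profile_U :: "real \<Rightarrow> real \<Rightarrow> real" where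
  "profile_U \<alpha> x = (LBINT y=ereal 0..ereal x. profile_v \<alpha> y)"

definition profile_M :: "real \<Rightarrow> real" where
  "profile_M \<alpha> = (LBINT y=ereal 0..ereal 1. profile_v \<alpha> y)"

definition profile_y :: "real \<Rightarrow> real" where
  "profile_y \<alpha> = ((\<alpha> + 1) / (2 * profile_M \<alpha>)) powr (1 / (\<alpha> + 1))"

definition profile_Phi :: "real \<Rightarrow> real \<Rightarrow> real" where
  "profile_Phi \<alpha> y = 1 / (2 * profile_M \<alpha>) * (profile_U \<alpha> (y / profile_y \<alpha>) + profile_M \<alpha>)"

text \<open>The parameter \<open>h\<close> is the value at the origin.\<close>

definition heaviside :: "real \<Rightarrow> real \<Rightarrow> real" where
  "heaviside h x = (if x < 0 then 0 else if x > 0 then 1 else h)"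

text \<open>Functions on \<open>\<real> \<times> [0,\<infinity>)\<close> are total functions of \<open>(x,t)\<close>; their values for \<open>t < 0\<close> are
  never used.\<close>

definition self_similar :: "real \<Rightarrow> real \<Rightarrow> real \<times> real \<Rightarrow> real" where
  "self_similar \<alpha> h = (\<lambda>(x, t).
     if t > 0 then profile_Phi \<alpha> (x / t powr (1 / (\<alpha> + 1))) else heaviside h x)"

section \<open>Semicontinuous envelopes\<close>

definition locally_bounded_on :: "'a::topological_space set \<Rightarrow> ('a \<Rightarrow> real) \<Rightarrow> bool" where
  "locally_bounded_on S u \<longleftrightarrow> (\<forall>p\<in>S. \<exists>V. open V \<and> p \<in> V \<and> bounded (u ` (V \<inter> S)))"

text \<open>The filter \<open>inf (nhds p) (principal S)\<close>, unlike \<open>at p within S\<close>, includes the point \<open>p\<close>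
  itself. For locally bounded \<open>u\<close> the limits superior and inferior are finite at points of \<open>S\<close>.\<close>

definition usc_envelope :: "'a::topological_space set \<Rightarrow> ('a \<Rightarrow> real) \<Rightarrow> 'a \<Rightarrow> real" where
  "usc_envelope S u p =
     real_of_ereal (Limsup (inf (nhds p) (principal S)) (\<lambda>q. ereal (u q)))"

definition lsc_envelope :: "'a::topological_space set \<Rightarrow> ('a \<Rightarrow> real) \<Rightarrow> 'a \<Rightarrow> real" where
  "lsc_envelope S u p =
     real_of_ereal (Liminf (inf (nhds p) (principal S)) (\<lambda>q. ereal (u q)))"

definition usc_on :: "'a::topological_space set \<Rightarrow> ('a \<Rightarrow> real) \<Rightarrow> bool" where
  "usc_on S u \<longleftrightarrow> (\<forall>p\<in>S. \<forall>c. u p < c \<longrightarrow> (\<forall>\<^sub>F q in at p within S. u q < c))"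

definition lsc_on :: "'a::topological_space set \<Rightarrow> ('a \<Rightarrow> real) \<Rightarrow> bool" where
  "lsc_on S u \<longleftrightarrow> (\<forall>p\<in>S. \<forall>c. c < u p \<longrightarrow> (\<forall>\<^sub>F q in at p within S. c < u q))"

section \<open>Test functions\<close>

definition half_plane :: "(real \<times> real) set" where
  "half_plane = UNIV \<times> {0..}"

definition open_half_plane :: "(real \<times> real) set" where
  "open_half_plane = UNIV \<times> {0<..}"

definition dx :: "(real \<times> real \<Rightarrow> real) \<Rightarrow> real \<times> real \<Rightarrow> real" where
  "dx f p = deriv (\<lambda>x. f (x, snd p)) (fst p)"

definition dt :: "(real \<times> real \<Rightarrow> real) \<Rightarrow> real \<times> real \<Rightarrow> real" where
  "dt f p = deriv (\<lambda>t. f (fst p, t)) (snd p)"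

text \<open>To be used for open \<open>S\<close> only.\<close>

definition C1_on :: "(real \<times> real) set \<Rightarrow> (real \<times> real \<Rightarrow> real) \<Rightarrow> bool" where
  "C1_on S f \<longleftrightarrow>
     (\<forall>p\<in>S. f differentiable at p) \<and> continuous_on S (dx f) \<and> continuous_on S (dt f)"

definition C2_on :: "(real \<times> real) set \<Rightarrow> (real \<times> real \<Rightarrow> real) \<Rightarrow> bool" where
  "C2_on S f \<longleftrightarrow> C1_on S f \<and> C1_on S (dx f) \<and> C1_on S (dt f)"

definition test_function :: "(real \<times> real \<Rightarrow> real) \<Rightarrow> bool" where
  "test_function \<phi> \<longleftrightarrow> C2_on open_half_plane \<phi> \<and> bounded (\<phi> ` open_half_plane)"

section \<open>Viscosity solutions of \<open>u\<^sub>t = - \<bar>u\<^sub>x\<bar> \<Lambda>\<^sup>\<alpha> u\<close>\<close>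

definition viscosity_subsolution :: "real \<Rightarrow> (real \<times> real \<Rightarrow> real) \<Rightarrow> bool" where
  "viscosity_subsolution \<alpha> u \<longleftrightarrow>
     bounded (u ` half_plane) \<and> usc_on half_plane u \<and>
     (\<forall>x0 t0 \<tau> \<phi>. t0 > 0 \<longrightarrow> 0 < \<tau> \<longrightarrow> \<tau> < t0 \<longrightarrow> test_function \<phi> \<longrightarrow>
        (\<forall>x. \<forall>t\<in>{t0 - \<tau><..<t0 + \<tau>}. u (x, t) - \<phi> (x, t) \<le> u (x0, t0) - \<phi> (x0, t0)) \<longrightarrow>
        dt \<phi> (x0, t0) + \<bar>dx \<phi> (x0, t0)\<bar> * frac_lap \<alpha> (\<lambda>x. \<phi> (x, t0)) x0 \<le> 0)"

definition viscosity_supersolution :: "real \<Rightarrow> (real \<times> real \<Rightarrow> real) \<Rightarrow> bool" where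
  "viscosity_supersolution \<alpha> u \<longleftrightarrow>
     bounded (u ` half_plane) \<and> lsc_on half_plane u \<and>
     (\<forall>x0 t0 \<tau> \<phi>. t0 > 0 \<longrightarrow> 0 < \<tau> \<longrightarrow> \<tau> < t0 \<longrightarrow> test_function \<phi> \<longrightarrow>
        (\<forall>x. \<forall>t\<in>{t0 - \<tau><..<t0 + \<tau>}. u (x, t) - \<phi> (x, t) \<ge> u (x0, t0) - \<phi> (x0, t0)) \<longrightarrow>
        dt \<phi> (x0, t0) + \<bar>dx \<phi> (x0, t0)\<bar> * frac_lap \<alpha> (\<lambda>x. \<phi> (x, t0)) x0 \<ge> 0)"

definition viscosity_subsolution_ivp ::
    "real \<Rightarrow> (real \<Rightarrow> real) \<Rightarrow> (real \<times> real \<Rightarrow> real) \<Rightarrow> bool" where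
  "viscosity_subsolution_ivp \<alpha> u0 u \<longleftrightarrow>
     viscosity_subsolution \<alpha> u \<and> (\<forall>x. u (x, 0) \<le> usc_envelope UNIV u0 x)"

definition viscosity_supersolution_ivp ::
    "real \<Rightarrow> (real \<Rightarrow> real) \<Rightarrow> (real \<times> real \<Rightarrow> real) \<Rightarrow> bool" where
  "viscosity_supersolution_ivp \<alpha> u0 u \<longleftrightarrow>
     viscosity_supersolution \<alpha> u \<and> (\<forall>x. u (x, 0) \<ge> lsc_envelope UNIV u0 x)"

text \<open>Local boundedness is part of the notion because the envelopes are only meaningful for
  locally bounded functions.\<close>

definition viscosity_solution_ivp ::
    "real \<Rightarrow> (real \<Rightarrow> real) \<Rightarrow> (real \<times> real \<Rightarrow> real) \<Rightarrow> bool" where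
  "viscosity_solution_ivp \<alpha> u0 u \<longleftrightarrow>
     locally_bounded_on half_plane u \<and>
     viscosity_subsolution_ivp \<alpha> u0 (usc_envelope half_plane u) \<and>
     viscosity_supersolution_ivp \<alpha> u0 (lsc_envelope half_plane u)"

end

theory Submission
  imports Defs "HOL-Probability.Probability"
begin

text \<open>For a function with derivative \<open>v\<close>, Fubini turns the symmetrised Levy integral into
  the principal value of \<open>\<integral> v(y) sgn(x - y) \<bar>x - y\<bar>\<^sup>-\<^sup>\<alpha> dy / \<alpha>\<close>. For \<open>v(y) = (1 - y\<^sup>2)\<^sup>\<alpha>\<^sup>/\<^sup>2\<close> the Moebius
  automorphism of \<open>(-1,1)\<close> that sends \<open>0\<close> to \<open>x\<close>, followed by
  \<open>t = s\<^sup>2 (1 - x\<^sup>2) / (1 - x\<^sup>2 s\<^sup>2)\<close>, reduces it to \<open>2 x\<close> times a Beta integral. The Gamma factors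
  cancel against those of the profile constant and of the Levy-Khintchine constant, which is
  read off from \<open>\<integral> (1 - cos z) \<bar>z\<bar>\<^sup>-\<^sup>1\<^sup>-\<^sup>\<alpha> dz\<close>. This is the profile equation
  \<open>\<Lambda>\<^sup>\<alpha>\<Phi>(y) = y / (\<alpha> + 1)\<close> on \<open>[-y\<^sub>\<alpha>, y\<^sub>\<alpha>]\<close>, which gives existence.

  For uniqueness no doubling of variables is needed, since only one of the two functions
  compared is merely semicontinuous. A subsolution is compared with a smooth strict
  supersolution: the self-similar solution, shifted in space and time and with its profile
  averaged over a short interval, plus two small terms that force the maximum of the
  difference to be attained. Averaging is harmless because \<open>\<Lambda>\<^sup>\<alpha>\<Phi>\<close> is continuous across the free
  boundary. The lower bound for supersolutions follows from the symmetry
  \<open>u(x,t) \<mapsto> 1 - u(-x,t)\<close>.\<close>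

section \<open>The symmetrised Levy integral\<close>

text \<open>A barrier must be C^2 to serve as a test function, but \<Phi> has only Hoelder
  derivatives, of exponent \<alpha>/2, and solves the profile equation only on its transition
  interval. Averaging cures the first defect yet spreads the slope a distance \<eta> past the free
  boundary, where the equation holds only up to an error. The penalty at scale R adds a second
  error. A term increasing slowly in time pays for both, once the time shift \<delta> has bounded
  all negative powers of s = t + \<delta>. The exponent \<gamma> = 1/(\<alpha>+1) is the one for
  which slope times nonlocal term scales like s^(-\<gamma>) s^(-\<gamma>\<alpha>) = 1/s, as the time
  derivative does.

  In the explicit evaluation of the operator the obstacle is that for \<alpha> >= 1 each one-sided
  integral of the density against r^(-\<alpha>) diverges at r = 0, so both must be cut off. The
  Moebius map sends one cut-off in s to unequal cut-offs on the two sides of x. These differ by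
  O(\<epsilon>^2), where the kernel is O(\<epsilon>^(-\<alpha>)); the mismatch
  O(\<epsilon>^(2-\<alpha>)) disappears because \<alpha> < 2.\<close>

definition levy_majorant :: "real \<Rightarrow> real \<Rightarrow> real \<Rightarrow> real \<Rightarrow> real \<Rightarrow> real" where
  "levy_majorant \<alpha> q A B z =
     indicator {0<..1} z * (A * z powr (q - 1 - \<alpha>)) + indicator {1..} z * (B * z powr (- 1 - \<alpha>))"

lemma levy_majorant_measurable [measurable]: "levy_majorant \<alpha> q A B \<in> borel_measurable borel"
  unfolding levy_majorant_def by measurable

lemma integrable_levy_majorant:
  assumes "0 < \<alpha>" "\<alpha> < q"
  shows "integrable lborel (levy_majorant \<alpha> q A B)"
proof -
  have "(\<lambda>z. z powr (q - 1 - \<alpha>)) integrable_on {0<..1::real}"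
    by (rule integrable_on_powr_from_0') (use assms in auto)
  then have "(\<lambda>z. z powr (q - 1 - \<alpha>)) absolutely_integrable_on {0<..1::real}"
    by (rule nonnegative_absolutely_integrable_1) auto
  then have 1: "integrable lborel (\<lambda>z::real. indicator {0<..1} z * z powr (q - 1 - \<alpha>))"
    unfolding set_integrable_def by (subst (asm) integrable_completion) auto
  have "(\<lambda>z. z powr (- 1 - \<alpha>)) integrable_on {1::real..}"
    using has_integral_powr_to_inf[of "- 1 - \<alpha>" 1] assms by (auto simp: integrable_on_def)
  then have "(\<lambda>z. z powr (- 1 - \<alpha>)) absolutely_integrable_on {1::real..}"
    by (rule nonnegative_absolutely_integrable_1) auto
  then have 2: "integrable lborel (\<lambda>z::real. indicator {1..} z * z powr (- 1 - \<alpha>))"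
    unfolding set_integrable_def by (subst (asm) integrable_completion) auto
  from integrable_mult_right[OF 1, of A] integrable_mult_right[OF 2, of B]
  show ?thesis
    unfolding levy_majorant_def [abs_def] by (auto simp: mult_ac)
qed

text \<open>\<open>q\<close> is the order of vanishing of the numerator at 0. At z = 1 both pieces
  of the majorant are switched on while only the first one is controlled by the numerator;
  \<open>0 \<le> B\<close> keeps the second from spoiling the bound.\<close>

lemma levy_majorant_bound:
  assumes "0 < z \<Longrightarrow> z \<le> 1 \<Longrightarrow> \<bar>f\<bar> \<le> A * z powr q" "1 < z \<Longrightarrow> \<bar>f\<bar> \<le> B" "0 \<le> B"
  shows "\<bar>indicator {0<..} z * (f / z powr (1 + \<alpha>))\<bar> \<le> levy_majorant \<alpha> q A B z"
proof (cases "z > 0")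
  case True
  have eq: "z powr (q - 1 - \<alpha>) = z powr q / z powr (1 + \<alpha>)" "z powr (- 1 - \<alpha>) = 1 / z powr (1 + \<alpha>)"
    using True by (simp_all add: powr_diff powr_add powr_minus field_simps)
  show ?thesis
  proof (cases "z \<le> 1")
    case z: True
    have "\<bar>f\<bar> / z powr (1 + \<alpha>) \<le> (A * z powr q) / z powr (1 + \<alpha>)"
      using assms(1) True z by (intro divide_right_mono) auto
    then show ?thesis
      using True z assms(3) unfolding levy_majorant_def eq
      by (auto simp: abs_mult split: split_indicator intro: order_trans)
  next
    case False
    have "\<bar>f\<bar> / z powr (1 + \<alpha>) \<le> B / z powr (1 + \<alpha>)"
      using assms(2) False by (intro divide_right_mono) auto
    then show ?thesis
      using True False unfolding levy_majorant_def eq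
      by (auto simp: abs_mult split: split_indicator)
  qed
qed (auto simp: levy_majorant_def)

text \<open>Used with q = 2 for functions with a second-order Taylor bound and with q = 1 +
  \<alpha>/2 for the profile. In both cases \<open>\<alpha> < q\<close> is the condition \<alpha> <
  2.\<close>

lemma
  fixes f :: "real \<Rightarrow> real"
  assumes "0 < \<alpha>" "\<alpha> < q" and [measurable]: "f \<in> borel_measurable borel"
    and f: "\<And>z. 0 < z \<Longrightarrow> z \<le> 1 \<Longrightarrow> \<bar>f z\<bar> \<le> A * z powr q" "\<And>z. 1 < z \<Longrightarrow> \<bar>f z\<bar> \<le> B"
  shows integrable_levy_kernel:
      "integrable lborel (\<lambda>z. indicator {0<..} z * (f z / z powr (1 + \<alpha>)))"
    and abs_integral_levy_kernel_le:
      "\<bar>LINT z|lborel. indicator {0<..} z * (f z / z powr (1 + \<alpha>))\<bar>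
         \<le> (LINT z|lborel. levy_majorant \<alpha> q A B z)"
proof -
  have "0 \<le> B" using f(2)[of 2] by linarith
  then have *: "\<bar>indicator {0<..} z * (f z / z powr (1 + \<alpha>))\<bar> \<le> levy_majorant \<alpha> q A B z" for z
    by (intro levy_majorant_bound f) auto
  show 1: "integrable lborel (\<lambda>z. indicator {0<..} z * (f z / z powr (1 + \<alpha>)))"
    by (rule Bochner_Integration.integrable_bound[OF integrable_levy_majorant[OF assms(1,2)]])
       (use * in \<open>auto intro: order_trans[OF _ abs_ge_self]\<close>)
  show "\<bar>LINT z|lborel. indicator {0<..} z * (f z / z powr (1 + \<alpha>))\<bar>
         \<le> (LINT z|lborel. levy_majorant \<alpha> q A B z)"
    using Bochner_Integration.integral_norm_bound_integral[OF 1 integrable_levy_majorant[OF assms(1,2)]] * by auto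
qed

text \<open>The sign makes \<open>sym_op\<close> a positive multiple of the operator itself rather
  than of its negative: at a maximum of \<open>w\<close> the integrand is nonnegative.\<close>

definition second_diff :: "(real \<Rightarrow> real) \<Rightarrow> real \<Rightarrow> real \<Rightarrow> real" where
  "second_diff w x z = 2 * w x - w (x + z) - w (x - z)"

abbreviation levy_quotient :: "real \<Rightarrow> (real \<Rightarrow> real) \<Rightarrow> real \<Rightarrow> real \<Rightarrow> real" where
  "levy_quotient \<alpha> w x z \<equiv> indicator {0<..} z * (second_diff w x z / z powr (1 + \<alpha>))"

definition sym_op :: "real \<Rightarrow> (real \<Rightarrow> real) \<Rightarrow> real \<Rightarrow> real" where
  "sym_op \<alpha> w x = (LINT z|lborel. levy_quotient \<alpha> w x z)"

lemma second_diff_measurable [measurable (raw)]: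
  assumes [measurable]: "w \<in> borel_measurable borel"
  shows "second_diff w x \<in> borel_measurable borel"
  unfolding second_diff_def [abs_def] by measurable

lemma second_diff_le:
  assumes "\<And>y. \<bar>w y\<bar> \<le> B"
  shows "\<bar>second_diff w x z\<bar> \<le> 4 * B"
  using assms[of x] assms[of "x+z"] assms[of "x-z"] unfolding second_diff_def by linarith

lemma integral_half_line_split:
  fixes f :: "real \<Rightarrow> real"
  assumes "integrable lborel (\<lambda>z. indicator {0<..} z * f z)"
    and "integrable lborel (\<lambda>z. indicator {0<..} z * f (- z))"
  shows "(LINT z|lborel. f z) = (LINT z|lborel. indicator {0<..} z * (f z + f (- z)))"
proof -
  let ?g = "\<lambda>z. indicator {..<0} z * f z"
  have eq: "(\<lambda>z. ?g (0 + (-1) * z)) = (\<lambda>z. indicator {0<..} z * f (- z))"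
    by (auto simp: fun_eq_iff split: split_indicator)
  have 1: "integrable lborel ?g"
    using assms(2) lborel_integrable_real_affine_iff[of "-1" ?g 0] unfolding eq by simp
  have 2: "(LINT z|lborel. ?g z) = (LINT z|lborel. indicator {0<..} z * f (- z))"
    using lborel_integral_real_affine[of "-1" ?g 0] unfolding eq by simp
  have "(LINT z|lborel. f z) = (LINT z|lborel. indicator {0<..} z * f z + ?g z)"
    by (rule integral_discrete_difference[where X="{0}"]) (auto split: split_indicator)
  also have "\<dots> = (LINT z|lborel. indicator {0<..} z * f z) + (LINT z|lborel. indicator {0<..} z * f (- z))"
    using 1 assms(1) by (simp add: 2)
  also have "\<dots> = (LINT z|lborel. indicator {0<..} z * (f z + f (- z)))"
    using assms by (simp add: distrib_left)
  finally show ?thesis .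
qed

text \<open>A local Taylor bound must reach all of |z| <= 1, the range on which the formula
  subtracts the first-order term. Between \<delta> and 1 the remainder is bounded and z^2 is at
  least \<delta>^2.\<close>

lemma quadratic_bound_extend:
  fixes w :: "real \<Rightarrow> real"
  assumes B: "\<And>y. \<bar>w y\<bar> \<le> B" and "0 < \<delta>"
    and loc: "\<And>z. \<bar>z\<bar> \<le> \<delta> \<Longrightarrow> \<bar>w (x + z) - w x - z * d\<bar> \<le> A * z\<^sup>2"
  obtains A' where "\<And>z. \<bar>z\<bar> \<le> 1 \<Longrightarrow> \<bar>w (x + z) - w x - z * d\<bar> \<le> A' * z\<^sup>2"
proof
  fix z :: real assume z: "\<bar>z\<bar> \<le> 1"
  let ?A = "\<bar>A\<bar> + (2 * B + \<bar>d\<bar>) / \<delta>\<^sup>2"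
  have B0: "B \<ge> 0" using B[of 0] by linarith
  show "\<bar>w (x + z) - w x - z * d\<bar> \<le> ?A * z\<^sup>2"
  proof (cases "\<bar>z\<bar> \<le> \<delta>")
    case True
    have "A * z\<^sup>2 \<le> ?A * z\<^sup>2" using B0 by (intro mult_right_mono add_increasing2) auto
    then show ?thesis using loc[OF True] by linarith
  next
    case False
    have "\<bar>z * d\<bar> \<le> \<bar>d\<bar>" using z by (simp add: abs_mult mult_left_le_one_le)
    then have "\<bar>w (x + z) - w x - z * d\<bar> \<le> 2 * B + \<bar>d\<bar>"
      using B[of x] B[of "x+z"] by linarith
    also have "\<dots> = (2 * B + \<bar>d\<bar>) / \<delta>\<^sup>2 * \<delta>\<^sup>2" using \<open>0 < \<delta>\<close> by simp
    also have "\<dots> \<le> (2 * B + \<bar>d\<bar>) / \<delta>\<^sup>2 * z\<^sup>2"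
      using False \<open>0 < \<delta>\<close> B0 by (intro mult_left_mono) (auto simp: abs_le_square_iff[symmetric])
    also have "\<dots> \<le> ?A * z\<^sup>2" by (intro mult_right_mono) auto
    finally show ?thesis .
  qed
qed

text \<open>The first-order correction is odd in \<open>z\<close>, so it disappears on symmetrising.\<close>

lemma levy_khintchine_eq_sym_op:
  fixes w :: "real \<Rightarrow> real"
  assumes \<alpha>: "0 < \<alpha>" "\<alpha> < 2" and [measurable]: "w \<in> borel_measurable borel"
    and B: "\<And>y. \<bar>w y\<bar> \<le> B" and "0 < \<delta>"
    and loc: "\<And>z. \<bar>z\<bar> \<le> \<delta> \<Longrightarrow> \<bar>w (x + z) - w x - z * deriv w x\<bar> \<le> A * z\<^sup>2"
  shows "levy_khintchine C \<alpha> w x = C * sym_op \<alpha> w x"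
    and "integrable lborel (levy_quotient \<alpha> w x)"
proof -
  obtain A' where A': "\<And>z. \<bar>z\<bar> \<le> 1 \<Longrightarrow> \<bar>w (x + z) - w x - z * deriv w x\<bar> \<le> A' * z\<^sup>2"
    using quadratic_bound_extend[OF B \<open>0 < \<delta>\<close> loc] by metis
  define n where "n z = w (x + z) - w x - z * deriv w x * indicator {-1..1} z" for z
  have [measurable]: "n \<in> borel_measurable borel" unfolding n_def [abs_def] by measurable
  have n1: "\<bar>n z\<bar> \<le> A' * \<bar>z\<bar> powr 2" if "\<bar>z\<bar> \<le> 1" for z
    using A'[OF that] that unfolding n_def by (auto split: split_indicator)
  have n2: "\<bar>n z\<bar> \<le> 2 * B" if "\<bar>z\<bar> > 1" for z
    using B[of "x+z"] B[of x] that unfolding n_def by (auto split: split_indicator)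
  let ?f = "\<lambda>z. n z / \<bar>z\<bar> powr (1 + \<alpha>)"
  have "integrable lborel (\<lambda>z. indicator {0<..} z * (n z / z powr (1 + \<alpha>)))"
    using n1 n2 by (intro integrable_levy_kernel[where q=2]) (use \<alpha> in force)+
  moreover have "(\<lambda>z. indicator {0<..} z * (n z / z powr (1 + \<alpha>))) = (\<lambda>z. indicator {0<..} z * ?f z)"
    by (auto split: split_indicator)
  ultimately have i1: "integrable lborel (\<lambda>z. indicator {0<..} z * ?f z)" by simp
  have "integrable lborel (\<lambda>z. indicator {0<..} z * (n (- z) / z powr (1 + \<alpha>)))"
    using n1[of "- _"] n2[of "- _"] by (intro integrable_levy_kernel[where q=2]) (use \<alpha> in force)+
  moreover have "(\<lambda>z. indicator {0<..} z * (n (- z) / z powr (1 + \<alpha>))) = (\<lambda>z. indicator {0<..} z * ?f (- z))"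
    by (auto split: split_indicator)
  ultimately have i2: "integrable lborel (\<lambda>z. indicator {0<..} z * ?f (- z))" by simp
  have eq: "(\<lambda>z. indicator {0<..} z * (?f z + ?f (- z))) =
      (\<lambda>z. - (levy_quotient \<alpha> w x z))"
    by (auto simp: fun_eq_iff n_def second_diff_def field_simps split: split_indicator)
  show "levy_khintchine C \<alpha> w x = C * sym_op \<alpha> w x"
    unfolding levy_khintchine_def sym_op_def
    using integral_half_line_split[OF i1 i2] unfolding eq by (simp add: n_def)
  have "integrable lborel (\<lambda>z. indicator {0<..} z * (?f z + ?f (- z)))"
    using Bochner_Integration.integrable_add[OF i1 i2] by (simp add: distrib_left)
  then show "integrable lborel (levy_quotient \<alpha> w x)"
    unfolding eq by simp
qed

lemma Taylor_bound:
  fixes f f' f'' :: "real \<Rightarrow> real"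
  assumes "\<And>y. \<bar>y - x\<bar> \<le> \<bar>z\<bar> \<Longrightarrow> (f has_real_derivative f' y) (at y)"
    and "\<And>y. \<bar>y - x\<bar> \<le> \<bar>z\<bar> \<Longrightarrow> (f' has_real_derivative f'' y) (at y)"
    and A: "\<And>y. \<bar>y - x\<bar> \<le> \<bar>z\<bar> \<Longrightarrow> \<bar>f'' y\<bar> \<le> A"
  shows "\<bar>f (x + z) - f x - z * f' x\<bar> \<le> A / 2 * z\<^sup>2"
proof (cases "z = 0")
  case False
  define D where "D n = (if n = 0 then f else if n = Suc 0 then f' else f'')" for n :: nat
  have "\<exists>t. (if x + z < x then x + z < t \<and> t < x else x < t \<and> t < x + z) \<and>
      f (x + z) = (\<Sum>m<2. (D m x / fact m) * (x + z - x) ^ m) + (D 2 t / fact 2) * (x + z - x)\<^sup>2"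
    by (rule Taylor[where a="x - \<bar>z\<bar>" and b="x + \<bar>z\<bar>"])
       (use False assms in \<open>auto simp: D_def less_2_cases_iff abs_le_iff\<close>)
  then obtain t where "if x + z < x then x + z < t \<and> t < x else x < t \<and> t < x + z"
    and t: "f (x + z) = f x + f' x * z + f'' t / 2 * z\<^sup>2"
    by (auto simp: D_def numeral_2_eq_2 simp del: if_split)
  then have t': "\<bar>t - x\<bar> \<le> \<bar>z\<bar>" by (auto split: if_splits)
  have "\<bar>f (x + z) - f x - z * f' x\<bar> = \<bar>f'' t\<bar> / 2 * z\<^sup>2"
    using t by (simp add: abs_mult mult.commute)
  also have "\<dots> \<le> A / 2 * z\<^sup>2" using A[OF t'] by (intro mult_right_mono) auto
  finally show ?thesis .
qed simp

lemma second_diff_Taylor: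
  fixes f f' f'' :: "real \<Rightarrow> real"
  assumes f: "\<And>y. \<bar>y - x\<bar> \<le> \<bar>z\<bar> \<Longrightarrow> (f has_real_derivative f' y) (at y)"
    "\<And>y. \<bar>y - x\<bar> \<le> \<bar>z\<bar> \<Longrightarrow> (f' has_real_derivative f'' y) (at y)"
    "\<And>y. \<bar>y - x\<bar> \<le> \<bar>z\<bar> \<Longrightarrow> \<bar>f'' y\<bar> \<le> A"
  shows "\<bar>second_diff f x z\<bar> \<le> A * z\<^sup>2"
proof -
  have 1: "\<bar>f (x + z) - f x - z * f' x\<bar> \<le> A / 2 * z\<^sup>2"
    using Taylor_bound[of x z f f' f'' A] f by simp
  have 2: "\<bar>f (x - z) - f x + z * f' x\<bar> \<le> A / 2 * z\<^sup>2"
    using Taylor_bound[of x "- z" f f' f'' A] f by simp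
  have "second_diff f x z = - (f (x + z) - f x - z * f' x) - (f (x - z) - f x + z * f' x)"
    by (simp add: second_diff_def)
  also have "\<bar>\<dots>\<bar> \<le> \<bar>f (x + z) - f x - z * f' x\<bar> + \<bar>f (x - z) - f x + z * f' x\<bar>"
    by linarith
  finally show ?thesis using 1 2 by (simp add: field_simps)
qed

text \<open>Homogeneity of order \<alpha>: substituting c z for z gives a factor c from the measure
  and c^(-1-\<alpha>) from the kernel.\<close>

lemma sym_op_affine:
  assumes "0 < c"
  shows "sym_op \<alpha> (\<lambda>x. w ((x + a) / c)) x = c powr (- \<alpha>) * sym_op \<alpha> w ((x + a) / c)"
proof -
  let ?f = "\<lambda>z. levy_quotient \<alpha> (\<lambda>x. w ((x + a) / c)) x z"
  have "sym_op \<alpha> (\<lambda>x. w ((x + a) / c)) x = c * (LINT z|lborel. ?f (0 + c * z))"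
    unfolding sym_op_def using lborel_integral_real_affine[of c ?f 0] assms by simp
  also have "(\<lambda>z. ?f (0 + c * z)) =
      (\<lambda>z. c powr (-1 - \<alpha>) * (levy_quotient \<alpha> w ((x + a) / c) z))"
  proof
    fix z :: real
    have 1: "second_diff (\<lambda>x. w ((x + a) / c)) x (c * z) = second_diff w ((x + a) / c) z"
    proof -
      have "(x + c * z + a) / c = (x + a) / c + z" "(x - c * z + a) / c = (x + a) / c - z"
        using assms by (simp_all add: field_simps)
      then show ?thesis by (simp add: second_diff_def)
    qed
    have 2: "c powr (-1 - \<alpha>) = 1 / c powr (1 + \<alpha>)"
      by (simp add: powr_minus [symmetric] powr_minus_divide [symmetric])
    show "?f (0 + c * z) =
        c powr (-1 - \<alpha>) * (levy_quotient \<alpha> w ((x + a) / c) z)"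
      using assms by (cases "z > 0") (simp_all add: 1 2 powr_mult zero_less_mult_iff)
  qed
  finally show ?thesis
    using assms unfolding sym_op_def integral_mult_right_zero
    by (simp add: powr_diff powr_minus divide_simps)
qed

lemma sym_op_reflect: "sym_op \<alpha> (\<lambda>x. c - w (- x)) x = - sym_op \<alpha> w (- x)"
proof -
  have "second_diff (\<lambda>x. c - w (- x)) x z = - second_diff w (- x) z" for z
    by (simp add: second_diff_def algebra_simps)
  then show ?thesis unfolding sym_op_def by simp
qed

section \<open>The constant in the Levy-Khintchine formula\<close>

text \<open>Writes z^(-1-\<alpha>) as a Laplace transform in t, trading the singular kernel for an
  exponential one. The nonnegative integral lets Tonelli be applied before integrability is
  known.\<close>

lemma Gamma_scaled_nn_integral:
  fixes z \<alpha> :: real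
  assumes "0 < z" "0 < \<alpha>"
  shows "(\<integral>\<^sup>+t. ennreal (indicator {0<..} t * (t powr \<alpha> * exp (- (z * t)))) \<partial>lborel)
           = ennreal (Gamma (1 + \<alpha>) / z powr (1 + \<alpha>))"
proof -
  let ?f = "\<lambda>t. ennreal (indicator {0<..} t * (t powr \<alpha> * exp (- (z * t))))"
  have "ennreal (Gamma (1 + \<alpha>)) =
      (\<integral>\<^sup>+t. ennreal (indicator {0..} t * t powr (1 + \<alpha> - 1) / exp t) \<partial>lborel)"
    by (rule Gamma_conv_nn_integral_real) (use assms in auto)
  also have "\<dots> = ennreal z * (\<integral>\<^sup>+t. ennreal (indicator {0..} (0 + z * t) * (0 + z * t) powr (1 + \<alpha> - 1) / exp (0 + z * t)) \<partial>lborel)"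
    by (subst nn_integral_real_affine[where c=z and t=0]) (use assms in auto)
  also have "(\<lambda>t. ennreal (indicator {0..} (0 + z * t) * (0 + z * t) powr (1 + \<alpha> - 1) / exp (0 + z * t)))
      = (\<lambda>t. ennreal (z powr \<alpha>) * ?f t)"
    using assms by (auto simp: fun_eq_iff ennreal_mult' [symmetric] powr_mult exp_minus zero_le_mult_iff field_simps
        split: split_indicator)
  also have "ennreal z * (\<integral>\<^sup>+t. ennreal (z powr \<alpha>) * ?f t \<partial>lborel) = ennreal (z powr (1 + \<alpha>)) * (\<integral>\<^sup>+t. ?f t \<partial>lborel)"
    using assms by (subst nn_integral_cmult) (auto simp: powr_add ennreal_mult' mult.assoc)
  finally have eq: "ennreal (Gamma (1 + \<alpha>)) = ennreal (z powr (1 + \<alpha>)) * (\<integral>\<^sup>+t. ?f t \<partial>lborel)" .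
  have "ennreal (Gamma (1 + \<alpha>) / z powr (1 + \<alpha>)) = ennreal (1 / z powr (1 + \<alpha>)) * ennreal (Gamma (1 + \<alpha>))"
    using assms by (simp add: ennreal_mult' [symmetric])
  also have "\<dots> = ennreal (1 / z powr (1 + \<alpha>) * z powr (1 + \<alpha>)) * (\<integral>\<^sup>+t. ?f t \<partial>lborel)"
    unfolding eq by (subst ennreal_mult) (auto simp: mult.assoc)
  finally show ?thesis using assms by simp
qed

lemma nn_integral_one_minus_cos_exp:
  fixes t :: real
  assumes "0 < t"
  shows "(\<integral>\<^sup>+z. ennreal (indicator {0<..} z * ((1 - cos z) * exp (- (z * t)))) \<partial>lborel)
           = ennreal (1 / (t * (1 + t\<^sup>2)))"
proof -
  \<comment> \<open>An antiderivative, obtained by integrating exp(-zt) and exp(-zt) cos z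
    separately. It tends to 0 at infinity, so the integral is \<open>- F 0\<close>.\<close>
  define F where "F z = - exp (- (z * t)) / t - exp (- (z * t)) * (sin z - t * cos z) / (1 + t\<^sup>2)" for z
  have t2: "1 + t\<^sup>2 > 0" by (simp add: add_pos_nonneg)
  have der: "(F has_real_derivative (1 - cos z) * exp (- (z * t))) (at z)" for z
  proof -
    have "(F has_real_derivative
        exp (- (z * t)) - (exp (- (z * t)) * (cos z + t * sin z) - t * exp (- (z * t)) * (sin z - t * cos z)) / (1 + t\<^sup>2)) (at z)"
      unfolding F_def [abs_def]
      by (rule derivative_eq_intros refl | use assms t2 in force)+
    also have "exp (- (z * t)) * (cos z + t * sin z) - t * exp (- (z * t)) * (sin z - t * cos z) =
        (1 + t\<^sup>2) * (exp (- (z * t)) * cos z)"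
      by (simp add: algebra_simps power2_eq_square)
    also have "(1 + t\<^sup>2) * (exp (- (z * t)) * cos z) / (1 + t\<^sup>2) = exp (- (z * t)) * cos z"
      using t2 by (intro nonzero_mult_div_cancel_left) auto
    finally show ?thesis by (simp add: algebra_simps)
  qed
  have e: "((\<lambda>z. exp (- (z * t))) \<longlongrightarrow> 0) at_top"
    using assms by real_asymp
  have "((\<lambda>z. exp (- (z * t)) * (sin z - t * cos z)) \<longlongrightarrow> 0) at_top"
  proof (rule Lim_null_comparison)
    show "((\<lambda>z. exp (- (z * t)) * (1 + t)) \<longlongrightarrow> 0) at_top"
      using tendsto_mult[OF e tendsto_const[of "1 + t"]] by simp
    show "\<forall>\<^sub>F z in at_top. norm (exp (- (z * t)) * (sin z - t * cos z)) \<le> exp (- (z * t)) * (1 + t)"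
    proof (intro always_eventually allI)
      fix z
      have "\<bar>sin z - t * cos z\<bar> \<le> \<bar>sin z\<bar> + \<bar>t * cos z\<bar>" by linarith
      also have "\<dots> \<le> 1 + t"
        using assms by (intro add_mono) (auto simp: abs_mult mult_left_le)
      finally show "norm (exp (- (z * t)) * (sin z - t * cos z)) \<le> exp (- (z * t)) * (1 + t)"
        by (simp add: abs_mult)
    qed
  qed
  from tendsto_diff[OF tendsto_divide[OF tendsto_minus[OF e] tendsto_const[of t]] tendsto_divide[OF this tendsto_const[of "1 + t\<^sup>2"]]]
  have lim: "(F \<longlongrightarrow> 0) at_top" unfolding F_def [abs_def] using assms t2 by simp
  have "(\<integral>\<^sup>+z. ennreal (indicator {0<..} z * ((1 - cos z) * exp (- (z * t)))) \<partial>lborel)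
      = (\<integral>\<^sup>+z. ennreal ((1 - cos z) * exp (- (z * t))) * indicator {0..} z \<partial>lborel)"
    by (intro nn_integral_cong) (auto split: split_indicator)
  also have "\<dots> = ennreal (0 - F 0)"
    by (rule nn_integral_FTC_atLeast[OF _ der]) (use lim in auto)
  also have "0 - F 0 = 1 / (t * (1 + t\<^sup>2))"
    using assms t2 by (simp add: F_def field_simps power2_eq_square)
  finally show ?thesis .
qed

text \<open>The substitution t = sqrt(u / (1 - u)) maps (0,1) onto the positive half-line and gives
  1 + t^2 = 1 / (1 - u), which leaves half the integrand of Beta(a/2, 1 - a/2).\<close>

lemma
  fixes a :: real
  assumes a: "0 < a" "a < 2"
  shows integrable_powr_div_1_plus_square: "set_integrable lborel {0<..} (\<lambda>t. t powr (a - 1) / (1 + t\<^sup>2))"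
    and LBINT_powr_div_1_plus_square:
      "(LINT t:{0<..}|lborel. t powr (a - 1) / (1 + t\<^sup>2)) = Beta (a/2) (1 - a/2) / 2"
proof -
  define g where "g u = (u / (1 - u)) powr (1/2)" for u :: real
  define g' where "g' u = 1/2 * (u / (1 - u)) powr (- 1/2) * (1 / (1 - u)\<^sup>2)" for u :: real
  define f where "f t = t powr (a - 1) / (1 + t\<^sup>2)" for t :: real
  have fg: "f (g u) * g' u = 1/2 * (u powr (a/2 - 1) * (1 - u) powr (1 - a/2 - 1))" if "0 < u" "u < 1" for u
  proof -
    define p where "p = u / (1 - u)"
    have p: "p > 0" using that by (simp add: p_def)
    have "(g u)\<^sup>2 = p" using p by (simp add: g_def p_def[symmetric] powr_half_sqrt)
    moreover have "1 + p = 1 / (1 - u)" using that by (simp add: p_def field_simps)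
    ultimately have "f (g u) * g' u = 1/2 * (p powr (1/2 * (a - 1)) * p powr (- 1/2)) * (1 / (1 - u))"
      using that by (simp add: f_def g'_def g_def p_def[symmetric] powr_powr power2_eq_square)
    also have "p powr (1/2 * (a - 1)) * p powr (- 1/2) = p powr (a/2 - 1)"
    proof -
      have "1/2 * (a - 1) + - 1/2 = a/2 - 1" by (simp add: field_simps)
      then show ?thesis by (simp only: powr_add[symmetric])
    qed
    also have "\<dots> = u powr (a/2 - 1) / (1 - u) powr (a/2 - 1)"
      unfolding p_def using that by (subst powr_divide) auto
    also have "1/2 * (u powr (a/2 - 1) / (1 - u) powr (a/2 - 1)) * (1 / (1 - u)) = 1/2 * (u powr (a/2 - 1) * (1 - u) powr (1 - a/2 - 1))"
    proof -
      have "(1 - u) powr (a/2 - 1) = (1 - u) powr (a/2) / (1 - u)" "(1 - u) powr (1 - a/2 - 1) = 1 / (1 - u) powr (a/2)"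
        using that by (simp_all add: powr_diff powr_minus_divide)
      then show ?thesis using that by simp
    qed
    finally show ?thesis .
  qed
  have der: "(g has_real_derivative g' u) (at u)" if "0 < u" "u < 1" for u
  proof -
    have "((\<lambda>u. u / (1 - u)) has_real_derivative (1 / (1 - u)\<^sup>2)) (at u)"
      using that by (auto intro!: derivative_eq_intros simp: power2_eq_square)
    from DERIV_fun_powr[OF this, of "1/2"] show ?thesis
      using that unfolding g_def g'_def by (simp add: mult_ac)
  qed
  have cg: "isCont g' u" if "0 < u" "u < 1" for u
    using that unfolding g'_def [abs_def] by (auto intro!: continuous_intros)
  have gpos: "g u > 0" if "0 < u" "u < 1" for u using that by (simp add: g_def)
  have cf: "isCont f (g u)" if "0 < u" "u < 1" for u
  proof -
    have "1 + (g u)\<^sup>2 > 0" by (simp add: add_pos_nonneg)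
    then show ?thesis using gpos[OF that] unfolding f_def [abs_def]
      by (auto intro!: continuous_intros)
  qed
  have beta: "set_integrable lborel {0..1} (\<lambda>u. u powr (a/2 - 1) * (1 - u) powr (1 - a/2 - 1))"
    by (rule integrable_Beta) (use a in auto)
  then have "set_integrable lborel {0<..<1} (\<lambda>u. 1/2 * (u powr (a/2 - 1) * (1 - u) powr (1 - a/2 - 1)))"
    by (intro set_integrable_mult_right) (rule set_integrable_subset, auto)
  then have "set_integrable lborel {0<..<1} (\<lambda>u. f (g u) * g' u)"
    by (rule set_integrable_cong[THEN iffD2, rotated -1]) (simp_all only: fg greaterThanLessThan_iff)
  then have int: "set_integrable lborel (einterval 0 1) (\<lambda>u. f (g u) * g' u)"
    by (simp add: zero_ereal_def one_ereal_def einterval_eq)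
  have A: "((ereal \<circ> g \<circ> real_of_ereal) \<longlongrightarrow> 0) (at_right 0)"
  proof -
    have "(g \<longlongrightarrow> 0) (at_right 0)" unfolding g_def by real_asymp
    then show ?thesis unfolding zero_ereal_def by (simp add: ereal_tendsto_simps)
  qed
  have B: "((ereal \<circ> g \<circ> real_of_ereal) \<longlongrightarrow> \<infinity>) (at_left 1)"
  proof -
    have "filterlim g at_top (at_left 1)" unfolding g_def by real_asymp
    then show ?thesis unfolding one_ereal_def by (simp add: ereal_tendsto_simps)
  qed
  have ei: "einterval 0 \<infinity> = {0<..}" by (auto simp: einterval_def)
  note subst = interval_integral_substitution_nonneg[of 0 1 g g' f 0 \<infinity>]
  have S1: "set_integrable lborel (einterval 0 \<infinity>) f"
    by (rule subst(1)) (use A B int der cg cf in \<open>auto simp: f_def g'_def zero_ereal_def one_ereal_def\<close>)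
  have S2: "(LBINT t=0..\<infinity>. f t) = (LBINT u=0..1. (f (g u) * g' u))"
    by (rule subst(2)) (use A B int der cg cf in \<open>auto simp: f_def g'_def zero_ereal_def one_ereal_def\<close>)
  show "set_integrable lborel {0<..} (\<lambda>t. t powr (a - 1) / (1 + t\<^sup>2))"
    using S1 unfolding ei f_def .
  have "(LINT t:{0<..}|lborel. t powr (a - 1) / (1 + t\<^sup>2)) = (LBINT t=0..\<infinity>. f t)"
    by (simp add: interval_lebesgue_integral_def ei f_def)
  also have "\<dots> = (LBINT u=ereal 0..ereal 1. (f (g u) * g' u))" unfolding S2 by (simp add: zero_ereal_def one_ereal_def)
  also have "\<dots> = (LBINT u=ereal 0..ereal 1. 1/2 * (u powr (a/2 - 1) * (1 - u) powr (1 - a/2 - 1)))"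
    by (rule interval_integral_cong) (auto simp: fg einterval_eq)
  also have "\<dots> = 1/2 * (LBINT u=ereal 0..ereal 1. (u powr (a/2 - 1) * (1 - u) powr (1 - a/2 - 1)))"
    by simp
  also have "(LBINT u=ereal 0..ereal 1. (u powr (a/2 - 1) * (1 - u) powr (1 - a/2 - 1))) = Beta (a/2) (1 - a/2)"
  proof -
    have "(LBINT u=ereal 0..ereal 1. (u powr (a/2 - 1) * (1 - u) powr (1 - a/2 - 1)))
        = integral {0..1} (\<lambda>u. u powr (a/2 - 1) * (1 - u) powr (1 - a/2 - 1))"
      using beta by (intro interval_integral_eq_integral) auto
    also have "\<dots> = Beta (a/2) (1 - a/2)"
      by (rule integral_unique, rule has_integral_Beta_real) (use a in auto)
    finally show ?thesis .
  qed
  finally show "(LINT t:{0<..}|lborel. t powr (a - 1) / (1 + t\<^sup>2)) = Beta (a/2) (1 - a/2) / 2" by simp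
qed

text \<open>The classical normalising constant of the one-dimensional fractional Laplacian;
  \<open>levy_const_eq\<close> identifies it with \<open>levy_const\<close>.\<close>

definition riesz_const :: "real \<Rightarrow> real" where
  "riesz_const \<alpha> = \<alpha> * 2 powr (\<alpha> - 1) * Gamma ((1 + \<alpha>) / 2) / (sqrt pi * Gamma (1 - \<alpha>/2))"

text \<open>After the kernel is replaced by its Laplace representation, Tonelli allows integrating
  over z first, and t^(\<alpha>-1) / (1 + t^2) remains.\<close>

lemma has_bochner_integral_one_minus_cos:
  assumes \<alpha>: "0 < \<alpha>" "\<alpha> < 2"
  shows "has_bochner_integral lborel (\<lambda>z. indicator {0<..} z * ((1 - cos z) / z powr (1 + \<alpha>)))
           (1 / (2 * riesz_const \<alpha>))"
proof -
  define G where "G = Gamma (1 + \<alpha>)"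
  have G: "G > 0" using \<alpha> by (simp add: G_def)
  let ?f = "\<lambda>z. indicator {0<..} z * ((1 - cos z) / z powr (1 + \<alpha>))"
  let ?k = "\<lambda>z t. ennreal (indicator {0<..} z * indicator {0<..} t * ((1 - cos z) * (t powr \<alpha> * exp (- (z * t)))))"
  have "ennreal G * (\<integral>\<^sup>+z. ennreal (?f z) \<partial>lborel) = (\<integral>\<^sup>+z. ennreal G * ennreal (?f z) \<partial>lborel)"
    by (rule nn_integral_cmult[symmetric]) auto
  also have "\<dots> = (\<integral>\<^sup>+z. \<integral>\<^sup>+t. ?k z t \<partial>lborel \<partial>lborel)"
  proof (rule nn_integral_cong)
    fix z :: real
    show "ennreal G * ennreal (?f z) = (\<integral>\<^sup>+t. ?k z t \<partial>lborel)"
    proof (cases "z > 0")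
      case True
      have "(\<integral>\<^sup>+t. ?k z t \<partial>lborel) = (\<integral>\<^sup>+t. ennreal (1 - cos z) * ennreal (indicator {0<..} t * (t powr \<alpha> * exp (- (z * t)))) \<partial>lborel)"
        using True by (intro nn_integral_cong) (simp add: ennreal_mult' [symmetric] split: split_indicator)
      also have "\<dots> = ennreal (1 - cos z) * ennreal (G / z powr (1 + \<alpha>))"
        using Gamma_scaled_nn_integral[OF True \<alpha>(1)] by (subst nn_integral_cmult) (auto simp: G_def)
      also have "\<dots> = ennreal G * ennreal (?f z)"
        using True G by (simp add: ennreal_mult' [symmetric] mult.commute)
      finally show ?thesis by simp
    qed simp
  qed
  also have "\<dots> = (\<integral>\<^sup>+t. \<integral>\<^sup>+z. ?k z t \<partial>lborel \<partial>lborel)"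
    by (rule lborel_pair.Fubini') measurable
  also have "\<dots> = (\<integral>\<^sup>+t. ennreal (indicator {0<..} t * (t powr (\<alpha> - 1) / (1 + t\<^sup>2))) \<partial>lborel)"
  proof (rule nn_integral_cong)
    fix t :: real
    show "(\<integral>\<^sup>+z. ?k z t \<partial>lborel) = ennreal (indicator {0<..} t * (t powr (\<alpha> - 1) / (1 + t\<^sup>2)))"
    proof (cases "t > 0")
      case True
      have t2: "1 + t\<^sup>2 > 0" by (simp add: add_pos_nonneg)
      have "(\<integral>\<^sup>+z. ?k z t \<partial>lborel) = (\<integral>\<^sup>+z. ennreal (t powr \<alpha>) * ennreal (indicator {0<..} z * ((1 - cos z) * exp (- (z * t)))) \<partial>lborel)"
        using True by (intro nn_integral_cong) (simp add: ennreal_mult' [symmetric] mult_ac split: split_indicator)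
      also have "\<dots> = ennreal (t powr \<alpha>) * ennreal (1 / (t * (1 + t\<^sup>2)))"
        using nn_integral_one_minus_cos_exp[OF True] by (subst nn_integral_cmult) auto
      also have "\<dots> = ennreal (indicator {0<..} t * (t powr (\<alpha> - 1) / (1 + t\<^sup>2)))"
        using True t2 by (simp add: ennreal_mult' [symmetric] powr_diff field_simps)
      finally show ?thesis .
    qed simp
  qed
  also have "\<dots> = ennreal (Beta (\<alpha>/2) (1 - \<alpha>/2) / 2)"
  proof -
    have "(LINT t|lborel. indicator {0<..} t * (t powr (\<alpha> - 1) / (1 + t\<^sup>2))) = Beta (\<alpha>/2) (1 - \<alpha>/2) / 2"
      using LBINT_powr_div_1_plus_square[OF \<alpha>] unfolding set_lebesgue_integral_def real_scaleR_def .
    moreover have "(\<integral>\<^sup>+t. ennreal (indicator {0<..} t * (t powr (\<alpha> - 1) / (1 + t\<^sup>2))) \<partial>lborel) =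
        ennreal (LINT t|lborel. indicator {0<..} t * (t powr (\<alpha> - 1) / (1 + t\<^sup>2)))"
      by (rule nn_integral_eq_integral[OF integrable_powr_div_1_plus_square[OF \<alpha>, unfolded set_integrable_def real_scaleR_def]])
        auto
    ultimately show ?thesis by (simp only:)
  qed
  finally have main: "ennreal G * (\<integral>\<^sup>+z. ennreal (?f z) \<partial>lborel) = ennreal (Beta (\<alpha>/2) (1 - \<alpha>/2) / 2)" .
  have "(\<integral>\<^sup>+z. ennreal (?f z) \<partial>lborel) = ennreal (1 / G * G) * (\<integral>\<^sup>+z. ennreal (?f z) \<partial>lborel)"
    using G by simp
  also have "\<dots> = ennreal (1 / G) * (ennreal G * (\<integral>\<^sup>+z. ennreal (?f z) \<partial>lborel))"
    using G by (subst ennreal_mult) (auto simp: mult.assoc)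
  also have "\<dots> = ennreal (Beta (\<alpha>/2) (1 - \<alpha>/2) / 2 / G)"
    unfolding main using G by (subst ennreal_mult' [symmetric]) (auto simp: mult.commute)
  \<comment> \<open>Legendre's duplication formula at \<alpha>/2, taken over the complex numbers and
    brought back to the reals, eliminates Gamma(1 + \<alpha>).\<close>
  also have "Beta (\<alpha>/2) (1 - \<alpha>/2) / 2 / G = 1 / (2 * riesz_const \<alpha>)"
  proof -
    have "\<alpha>/2 \<notin> \<int>\<^sub>\<le>\<^sub>0" "\<alpha>/2 + 1/2 \<notin> \<int>\<^sub>\<le>\<^sub>0" using \<alpha> by (auto dest: nonpos_Ints_nonpos)
    then have "complex_of_real (Gamma (\<alpha>/2)) * complex_of_real (Gamma (\<alpha>/2 + 1/2)) =
        complex_of_real (exp ((1 - \<alpha>) * ln 2) * sqrt pi * Gamma \<alpha>)"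
      using Gamma_legendre_duplication[of "complex_of_real (\<alpha>/2)"] \<alpha>
        of_real_in_nonpos_Ints_iff[of "\<alpha>/2", where 'a=complex]
        of_real_in_nonpos_Ints_iff[of "\<alpha>/2 + 1/2", where 'a=complex]
      by (simp add: Gamma_complex_of_real[symmetric] exp_of_real[symmetric])
    then have "Gamma (\<alpha>/2) * Gamma (\<alpha>/2 + 1/2) = exp ((1 - \<alpha>) * ln 2) * sqrt pi * Gamma \<alpha>"
      unfolding of_real_mult [symmetric] of_real_eq_iff .
    then have leg: "Gamma (\<alpha>/2) * Gamma ((1 + \<alpha>)/2) = 2 powr (1 - \<alpha>) * sqrt pi * Gamma \<alpha>"
      by (simp add: powr_def add_divide_distrib add.commute)
    have GG: "G = \<alpha> * Gamma \<alpha>" using Gamma_plus1[of \<alpha>] \<alpha> nonpos_Ints_nonpos[of \<alpha>] by (auto simp: G_def add.commute)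
    have pos: "Gamma (\<alpha>/2) > 0" "Gamma ((1 + \<alpha>)/2) > 0" "Gamma \<alpha> > 0" "Gamma (1 - \<alpha>/2) > 0"
      using \<alpha> by simp_all
    have B: "Beta (\<alpha>/2) (1 - \<alpha>/2) = Gamma (\<alpha>/2) * Gamma (1 - \<alpha>/2)" by (simp add: Beta_def)
    have two: "2 powr (1 - \<alpha>) = 1 / 2 powr (\<alpha> - 1)"
      using powr_minus_divide[of 2 "\<alpha> - 1"] by simp
    have leg': "Gamma (\<alpha>/2) = sqrt pi * Gamma \<alpha> / (2 powr (\<alpha> - 1) * Gamma ((1 + \<alpha>)/2))"
      using leg pos unfolding two by (simp add: field_simps)
    show ?thesis unfolding B GG leg' riesz_const_def using pos[THEN less_imp_neq] \<alpha> by (auto simp: field_simps)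
  qed
  finally have fin: "(\<integral>\<^sup>+z. ennreal (?f z) \<partial>lborel) = ennreal (1 / (2 * riesz_const \<alpha>))" .
  show ?thesis
    by (rule has_bochner_integral_nn_integral[OF _ _ _ fin]) (use \<alpha> in \<open>auto simp: riesz_const_def\<close>)
qed

section \<open>The Fourier symbol of the Levy-Khintchine operator\<close>

lemma inverse_1_plus_square_integrable: "integrable lborel (\<lambda>x::real. 1 / (1 + x\<^sup>2))"
  using integrable_inverse_1_plus_square unfolding set_integrable_def
  by (simp add: einterval_def inverse_eq_divide)

text \<open>All that is needed of the Schwartz class: inverse quadratic decay of \<open>w\<close>
  and of its second derivative, enough to integrate second differences over the line.\<close>

lemma schwartz_bounds:
  assumes "schwartz w"
  obtains D where "\<And>x. (w has_real_derivative deriv w x) (at x)"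
    and "\<And>x. (deriv w has_real_derivative deriv (deriv w) x) (at x)"
    and "\<And>x. \<bar>w x\<bar> \<le> D / (1 + x\<^sup>2)" and "\<And>x. \<bar>deriv (deriv w) x\<bar> \<le> D / (1 + x\<^sup>2)"
proof -
  have d: "(deriv ^^ n) w field_differentiable at x" for n x
    using assms unfolding schwartz_def by auto
  have b: "\<exists>B. \<forall>x. \<bar>x\<bar> ^ m * \<bar>(deriv ^^ n) w x\<bar> \<le> B" for m n
    using assms unfolding schwartz_def by auto
  have ex: "\<exists>D. \<forall>x. \<bar>(deriv ^^ n) w x\<bar> \<le> D / (1 + x\<^sup>2)" for n
  proof -
    obtain B0 B2 where "\<And>x. \<bar>x\<bar> ^ 0 * \<bar>(deriv ^^ n) w x\<bar> \<le> B0" "\<And>x. \<bar>x\<bar> ^ 2 * \<bar>(deriv ^^ n) w x\<bar> \<le> B2"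
      using b by metis
    then have "(1 + x\<^sup>2) * \<bar>(deriv ^^ n) w x\<bar> \<le> B0 + B2" for x
      by (simp add: distrib_right add_mono)
    moreover have "1 + x\<^sup>2 > 0" for x :: real by (simp add: add_pos_nonneg)
    ultimately show ?thesis by (intro exI[of _ "B0 + B2"]) (auto simp: pos_le_divide_eq mult.commute)
  qed
  obtain D0 D2 where D: "\<And>x. \<bar>w x\<bar> \<le> D0 / (1 + x\<^sup>2)" "\<And>x. \<bar>deriv (deriv w) x\<bar> \<le> D2 / (1 + x\<^sup>2)"
    using ex[of 0] ex[of 2] by (auto simp: numeral_2_eq_2)
  have "D0 / (1 + x\<^sup>2) \<le> max D0 D2 / (1 + x\<^sup>2)" "D2 / (1 + x\<^sup>2) \<le> max D0 D2 / (1 + x\<^sup>2)" for x :: real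
    by (intro divide_right_mono; simp)+
  then have 1: "\<And>x. \<bar>w x\<bar> \<le> max D0 D2 / (1 + x\<^sup>2)" "\<And>x. \<bar>deriv (deriv w) x\<bar> \<le> max D0 D2 / (1 + x\<^sup>2)"
    using D order_trans by blast+
  have "\<And>x. (w has_real_derivative deriv w x) (at x)"
    "\<And>x. (deriv w has_real_derivative deriv (deriv w) x) (at x)"
    using d[of 0] d[of 1] by (auto simp: field_differentiable_derivI)
  then show ?thesis using 1 that by blast
qed

lemma riesz_const_pos: "0 < \<alpha> \<Longrightarrow> \<alpha> < 2 \<Longrightarrow> 0 < riesz_const \<alpha>"
  by (simp add: riesz_const_def)

text \<open>This is the symbol of \<open>sym_op\<close>, since 2 (1 - cos(z \<xi>)) is the
  multiplier of the second difference. Rescaling z by |\<xi>| reduces it to the previous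
  integral.\<close>

lemma integral_cos_kernel:
  assumes \<alpha>: "0 < \<alpha>" "\<alpha> < 2"
  shows "(LINT z|lborel. indicator {0<..} z * (2 * (1 - cos (z * \<xi>)) / z powr (1 + \<alpha>)))
           = \<bar>\<xi>\<bar> powr \<alpha> / riesz_const \<alpha>"
proof (cases "\<xi> = 0")
  case False
  let ?f = "\<lambda>z. indicator {0<..} z * ((1 - cos z) / z powr (1 + \<alpha>))"
  have "1 / (2 * riesz_const \<alpha>) = (LINT z|lborel. ?f z)"
    using has_bochner_integral_one_minus_cos[OF \<alpha>] by (simp add: has_bochner_integral_iff)
  also have "\<dots> = \<bar>\<xi>\<bar> * (LINT z|lborel. ?f (0 + \<bar>\<xi>\<bar> * z))"
    using False lborel_integral_real_affine[of "\<bar>\<xi>\<bar>" ?f 0] by simp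
  also have "(\<lambda>z. ?f (0 + \<bar>\<xi>\<bar> * z)) =
      (\<lambda>z. \<bar>\<xi>\<bar> powr (- 1 - \<alpha>) / 2 * (indicator {0<..} z * (2 * (1 - cos (z * \<xi>)) / z powr (1 + \<alpha>))))"
  proof
    fix z :: real
    have "cos (\<bar>\<xi>\<bar> * z) = cos (z * \<xi>)"
      by (cases "\<xi> \<ge> 0") (simp_all add: mult.commute)
    moreover have "\<bar>\<xi>\<bar> powr (- 1 - \<alpha>) = 1 / \<bar>\<xi>\<bar> powr (1 + \<alpha>)"
      using powr_minus_divide[of "\<bar>\<xi>\<bar>" "1 + \<alpha>"] by simp
    ultimately show "?f (0 + \<bar>\<xi>\<bar> * z) =
      \<bar>\<xi>\<bar> powr (- 1 - \<alpha>) / 2 * (indicator {0<..} z * (2 * (1 - cos (z * \<xi>)) / z powr (1 + \<alpha>)))"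
      using False by (cases "z > 0") (simp_all add: powr_mult zero_less_mult_iff field_simps)
  qed
  finally have "1 / (2 * riesz_const \<alpha>) = \<bar>\<xi>\<bar> * (\<bar>\<xi>\<bar> powr (- 1 - \<alpha>) / 2 *
      (LINT z|lborel. indicator {0<..} z * (2 * (1 - cos (z * \<xi>)) / z powr (1 + \<alpha>))))"
    unfolding integral_mult_right_zero .
  moreover have "\<bar>\<xi>\<bar> powr (- 1 - \<alpha>) = 1 / (\<bar>\<xi>\<bar> * \<bar>\<xi>\<bar> powr \<alpha>)"
    using powr_minus_divide[of "\<bar>\<xi>\<bar>" "1 + \<alpha>"] False by (simp add: powr_add)
  ultimately show ?thesis
    using False riesz_const_pos[OF \<alpha>] by (simp only:) (simp add: field_simps)
qed simp

text \<open>Translation by z multiplies the transform by \<open>cis (z * \<xi>)\<close>; the two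
  translations add up to twice a cosine.\<close>

lemma fourier_second_diff:
  assumes int: "integrable lborel w"
  shows "(LINT x|lborel. cis (- (x * \<xi>)) * complex_of_real (second_diff w x z)) =
           complex_of_real (2 * (1 - cos (z * \<xi>))) * fourier w \<xi>"
    and "integrable lborel (\<lambda>x. cis (- (x * \<xi>)) * complex_of_real (second_diff w x z))"
proof -
  have [measurable]: "w \<in> borel_measurable borel" using int by auto
  have [measurable]: "(\<lambda>x. cis (g x)) \<in> borel_measurable M" if "g \<in> borel_measurable M" for g and M :: "real measure"
    using that unfolding cis_conv_exp by measurable
  have g: "integrable lborel (\<lambda>x. cis (- (x * \<xi>)) * complex_of_real (w x))"
    by (rule Bochner_Integration.integrable_bound[OF int]) (auto simp: norm_mult)
  have sh: "integrable lborel (\<lambda>x. cis (- (x * \<xi>)) * complex_of_real (w (x + z)))"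
    "(LINT x|lborel. cis (- (x * \<xi>)) * complex_of_real (w (x + z))) = cis (z * \<xi>) * fourier w \<xi>" for z
  proof -
    have eq: "cis (- (x * \<xi>)) * complex_of_real (w (x + z)) =
        cis (z * \<xi>) * (cis (- ((z + 1 * x) * \<xi>)) * complex_of_real (w (z + 1 * x)))" for x
      unfolding mult.assoc[symmetric] cis_mult by (simp add: algebra_simps)
    show "integrable lborel (\<lambda>x. cis (- (x * \<xi>)) * complex_of_real (w (x + z)))"
      unfolding eq using lborel_integrable_real_affine[OF g, of 1 z] by (intro integrable_mult_right) auto
    show "(LINT x|lborel. cis (- (x * \<xi>)) * complex_of_real (w (x + z))) = cis (z * \<xi>) * fourier w \<xi>"
      unfolding eq integral_mult_right_zero fourier_def
      by (subst (2) lborel_integral_real_affine[of 1 _ z]) auto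
  qed
  note sh' = sh[of "- z", simplified]
  have eq: "cis (- (x * \<xi>)) * complex_of_real (second_diff w x z) =
      2 * (cis (- (x * \<xi>)) * complex_of_real (w x)) - cis (- (x * \<xi>)) * complex_of_real (w (x + z))
      - cis (- (x * \<xi>)) * complex_of_real (w (x - z))" for x
    by (simp add: second_diff_def algebra_simps)
  show "integrable lborel (\<lambda>x. cis (- (x * \<xi>)) * complex_of_real (second_diff w x z))"
    unfolding eq using g sh(1) sh'(1) by (intro Bochner_Integration.integrable_diff integrable_mult_right) auto
  have "(LINT x|lborel. cis (- (x * \<xi>)) * complex_of_real (second_diff w x z)) =
      2 * fourier w \<xi> - cis (z * \<xi>) * fourier w \<xi> - cis (- (z * \<xi>)) * fourier w \<xi>"
    unfolding eq using g sh(1) sh'(1)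
    by (subst Bochner_Integration.integral_diff, (intro Bochner_Integration.integrable_diff integrable_mult_right; simp),
        simp, subst Bochner_Integration.integral_diff)
       (auto simp: sh sh' fourier_def[symmetric])
  also have "\<dots> = complex_of_real (2 * (1 - cos (z * \<xi>))) * fourier w \<xi>"
  proof -
    have "2 - cis (z * \<xi>) - cis (- (z * \<xi>)) = complex_of_real (2 * (1 - cos (z * \<xi>)))"
      by (simp add: complex_eq_iff)
    then show ?thesis by (metis left_diff_distrib)
  qed
  finally show "(LINT x|lborel. cis (- (x * \<xi>)) * complex_of_real (second_diff w x z)) =
           complex_of_real (2 * (1 - cos (z * \<xi>))) * fourier w \<xi>" .
qed

text \<open>Fubini in (z, x). The required integrability comes from the L^1 norm in x of the second
  difference, which is O(z^2) for small z and bounded for large z.\<close>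

lemma fourier_levy_khintchine:
  assumes \<alpha>: "0 < \<alpha>" "\<alpha> < 2" and w: "schwartz w"
  shows "fourier (levy_khintchine C \<alpha> w) \<xi> =
           complex_of_real (C / riesz_const \<alpha> * \<bar>\<xi>\<bar> powr \<alpha>) * fourier w \<xi>"
proof -
  obtain D where d: "\<And>x. (w has_real_derivative deriv w x) (at x)"
      "\<And>x. (deriv w has_real_derivative deriv (deriv w) x) (at x)"
    and D: "\<And>x. \<bar>w x\<bar> \<le> D / (1 + x\<^sup>2)" "\<And>x. \<bar>deriv (deriv w) x\<bar> \<le> D / (1 + x\<^sup>2)"
    using schwartz_bounds[OF w] by metis
  have D0: "0 \<le> D" using D(1)[of 0] by simp
  have x2: "1 + x\<^sup>2 > 0" for x :: real by (simp add: add_pos_nonneg)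
  have Dle: "D / (1 + x\<^sup>2) \<le> D" for x using D0 x2[of x] by (simp add: divide_le_eq_1 field_simps)
  have wD: "\<bar>w x\<bar> \<le> D" "\<bar>deriv (deriv w) x\<bar> \<le> D" for x using D[of x] Dle[of x] by auto
  have "continuous_on UNIV w" using d(1) by (intro continuous_at_imp_continuous_on) (auto intro: DERIV_isCont)
  then have m[measurable]: "w \<in> borel_measurable borel" by (rule borel_measurable_continuous_onI)
  have lk: "levy_khintchine C \<alpha> w x = C * sym_op \<alpha> w x" for x
  proof (rule levy_khintchine_eq_sym_op(1)[OF \<alpha> m wD(1), of 1])
    show "\<bar>w (x + z) - w x - z * deriv w x\<bar> \<le> D / 2 * z\<^sup>2" for z
      by (rule Taylor_bound[OF d wD(2)])
  qed simp
  define J where "J = (LINT x|lborel. 1 / (1 + x\<^sup>2 :: real))"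
  have [measurable]: "(\<lambda>p. cis (g p)) \<in> borel_measurable M" if "g \<in> borel_measurable M" for g and M :: "(real \<times> real) measure"
    using that unfolding cis_conv_exp by measurable
  have intw: "integrable lborel w"
    by (rule Bochner_Integration.integrable_bound[OF integrable_mult_right[OF inverse_1_plus_square_integrable, of D]])
       (use D x2 D0 in \<open>auto simp: less_imp_le abs_of_nonneg\<close>)
  let ?k = "\<lambda>z x. cis (- (x * \<xi>)) * complex_of_real (levy_quotient \<alpha> w x z)"
  have kk: "?k z x = complex_of_real (indicator {0<..} z / z powr (1 + \<alpha>)) * (cis (- (x * \<xi>)) * complex_of_real (second_diff w x z))" for z x
    by simp
  have sd_abs: "integrable lborel (\<lambda>x. \<bar>second_diff w x z\<bar>)" for z
    using integrable_norm[OF fourier_second_diff(2)[OF intw, of \<xi> z]] by (simp add: norm_mult)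
  have bd: "(LINT x|lborel. \<bar>second_diff w x z\<bar>) \<le> 3 * D * J * z powr 2" if z: "0 < z" "z \<le> 1" for z
  proof -
    have "\<bar>second_diff w x z\<bar> \<le> 3 * D * z\<^sup>2 * (1 / (1 + x\<^sup>2))" for x
    proof -
      have "\<bar>second_diff w x z\<bar> \<le> 3 * D / (1 + x\<^sup>2) * z\<^sup>2"
      proof (rule second_diff_Taylor[OF d])
        fix y assume y: "\<bar>y - x\<bar> \<le> \<bar>z\<bar>"
        define e where "e = (x - y)\<^sup>2"
        have "e \<le> 1" using y z by (simp add: e_def abs_square_le_1 abs_minus_commute)
        \<comment> \<open>The right side minus the left is (x - 2y)^2 + y^2. Hence the weight 1 +
          x^2 changes by at most a factor 3 over a unit distance, and decay at x controls the
          intermediate points of the Taylor estimate.\<close>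
        moreover have "1 + x\<^sup>2 \<le> 3 * (1 + y\<^sup>2) + 2 * (e - 1)"
          using sum_squares_ge_zero[of "x - 2 * y" y] by (simp add: e_def power2_eq_square algebra_simps)
        ultimately have "1 + x\<^sup>2 \<le> 3 * (1 + y\<^sup>2)" by (smt (verit))
        then have "D / (1 + y\<^sup>2) \<le> 3 * D / (1 + x\<^sup>2)"
          using x2[of x] x2[of y] D0 mult_left_mono[of "1 + x\<^sup>2" "3 * (1 + y\<^sup>2)" D] by (simp add: field_simps)
        then show "\<bar>deriv (deriv w) y\<bar> \<le> 3 * D / (1 + x\<^sup>2)" using D(2)[of y] by linarith
      qed
      then show ?thesis by (simp add: mult_ac)
    qed
    then have "(LINT x|lborel. \<bar>second_diff w x z\<bar>) \<le> (LINT x|lborel. 3 * D * z\<^sup>2 * (1 / (1 + x\<^sup>2)))"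
      by (intro integral_mono sd_abs integrable_mult_right inverse_1_plus_square_integrable)
    then show ?thesis using z unfolding integral_mult_right_zero J_def by (simp add: mult_ac)
  qed
  define E where "E = (LINT x|lborel. \<bar>w x\<bar>)"
  have bd': "(LINT x|lborel. \<bar>second_diff w x z\<bar>) \<le> 4 * E" for z
  proof -
    have i: "integrable lborel (\<lambda>x. \<bar>w (x + z)\<bar>)" "(LINT x|lborel. \<bar>w (x + z)\<bar>) = E" for z
      using lborel_integrable_real_affine[OF integrable_abs[OF intw], of 1 z]
        lborel_integral_real_affine[of 1 "\<lambda>x. \<bar>w x\<bar>" z] by (auto simp: E_def add.commute)
    note i' = i[of "- z", simplified]
    have "(LINT x|lborel. \<bar>second_diff w x z\<bar>) \<le> (LINT x|lborel. 2 * \<bar>w x\<bar> + \<bar>w (x + z)\<bar> + \<bar>w (x - z)\<bar>)"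
      using i i' intw sd_abs[of z] by (intro integral_mono) (auto simp: second_diff_def)
    also have "\<dots> = 4 * E"
      using i i' intw by (simp add: E_def[symmetric])
    finally show ?thesis .
  qed
  have E0: "E \<ge> 0" unfolding E_def by simp
  have int: "integrable (lborel \<Otimes>\<^sub>M lborel) (\<lambda>(z, x). ?k z x)"
  proof (rule lborel_pair.Fubini_integrable)
    show "(\<lambda>(z, x). ?k z x) \<in> borel_measurable (lborel \<Otimes>\<^sub>M lborel)"
      unfolding second_diff_def by measurable
    have n: "(LINT x|lborel. norm (case (z, x) of (z, x) \<Rightarrow> ?k z x)) =
        indicator {0<..} z * ((LINT x|lborel. \<bar>second_diff w x z\<bar>) / z powr (1 + \<alpha>))" for z
      by (simp add: norm_mult norm_divide split: split_indicator)
    show "integrable lborel (\<lambda>z. LINT x|lborel. norm (case (z, x) of (z, x) \<Rightarrow> ?k z x))"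
      unfolding n
    proof (rule integrable_levy_kernel[of \<alpha> 2 _ "3 * D * J" "4 * E"])
      show "(\<lambda>z. LINT x|lborel. \<bar>second_diff w x z\<bar>) \<in> borel_measurable borel"
        unfolding second_diff_def by measurable
    qed (use \<alpha> bd bd' in auto)
    show "AE z in lborel. integrable lborel (\<lambda>x. case (z, x) of (z, x) \<Rightarrow> ?k z x)"
      unfolding split kk using fourier_second_diff(2)[OF intw] by (intro AE_I2 integrable_mult_right)
  qed
  have "fourier (levy_khintchine C \<alpha> w) \<xi> = (LINT x|lborel. complex_of_real C * (LINT z|lborel. ?k z x))"
    unfolding fourier_def lk sym_op_def integral_mult_right_zero integral_complex_of_real of_real_mult[of C]
    by (simp only: mult.left_commute[of "cis _"] integral_mult_right_zero)
  also have "\<dots> = complex_of_real C * (LINT z|lborel. LINT x|lborel. ?k z x)"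
    using lborel_pair.Fubini_integral[OF int] by simp
  also have "(\<lambda>z. LINT x|lborel. ?k z x) =
      (\<lambda>z. complex_of_real (indicator {0<..} z * (2 * (1 - cos (z * \<xi>)) / z powr (1 + \<alpha>))) * fourier w \<xi>)"
    unfolding kk integral_mult_right_zero fourier_second_diff(1)[OF intw] by (simp add: fun_eq_iff)
  also have "(LINT z|lborel. complex_of_real (indicator {0<..} z * (2 * (1 - cos (z * \<xi>)) / z powr (1 + \<alpha>))) * fourier w \<xi>)
      = complex_of_real (\<bar>\<xi>\<bar> powr \<alpha> / riesz_const \<alpha>) * fourier w \<xi>"
    unfolding integral_mult_left_zero integral_complex_of_real integral_cos_kernel[OF \<alpha>] ..
  finally show ?thesis by simp
qed

section \<open>Uniqueness of the constant, by testing with a Gaussian\<close>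

text \<open>The k-th power of |x| <= k exp(x^2 / (2k)), which follows from 1 + u <= exp u.\<close>

lemma abs_power_gaussian_bounded: "\<exists>B. \<forall>x::real. \<bar>x\<bar> ^ k * exp (- x\<^sup>2 / 2) \<le> B"
proof -
  have "\<bar>x\<bar> ^ k * exp (- x\<^sup>2 / 2) \<le> real k ^ k" for x :: real
  proof (cases "k = 0")
    case False
    define y where "y = x\<^sup>2 / 2"
    have "\<bar>x\<bar> \<le> 1 + y"
      using sum_squares_ge_zero[of "\<bar>x\<bar> - 1" 0] by (simp add: y_def algebra_simps power2_eq_square)
    also have "\<dots> \<le> real k * (1 + y / real k)" using False by (simp add: field_simps)
    also have "\<dots> \<le> real k * exp (y / real k)" using exp_ge_add_one_self[of "y / real k"] by (intro mult_left_mono) auto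
    finally have "\<bar>x\<bar> ^ k \<le> (real k * exp (y / real k)) ^ k" by (intro power_mono) auto
    also have "\<dots> = real k ^ k * exp y"
      using False by (simp add: power_mult_distrib exp_of_nat_mult[symmetric])
    finally have "\<bar>x\<bar> ^ k * exp (- y) \<le> real k ^ k * exp y * exp (- y)" by (intro mult_right_mono) auto
    then show ?thesis by (simp add: y_def mult.assoc exp_minus)
  qed simp
  then show ?thesis by blast
qed

lemma abs_power_poly_gaussian_bounded: "\<exists>B. \<forall>x::real. \<bar>x\<bar> ^ m * \<bar>poly p x * exp (- x\<^sup>2 / 2)\<bar> \<le> B"
proof (induction p arbitrary: m)
  case (pCons a p)
  obtain B1 where B1: "\<And>x::real. \<bar>x\<bar> ^ m * exp (- x\<^sup>2 / 2) \<le> B1" using abs_power_gaussian_bounded by metis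
  obtain B2 where B2: "\<And>x::real. \<bar>x\<bar> ^ Suc m * \<bar>poly p x * exp (- x\<^sup>2 / 2)\<bar> \<le> B2" using pCons.IH by metis
  have "\<bar>x\<bar> ^ m * \<bar>poly (pCons a p) x * exp (- x\<^sup>2 / 2)\<bar> \<le> \<bar>a\<bar> * B1 + B2" for x
  proof -
    have "\<bar>x\<bar> ^ m * \<bar>poly (pCons a p) x * exp (- x\<^sup>2 / 2)\<bar> \<le>
        \<bar>x\<bar> ^ m * (\<bar>a\<bar> * exp (- x\<^sup>2 / 2) + \<bar>x\<bar> * \<bar>poly p x * exp (- x\<^sup>2 / 2)\<bar>)"
      by (intro mult_left_mono)
         (auto simp: abs_mult distrib_right[symmetric] mult.assoc[symmetric]
               intro!: mult_right_mono order_trans[OF abs_triangle_ineq])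
    also have "\<dots> = \<bar>a\<bar> * (\<bar>x\<bar> ^ m * exp (- x\<^sup>2 / 2)) + \<bar>x\<bar> ^ Suc m * \<bar>poly p x * exp (- x\<^sup>2 / 2)\<bar>"
      by (simp add: algebra_simps)
    also have "\<dots> \<le> \<bar>a\<bar> * B1 + B2" using B1 B2 by (intro add_mono mult_left_mono) auto
    finally show ?thesis .
  qed
  then show ?case by blast
qed auto

text \<open>Every derivative is a polynomial times the Gaussian, with p replaced by p' - x p at each
  differentiation.\<close>

lemma schwartz_gaussian: "schwartz (\<lambda>x. exp (- x\<^sup>2 / 2))"
proof -
  let ?w = "\<lambda>x::real. exp (- x\<^sup>2 / 2)"
  have der: "((\<lambda>x. poly p x * ?w x) has_real_derivative poly (pderiv p - pCons 0 p) x * ?w x) (at x)" for p x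
    by (auto intro!: derivative_eq_intros poly_DERIV simp: algebra_simps)
  have ex: "\<exists>p. (deriv ^^ n) ?w = (\<lambda>x. poly p x * ?w x)" for n
  proof (induction n)
    case 0
    show ?case by (intro exI[of _ 1]) auto
  next
    case (Suc n)
    then obtain p where "(deriv ^^ n) ?w = (\<lambda>x. poly p x * ?w x)" by blast
    then show ?case using DERIV_imp_deriv[OF der[of p]] by (intro exI[of _ "pderiv p - pCons 0 p"]) auto
  qed
  show ?thesis
    unfolding schwartz_def
  proof (intro conjI allI)
    fix n x
    obtain p where p: "(deriv ^^ n) ?w = (\<lambda>x. poly p x * ?w x)" using ex by blast
    show "(deriv ^^ n) ?w field_differentiable at x"
      unfolding p using der field_differentiable_def by blast
  next
    fix m n
    obtain p where p: "(deriv ^^ n) ?w = (\<lambda>x. poly p x * ?w x)" using ex by blast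
    show "\<exists>B. \<forall>x. \<bar>x\<bar> ^ m * \<bar>(deriv ^^ n) ?w x\<bar> \<le> B"
      unfolding p by (rule abs_power_poly_gaussian_bounded)
  qed
qed

text \<open>At frequency -1 the Fourier kernel is exp(ix), so the transform is a multiple of the
  characteristic function of the standard normal law at 1.\<close>

lemma fourier_gaussian_nonzero: "fourier (\<lambda>x. exp (- x\<^sup>2 / 2)) (- 1) \<noteq> 0"
proof
  assume 0: "fourier (\<lambda>x. exp (- x\<^sup>2 / 2)) (- 1) = 0"
  have "char std_normal_distribution 1 = (CLINT x|lborel. complex_of_real (std_normal_density x) * iexp x)"
    unfolding char_def by (subst integral_density) (auto simp: scaleR_conv_of_real)
  also have "\<dots> = (CLINT x|lborel. complex_of_real (1 / sqrt (2 * pi)) * (cis (- (x * (- 1))) * complex_of_real (exp (- x\<^sup>2 / 2))))"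
    by (intro Bochner_Integration.integral_cong refl)
       (simp add: normal_density_def cis_conv_exp mult_ac)
  also have "\<dots> = 0" using 0 unfolding fourier_def integral_mult_right_zero by simp
  finally show False by (simp add: char_std_normal_distribution)
qed

text \<open>The definite description also demands uniqueness. A single Schwartz function with
  nonzero transform at a frequency of modulus 1 determines the constant.\<close>

lemma levy_const_eq:
  assumes \<alpha>: "0 < \<alpha>" "\<alpha> < 2"
  shows "levy_const \<alpha> = riesz_const \<alpha>"
  unfolding levy_const_def
proof (rule the_equality)
  show "0 < riesz_const \<alpha> \<and> (\<forall>w. schwartz w \<longrightarrow>
      (\<forall>\<xi>. fourier (levy_khintchine (riesz_const \<alpha>) \<alpha> w) \<xi> = complex_of_real (\<bar>\<xi>\<bar> powr \<alpha>) * fourier w \<xi>))"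
    using riesz_const_pos[OF \<alpha>] fourier_levy_khintchine[OF \<alpha>] by simp
next
  fix C
  assume "C > 0 \<and> (\<forall>w. schwartz w \<longrightarrow>
      (\<forall>\<xi>. fourier (levy_khintchine C \<alpha> w) \<xi> = complex_of_real (\<bar>\<xi>\<bar> powr \<alpha>) * fourier w \<xi>))"
  then have "complex_of_real (C / riesz_const \<alpha> * \<bar>- 1\<bar> powr \<alpha>) * fourier (\<lambda>x. exp (- x\<^sup>2 / 2)) (- 1) =
      complex_of_real (\<bar>- 1\<bar> powr \<alpha>) * fourier (\<lambda>x. exp (- x\<^sup>2 / 2)) (- 1)"
    using fourier_levy_khintchine[OF \<alpha> schwartz_gaussian, of C "- 1"] schwartz_gaussian by metis
  then have "complex_of_real (C / riesz_const \<alpha>) = complex_of_real 1"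
    using fourier_gaussian_nonzero by (simp del: of_real_divide)
  then have "C / riesz_const \<alpha> = 1" unfolding of_real_eq_iff .
  then show "C = riesz_const \<alpha>" using riesz_const_pos[OF \<alpha>] by (simp add: field_simps)
qed

section \<open>The principal value integral of the profile density\<close>

text \<open>Subadditivity of a concave power: the fractions t/s and (s-t)/s add up to 1, and p <= p
  powr b on [0,1].\<close>

lemma powr_diff_le_powr:
  fixes s t b :: real
  assumes "0 < b" "b \<le> 1" "0 \<le> s" "0 \<le> t"
  shows "\<bar>s powr b - t powr b\<bar> \<le> \<bar>s - t\<bar> powr b"
proof -
  have key: "s powr b \<le> t powr b + (s - t) powr b" if "0 \<le> t" "t \<le> s" "0 < s" for s t :: real
  proof -
    have le: "p \<le> p powr b" if "0 \<le> p" "p \<le> 1" for p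
      using powr_mono'[of b 1 p] assms that by (cases "p = 0") auto
    have "1 \<le> (t / s) powr b + ((s - t) / s) powr b"
    proof -
      have "t / s + (s - t) / s = 1" using that by (simp add: field_simps)
      moreover have "t / s \<le> (t / s) powr b" "(s - t) / s \<le> ((s - t) / s) powr b"
        using that by (auto intro!: le)
      ultimately show ?thesis by linarith
    qed
    also have "\<dots> = (t powr b + (s - t) powr b) / s powr b"
      using that by (simp add: powr_divide add_divide_distrib)
    finally show ?thesis using that by (simp add: field_simps)
  qed
  show ?thesis
  proof (cases s t rule: linorder_cases)
    case less
    then have "s powr b \<le> t powr b" using assms by (intro powr_mono2) auto
    then show ?thesis using key[of s t] less assms by (simp add: abs_minus_commute)
  next
    case greater
    then have "t powr b \<le> s powr b" using assms by (intro powr_mono2) auto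
    then show ?thesis using key[of t s] greater assms by simp
  qed simp
qed

text \<open>The density \<open>profile_v\<close> up to its constant, for b = \<alpha>/2. Truncation
  at 0 together with \<open>0 powr b = 0\<close> gives one formula on the whole line.\<close>

definition bump :: "real \<Rightarrow> real \<Rightarrow> real" where
  "bump b y = max 0 (1 - y\<^sup>2) powr b"

lemma bump_even [simp]: "bump b (- y) = bump b y"
  by (simp add: bump_def)

lemma bump_nonneg [simp]: "0 \<le> bump b y"
  by (simp add: bump_def)

lemma bump_le_1: "0 < b \<Longrightarrow> bump b y \<le> 1"
  unfolding bump_def using powr_mono2[of b "max 0 (1 - y\<^sup>2)" 1] by simp

lemma bump_eq_0: "1 \<le> \<bar>y\<bar> \<Longrightarrow> bump b y = 0"
  by (simp add: bump_def abs_square_le_1[symmetric] abs_le_square_iff[of 1 y, simplified])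

lemma bump_pos: "\<bar>y\<bar> < 1 \<Longrightarrow> 0 < bump b y"
  using abs_square_less_1[of y] by (auto simp: bump_def)

lemma continuous_on_bump: "0 < b \<Longrightarrow> continuous_on S (bump b)"
  unfolding bump_def [abs_def] by (intro continuous_on_powr' continuous_intros) auto

text \<open>Clamping the argument to [-1,1] does not change the truncated 1 - y^2, and there 1 - y^2
  is Lipschitz with constant 2.\<close>

lemma bump_hoelder:
  assumes "0 < b" "b \<le> 1"
  shows "\<bar>bump b x - bump b y\<bar> \<le> (2 * \<bar>x - y\<bar>) powr b"
proof -
  have clamp: "\<exists>x'. \<bar>x'\<bar> \<le> 1 \<and> max 0 (1 - x\<^sup>2) = 1 - x'\<^sup>2 \<and> x' = max (-1) (min 1 x)" for x :: real
  proof (cases "\<bar>x\<bar> \<le> 1")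
    case True
    then show ?thesis by (intro exI[of _ x]) (auto simp: abs_square_le_1 abs_le_iff)
  next
    case False
    then have "1 - x\<^sup>2 \<le> 0" using abs_square_le_1[of x] by linarith
    with False show ?thesis by (intro exI[of _ "max (-1) (min 1 x)"]) (auto simp: max_def min_def power2_eq_1_iff abs_if split: if_splits)
  qed
  obtain x' y' where x': "\<bar>x'\<bar> \<le> 1" "max 0 (1 - x\<^sup>2) = 1 - x'\<^sup>2" "x' = max (-1) (min 1 x)"
    and y': "\<bar>y'\<bar> \<le> 1" "max 0 (1 - y\<^sup>2) = 1 - y'\<^sup>2" "y' = max (-1) (min 1 y)"
    using clamp[of x] clamp[of y] by blast
  have "\<bar>(1 - x'\<^sup>2) - (1 - y'\<^sup>2)\<bar> = \<bar>x' + y'\<bar> * \<bar>x' - y'\<bar>"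
    by (simp add: abs_mult[symmetric] power2_eq_square algebra_simps abs_minus_commute)
  also have "\<dots> \<le> 2 * \<bar>x - y\<bar>"
  proof (rule mult_mono)
    show "\<bar>x' + y'\<bar> \<le> 2" using x'(1) y'(1) by linarith
    show "\<bar>x' - y'\<bar> \<le> \<bar>x - y\<bar>" unfolding x'(3) y'(3) by (auto simp: max_def min_def)
  qed auto
  finally have "\<bar>max 0 (1 - x\<^sup>2) - max 0 (1 - y\<^sup>2)\<bar> powr b \<le> (2 * \<bar>x - y\<bar>) powr b"
    unfolding x'(2) y'(2) using assms by (intro powr_mono2) auto
  then show ?thesis
    unfolding bump_def using powr_diff_le_powr[OF assms, of "max 0 (1 - x\<^sup>2)" "max 0 (1 - y\<^sup>2)"] by simp
qed

section \<open>The Moebius and Beta substitutions\<close>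

text \<open>The Moebius automorphism of \<open>(-1,1)\<close> sending \<open>0\<close> to \<open>x\<close> turns the kernel centred at \<open>x\<close>
  into one centred at \<open>0\<close>.\<close>

lemma moebius_substitution:
  fixes x \<epsilon> \<alpha> :: real
  assumes x: "\<bar>x\<bar> < 1" and \<epsilon>: "0 < \<epsilon>" "\<epsilon> < 1" and \<alpha>: "0 < \<alpha>"
  shows "((\<lambda>s. (1 - x\<^sup>2) powr (1 - \<alpha>/2) * ((1 - s\<^sup>2) powr (\<alpha>/2) * s powr (- \<alpha>) / (1 + x * s)\<^sup>2)) has_integral
           integral {\<epsilon> * (1 - x\<^sup>2) / (1 + x * \<epsilon>)..1 - x} (\<lambda>r. bump (\<alpha>/2) (x + r) * r powr (- \<alpha>))) {\<epsilon>..1}"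
proof -
  have q: "0 < 1 - x\<^sup>2" using x by (simp add: abs_square_less_1)
  have xs: "0 < 1 + x * s" if "s \<in> {\<epsilon>..1}" for s
  proof -
    have "\<bar>x * s\<bar> \<le> \<bar>x\<bar> * 1" unfolding abs_mult using that \<epsilon> by (intro mult_left_mono) auto
    then show ?thesis using x by linarith
  qed
  \<comment> \<open>The displacement of the Moebius map: x + g(s) = (x + s) / (1 + x s).\<close>
  define g where "g s = s * (1 - x\<^sup>2) / (1 + x * s)" for s
  have der: "(g has_field_derivative (1 - x\<^sup>2) / (1 + x * s)\<^sup>2) (at s within {\<epsilon>..1})" if "s \<in> {\<epsilon>..1}" for s
    unfolding g_def [abs_def] using xs[OF that]
    by (auto intro!: derivative_eq_intros simp: power2_eq_square field_simps)
  have mono: "g s \<le> g s'" if "s \<in> {\<epsilon>..1}" "s' \<in> {\<epsilon>..1}" "s \<le> s'" for s s'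
  proof -
    have "s * (1 + x * s') \<le> s' * (1 + x * s)" using that by (simp add: algebra_simps)
    then have "s / (1 + x * s) \<le> s' / (1 + x * s')" using xs[OF that(1)] xs[OF that(2)] by (simp add: field_simps)
    from mult_right_mono[OF this, of "1 - x\<^sup>2"] show ?thesis using q by (simp add: g_def)
  qed
  have g1: "g 1 = 1 - x"
    using xs[of 1] \<epsilon> by (simp add: g_def field_simps power2_eq_square)
  have gpos: "0 < g s" if "s \<in> {\<epsilon>..1}" for s using that xs[OF that] q \<epsilon> by (simp add: g_def)
  have "((\<lambda>s. ((1 - x\<^sup>2) / (1 + x * s)\<^sup>2) *\<^sub>R (bump (\<alpha>/2) (x + g s) * g s powr (- \<alpha>))) has_integral
      integral {g \<epsilon>..g 1} (\<lambda>r. bump (\<alpha>/2) (x + r) * r powr (- \<alpha>))) {\<epsilon>..1}"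
  proof (rule has_integral_substitution[where c="g \<epsilon>" and d="g 1"])
    show "g ` {\<epsilon>..1} \<subseteq> {g \<epsilon>..g 1}" using mono \<epsilon> by auto
    have "continuous_on {g \<epsilon>..g 1} (\<lambda>r. bump (\<alpha>/2) (x + r))"
      by (rule continuous_on_compose2[OF continuous_on_bump[of "\<alpha>/2" UNIV]]) (use \<alpha> in \<open>auto intro!: continuous_intros\<close>)
    then show "continuous_on {g \<epsilon>..g 1} (\<lambda>r. bump (\<alpha>/2) (x + r) * r powr (- \<alpha>))"
      using gpos[of \<epsilon>] \<epsilon> by (intro continuous_intros) auto
  qed (use \<epsilon> mono[of \<epsilon> 1] der in auto)
  then show ?thesis
    unfolding g1 g_def[of \<epsilon>]
  proof (rule has_integral_eq[rotated])
    show "((1 - x\<^sup>2) / (1 + x * s)\<^sup>2) *\<^sub>R (bump (\<alpha>/2) (x + g s) * g s powr (- \<alpha>)) =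
        (1 - x\<^sup>2) powr (1 - \<alpha>/2) * ((1 - s\<^sup>2) powr (\<alpha>/2) * s powr (- \<alpha>) / (1 + x * s)\<^sup>2)" if s: "s \<in> {\<epsilon>..1}" for s
    proof -
      have s1: "0 \<le> 1 - s\<^sup>2" using s \<epsilon> by (simp add: abs_square_le_1)
      define d where "d = 1 + x * s"
      have d: "0 < d" using xs[OF s] by (simp add: d_def)
      have "1 - (x + g s)\<^sup>2 = (1 - x\<^sup>2) * (1 - s\<^sup>2) / d\<^sup>2"
      proof -
        have "x + g s = (x + s) / d" using d unfolding g_def d_def[symmetric]
          by (simp add: field_simps) (simp add: d_def power2_eq_square algebra_simps)
        then have "1 - (x + g s)\<^sup>2 = (d\<^sup>2 - (x + s)\<^sup>2) / d\<^sup>2" using d by (simp add: power_divide diff_divide_distrib)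
        also have "d\<^sup>2 - (x + s)\<^sup>2 = (1 - x\<^sup>2) * (1 - s\<^sup>2)" by (simp add: d_def power2_eq_square algebra_simps)
        finally show ?thesis .
      qed
      then have "bump (\<alpha>/2) (x + g s) = ((1 - x\<^sup>2) * (1 - s\<^sup>2) / d\<^sup>2) powr (\<alpha>/2)"
        using q s1 by (simp add: bump_def)
      also have "\<dots> = (1 - x\<^sup>2) powr (\<alpha>/2) * (1 - s\<^sup>2) powr (\<alpha>/2) / d powr \<alpha>"
      proof -
        have "(d\<^sup>2) powr (\<alpha>/2) = d powr \<alpha>" using d by (simp add: powr_powr flip: powr_numeral)
        then show ?thesis using q s1 d by (simp add: powr_divide powr_mult)
      qed
      finally have 1: "bump (\<alpha>/2) (x + g s) = (1 - x\<^sup>2) powr (\<alpha>/2) * (1 - s\<^sup>2) powr (\<alpha>/2) / d powr \<alpha>" .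
      have 2: "g s powr (- \<alpha>) = s powr (- \<alpha>) * (1 - x\<^sup>2) powr (- \<alpha>) * d powr \<alpha>"
      proof -
        have "g s powr (- \<alpha>) = s powr (- \<alpha>) * (1 - x\<^sup>2) powr (- \<alpha>) / d powr (- \<alpha>)"
          using s \<epsilon> q d unfolding g_def d_def[symmetric] by (subst powr_divide) (auto simp: powr_mult)
        then show ?thesis by (simp add: powr_minus_divide[of d])
      qed
      \<comment> \<open>The power d^\<alpha> from the bump cancels the one from the kernel, because
        the bump has exponent \<alpha>/2. Only the d^2 of the Jacobian survives.\<close>
      have frac: "(q / d\<^sup>2) * (A * B / e * (C * D * e)) = q * (A * D) * (B * C / d\<^sup>2)" if "e \<noteq> 0" for q A B C D e :: real
        using that by simp
      have 3: "(1 - x\<^sup>2) powr (1 - \<alpha>/2) = (1 - x\<^sup>2) * ((1 - x\<^sup>2) powr (\<alpha>/2) * (1 - x\<^sup>2) powr (- \<alpha>))"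
        using q by (simp add: powr_add[symmetric] powr_mult_base)
      show ?thesis unfolding 1 2 3 d_def[symmetric] real_scaleR_def by (rule frac) (use d in auto)
    qed
  qed
qed

text \<open>The integrand in s is the difference of the two Moebius-transformed sides. With t the
  image of s, 1 - t = (1 - s^2) / (1 - x^2 s^2), so it becomes a product of powers of t and 1 -
  t.\<close>

lemma beta_substitution:
  fixes x \<epsilon> \<alpha> :: real
  assumes x: "\<bar>x\<bar> < 1" and \<epsilon>: "0 < \<epsilon>" "\<epsilon> < 1" and \<alpha>: "0 < \<alpha>"
  shows "((\<lambda>s. (1 - x\<^sup>2) powr (1 - \<alpha>/2) * ((1 - s\<^sup>2) powr (\<alpha>/2) * s powr (- \<alpha>) * (4 * x * s) / (1 - x\<^sup>2 * s\<^sup>2)\<^sup>2)) has_integral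
           2 * x * integral {\<epsilon>\<^sup>2 * (1 - x\<^sup>2) / (1 - x\<^sup>2 * \<epsilon>\<^sup>2)..1} (\<lambda>t. t powr (- (\<alpha>/2)) * (1 - t) powr (\<alpha>/2))) {\<epsilon>..1}"
proof -
  have q: "0 < 1 - x\<^sup>2" using x by (simp add: abs_square_less_1)
  have xs: "0 < 1 - x\<^sup>2 * s\<^sup>2" if "s \<in> {\<epsilon>..1}" for s
  proof -
    have "s\<^sup>2 \<le> 1" using that \<epsilon> by (simp add: abs_square_le_1)
    then have "x\<^sup>2 * s\<^sup>2 \<le> x\<^sup>2 * 1" by (intro mult_left_mono) auto
    then show ?thesis using q by linarith
  qed
  define g where "g s = s\<^sup>2 * (1 - x\<^sup>2) / (1 - x\<^sup>2 * s\<^sup>2)" for s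
  have der: "(g has_field_derivative 2 * s * (1 - x\<^sup>2) / (1 - x\<^sup>2 * s\<^sup>2)\<^sup>2) (at s within {\<epsilon>..1})" if "s \<in> {\<epsilon>..1}" for s
    unfolding g_def [abs_def] using xs[OF that]
    by (auto intro!: derivative_eq_intros simp: power2_eq_square field_simps)
  have mono: "g s \<le> g s'" if "s \<in> {\<epsilon>..1}" "s' \<in> {\<epsilon>..1}" "s \<le> s'" for s s'
  proof -
    have "s\<^sup>2 \<le> s'\<^sup>2" using that \<epsilon> by (intro power_mono) auto
    then have "s\<^sup>2 * (1 - x\<^sup>2 * s'\<^sup>2) \<le> s'\<^sup>2 * (1 - x\<^sup>2 * s\<^sup>2)" by (simp add: algebra_simps)
    then have "s\<^sup>2 / (1 - x\<^sup>2 * s\<^sup>2) \<le> s'\<^sup>2 / (1 - x\<^sup>2 * s'\<^sup>2)" using xs[OF that(1)] xs[OF that(2)] by (simp add: field_simps)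
    from mult_right_mono[OF this, of "1 - x\<^sup>2"] show ?thesis using q by (simp add: g_def)
  qed
  have g1: "g 1 = 1" using q by (simp add: g_def)
  have gpos: "0 < g s" if "s \<in> {\<epsilon>..1}" for s using that xs[OF that] q \<epsilon> by (simp add: g_def)
  have "((\<lambda>s. (2 * s * (1 - x\<^sup>2) / (1 - x\<^sup>2 * s\<^sup>2)\<^sup>2) *\<^sub>R (g s powr (- (\<alpha>/2)) * (1 - g s) powr (\<alpha>/2))) has_integral
      integral {g \<epsilon>..g 1} (\<lambda>t. t powr (- (\<alpha>/2)) * (1 - t) powr (\<alpha>/2))) {\<epsilon>..1}"
  proof (rule has_integral_substitution[where c="g \<epsilon>" and d="g 1"])
    show "g ` {\<epsilon>..1} \<subseteq> {g \<epsilon>..g 1}" using mono \<epsilon> by auto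
    show "continuous_on {g \<epsilon>..g 1} (\<lambda>t. t powr (- (\<alpha>/2)) * (1 - t) powr (\<alpha>/2))"
      using gpos[of \<epsilon>] \<epsilon> \<alpha> by (intro continuous_on_mult continuous_on_powr' continuous_intros) (auto simp: g1)
  qed (use \<epsilon> mono[of \<epsilon> 1] der in auto)
  from has_integral_mult_right[OF this, of "2 * x"]
  have "((\<lambda>s. 2 * x * ((2 * s * (1 - x\<^sup>2) / (1 - x\<^sup>2 * s\<^sup>2)\<^sup>2) *\<^sub>R (g s powr (- (\<alpha>/2)) * (1 - g s) powr (\<alpha>/2)))) has_integral
      2 * x * integral {g \<epsilon>..1} (\<lambda>t. t powr (- (\<alpha>/2)) * (1 - t) powr (\<alpha>/2))) {\<epsilon>..1}"
    by (simp add: g1)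
  then show ?thesis unfolding g_def[of \<epsilon>]
  proof (rule has_integral_eq[rotated])
    show "2 * x * ((2 * s * (1 - x\<^sup>2) / (1 - x\<^sup>2 * s\<^sup>2)\<^sup>2) *\<^sub>R (g s powr (- (\<alpha>/2)) * (1 - g s) powr (\<alpha>/2))) =
        (1 - x\<^sup>2) powr (1 - \<alpha>/2) * ((1 - s\<^sup>2) powr (\<alpha>/2) * s powr (- \<alpha>) * (4 * x * s) / (1 - x\<^sup>2 * s\<^sup>2)\<^sup>2)" if s: "s \<in> {\<epsilon>..1}" for s
    proof -
      have s1: "0 \<le> 1 - s\<^sup>2" using s \<epsilon> by (simp add: abs_square_le_1)
      define d where "d = 1 - x\<^sup>2 * s\<^sup>2"
      have d: "0 < d" using xs[OF s] by (simp add: d_def)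
      have "1 - g s = (1 - s\<^sup>2) / d"
        using d unfolding g_def d_def[symmetric] by (simp add: field_simps) (simp add: d_def algebra_simps)
      then have 1: "(1 - g s) powr (\<alpha>/2) = (1 - s\<^sup>2) powr (\<alpha>/2) / d powr (\<alpha>/2)"
        using s1 d by (simp add: powr_divide)
      have sq: "(s\<^sup>2) powr (- (\<alpha>/2)) = s powr (- \<alpha>)" using s \<epsilon> by (simp add: powr_powr flip: powr_numeral)
      have 2: "g s powr (- (\<alpha>/2)) = s powr (- \<alpha>) * (1 - x\<^sup>2) powr (- (\<alpha>/2)) * d powr (\<alpha>/2)"
      proof -
        have "g s powr (- (\<alpha>/2)) = (s\<^sup>2) powr (- (\<alpha>/2)) * (1 - x\<^sup>2) powr (- (\<alpha>/2)) / d powr (- (\<alpha>/2))"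
          using s \<epsilon> q d unfolding g_def d_def[symmetric] by (subst powr_divide) (auto simp: powr_mult)
        then show ?thesis unfolding sq by (simp add: powr_minus_divide[of d])
      qed
      have frac: "2 * x * ((2 * s * q / d\<^sup>2) * (C * D * e * (B / e))) = q * D * (B * C * (4 * x * s) / d\<^sup>2)"
        if "e \<noteq> 0" for q B C D e :: real
        using that by simp
      have 3: "(1 - x\<^sup>2) powr (1 - \<alpha>/2) = (1 - x\<^sup>2) * (1 - x\<^sup>2) powr (- (\<alpha>/2))"
        using q by (simp add: powr_mult_base)
      show ?thesis unfolding 1 2 3 d_def[symmetric] real_scaleR_def by (rule frac) (use d in auto)
    qed
  qed
qed

text \<open>Applying the Moebius substitution at x and at -x puts both sides on the same range of s,
  where they differ only in 1/(1 + xs)^2 and 1/(1 - xs)^2. The price is two different lower limits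
  on the left.\<close>

lemma moebius_identity:
  fixes x \<epsilon> \<alpha> :: real
  assumes x: "\<bar>x\<bar> < 1" and \<epsilon>: "0 < \<epsilon>" "\<epsilon> < 1" and \<alpha>: "0 < \<alpha>"
  shows "integral {\<epsilon> * (1 - x\<^sup>2) / (1 - x * \<epsilon>)..1 + x} (\<lambda>r. bump (\<alpha>/2) (x - r) * r powr (- \<alpha>))
       - integral {\<epsilon> * (1 - x\<^sup>2) / (1 + x * \<epsilon>)..1 - x} (\<lambda>r. bump (\<alpha>/2) (x + r) * r powr (- \<alpha>))
       = 2 * x * integral {\<epsilon>\<^sup>2 * (1 - x\<^sup>2) / (1 - x\<^sup>2 * \<epsilon>\<^sup>2)..1} (\<lambda>t. t powr (- (\<alpha>/2)) * (1 - t) powr (\<alpha>/2))"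
proof -
  have eq: "bump (\<alpha>/2) (- x + r) = bump (\<alpha>/2) (x - r)" for r
    using bump_even[of "\<alpha>/2" "x - r"] by simp
  note 1 = moebius_substitution[of "- x" \<epsilon> \<alpha>, unfolded eq, simplified]
  note 2 = moebius_substitution[of x \<epsilon> \<alpha>]
  have "((\<lambda>s. (1 - x\<^sup>2) powr (1 - \<alpha>/2) * ((1 - s\<^sup>2) powr (\<alpha>/2) * s powr (- \<alpha>) / (1 - x * s)\<^sup>2)
           - (1 - x\<^sup>2) powr (1 - \<alpha>/2) * ((1 - s\<^sup>2) powr (\<alpha>/2) * s powr (- \<alpha>) / (1 + x * s)\<^sup>2)) has_integral
      integral {\<epsilon> * (1 - x\<^sup>2) / (1 - x * \<epsilon>)..1 + x} (\<lambda>r. bump (\<alpha>/2) (x - r) * r powr (- \<alpha>))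
       - integral {\<epsilon> * (1 - x\<^sup>2) / (1 + x * \<epsilon>)..1 - x} (\<lambda>r. bump (\<alpha>/2) (x + r) * r powr (- \<alpha>))) {\<epsilon>..1}"
    using 1 2 x \<epsilon> \<alpha> by (intro has_integral_diff) (auto simp: algebra_simps)
  then have "((\<lambda>s. (1 - x\<^sup>2) powr (1 - \<alpha>/2) * ((1 - s\<^sup>2) powr (\<alpha>/2) * s powr (- \<alpha>) * (4 * x * s) / (1 - x\<^sup>2 * s\<^sup>2)\<^sup>2)) has_integral
      integral {\<epsilon> * (1 - x\<^sup>2) / (1 - x * \<epsilon>)..1 + x} (\<lambda>r. bump (\<alpha>/2) (x - r) * r powr (- \<alpha>))
       - integral {\<epsilon> * (1 - x\<^sup>2) / (1 + x * \<epsilon>)..1 - x} (\<lambda>r. bump (\<alpha>/2) (x + r) * r powr (- \<alpha>))) {\<epsilon>..1}"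
  proof (rule has_integral_eq[rotated])
    fix s assume s: "s \<in> {\<epsilon>..1}"
    have "\<bar>x * s\<bar> \<le> \<bar>x\<bar> * 1" unfolding abs_mult using s \<epsilon> by (intro mult_left_mono) auto
    then have xs: "0 < 1 + x * s" "0 < 1 - x * s" using x by linarith+
    have p: "1 - x\<^sup>2 * s\<^sup>2 = (1 - x * s) * (1 + x * s)" by (simp add: algebra_simps power2_eq_square)
    have "1 / (1 - x * s)\<^sup>2 - 1 / (1 + x * s)\<^sup>2 = ((1 + x * s)\<^sup>2 - (1 - x * s)\<^sup>2) / (1 - x\<^sup>2 * s\<^sup>2)\<^sup>2"
      unfolding p using xs by (simp add: power_mult_distrib diff_frac_eq)
    also have "(1 + x * s)\<^sup>2 - (1 - x * s)\<^sup>2 = 4 * x * s" by (simp add: algebra_simps power2_eq_square)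
    finally have f: "1 / (1 - x * s)\<^sup>2 - 1 / (1 + x * s)\<^sup>2 = 4 * x * s / (1 - x\<^sup>2 * s\<^sup>2)\<^sup>2" .
    have "a * (b / (1 - x * s)\<^sup>2) - a * (b / (1 + x * s)\<^sup>2) = a * (b * (1 / (1 - x * s)\<^sup>2 - 1 / (1 + x * s)\<^sup>2))" for a b
      by (simp add: right_diff_distrib)
    then show "(1 - x\<^sup>2) powr (1 - \<alpha>/2) * ((1 - s\<^sup>2) powr (\<alpha>/2) * s powr (- \<alpha>) / (1 - x * s)\<^sup>2)
           - (1 - x\<^sup>2) powr (1 - \<alpha>/2) * ((1 - s\<^sup>2) powr (\<alpha>/2) * s powr (- \<alpha>) / (1 + x * s)\<^sup>2) =
        (1 - x\<^sup>2) powr (1 - \<alpha>/2) * ((1 - s\<^sup>2) powr (\<alpha>/2) * s powr (- \<alpha>) * (4 * x * s) / (1 - x\<^sup>2 * s\<^sup>2)\<^sup>2)"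
      unfolding f by simp
  qed
  from has_integral_unique[OF this beta_substitution[OF x \<epsilon> \<alpha>]] show ?thesis .
qed

lemma bump_kernel_integrable:
  fixes x \<alpha> :: real
  assumes \<alpha>: "0 < \<alpha>" "\<alpha> < 2"
  shows "integrable lborel (\<lambda>r. indicator {0<..} r * ((bump (\<alpha>/2) (x - r) - bump (\<alpha>/2) (x + r)) / r powr \<alpha>))"
proof -
  let ?g = "\<lambda>r. bump (\<alpha>/2) (x - r) - bump (\<alpha>/2) (x + r)"
  have [measurable]: "bump (\<alpha>/2) \<in> borel_measurable borel"
    by (rule borel_measurable_continuous_onI, rule continuous_on_bump) (use \<alpha> in auto)
  \<comment> \<open>The factor r turns the kernel r^(-\<alpha>) into a Levy kernel whose numerator
    has order 1 + \<alpha>/2 at 0. Beyond r = 1 + |x| both bumps vanish, which explains the bound 1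
    + |x|.\<close>
  have "integrable lborel (\<lambda>r. indicator {0<..} r * (r * ?g r / r powr (1 + \<alpha>)))"
  proof (rule integrable_levy_kernel[of \<alpha> "1 + \<alpha>/2" _ "4 powr (\<alpha>/2)" "1 + \<bar>x\<bar>"])
    fix r :: real assume r: "0 < r" "r \<le> 1"
    have "\<bar>?g r\<bar> \<le> (4 * r) powr (\<alpha>/2)"
      using bump_hoelder[of "\<alpha>/2" "x - r" "x + r"] \<alpha> r by simp
    then show "\<bar>r * ?g r\<bar> \<le> 4 powr (\<alpha>/2) * r powr (1 + \<alpha>/2)"
      using r by (simp add: abs_mult powr_mult powr_add mult_ac)
  next
    fix r :: real assume r: "1 < r"
    show "\<bar>r * ?g r\<bar> \<le> 1 + \<bar>x\<bar>"
    proof (cases "r \<le> 1 + \<bar>x\<bar>")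
      case True
      have "\<bar>?g r\<bar> \<le> 1"
        using bump_nonneg[of "\<alpha>/2" "x - r"] bump_nonneg[of "\<alpha>/2" "x + r"]
          bump_le_1[of "\<alpha>/2" "x - r"] bump_le_1[of "\<alpha>/2" "x + r"] \<alpha> by linarith
      then have "r * \<bar>?g r\<bar> \<le> 1 + \<bar>x\<bar>" using r True mult_left_le[of "\<bar>?g r\<bar>" r] by linarith
      then show ?thesis using r True by (simp only: abs_mult abs_of_pos)
    next
      case False
      then have "bump (\<alpha>/2) (x - r) = 0" "bump (\<alpha>/2) (x + r) = 0" by (auto intro!: bump_eq_0)
      then show ?thesis by simp
    qed
  qed (use \<alpha> in auto)
  also have "(\<lambda>r. indicator {0<..} r * (r * ?g r / r powr (1 + \<alpha>))) = (\<lambda>r. indicator {0<..} r * (?g r / r powr \<alpha>))"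
    by (auto simp: fun_eq_iff powr_add split: split_indicator)
  finally show ?thesis .
qed

text \<open>Passage to the limit in \<open>moebius_identity\<close>. The symmetric integral cut off
  at \<open>b\<close> differs from the two-sided expression only by the left piece between
  \<open>b\<close> and \<open>a\<close>; x >= 0 makes \<open>a\<close> the larger of the
  two.\<close>

lemma bump_kernel_integral_nonneg:
  fixes x \<alpha> :: real
  assumes \<alpha>: "0 < \<alpha>" "\<alpha> < 2" and x: "0 \<le> x" "x < 1"
  shows "(LINT r|lborel. indicator {0<..} r * ((bump (\<alpha>/2) (x - r) - bump (\<alpha>/2) (x + r)) / r powr \<alpha>))
           = 2 * x * Beta (1 - \<alpha>/2) (1 + \<alpha>/2)"
proof -
  define G where "G r = (bump (\<alpha>/2) (x - r) - bump (\<alpha>/2) (x + r)) * r powr (- \<alpha>)" for r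
  have x2: "0 < 1 - x\<^sup>2" using x by (simp add: abs_square_less_1)
  have G0: "G r = 0" if "2 < r" for r using that x by (simp add: G_def bump_eq_0)
  have eqI: "indicator {0<..} r * ((bump (\<alpha>/2) (x - r) - bump (\<alpha>/2) (x + r)) / r powr \<alpha>) = indicator {0..2} r *\<^sub>R G r" for r
    using G0[of r] by (cases "r = 0") (auto simp: G_def powr_minus_divide split: split_indicator)
  have intG: "set_integrable lborel {0..2} G"
    using bump_kernel_integrable[OF \<alpha>, of x] unfolding eqI set_integrable_def .
  have "(LINT r|lborel. indicator {0<..} r * ((bump (\<alpha>/2) (x - r) - bump (\<alpha>/2) (x + r)) / r powr \<alpha>)) = integral {0..2} G"
    using set_borel_integral_eq_integral[OF intG] unfolding eqI set_lebesgue_integral_def by simp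
  also have "integral {0..2} G = 2 * x * Beta (1 - \<alpha>/2) (1 + \<alpha>/2)"
  proof -
    \<comment> \<open>\<open>a\<close> and \<open>b\<close> are the distances from x of the Moebius
      images of -\<epsilon> and \<epsilon>; \<open>c\<close> is the image of \<epsilon> under the
      Beta substitution.\<close>
    define a where "a \<epsilon> = \<epsilon> * (1 - x\<^sup>2) / (1 - x * \<epsilon>)" for \<epsilon>
    define b where "b \<epsilon> = \<epsilon> * (1 - x\<^sup>2) / (1 + x * \<epsilon>)" for \<epsilon>
    define c where "c \<epsilon> = \<epsilon>\<^sup>2 * (1 - x\<^sup>2) / (1 - x\<^sup>2 * \<epsilon>\<^sup>2)" for \<epsilon>
    let ?h = "\<lambda>t::real. t powr (- (\<alpha>/2)) * (1 - t) powr (\<alpha>/2)"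
    let ?L = "\<lambda>r. bump (\<alpha>/2) (x - r) * r powr (- \<alpha>)" and ?R = "\<lambda>r. bump (\<alpha>/2) (x + r) * r powr (- \<alpha>)"
    have cont: "continuous_on {d..e} (\<lambda>r. bump (\<alpha>/2) (f r) * r powr (- \<alpha>))"
      if "0 < d" "continuous_on {d..e} f" for d e f
      by (intro continuous_on_mult continuous_on_compose2[OF continuous_on_bump[of "\<alpha>/2" UNIV]] continuous_intros that)
         (use that \<alpha> in auto)
    have intL: "?L integrable_on {d..e}" and intR: "?R integrable_on {d..e}" if "0 < d" for d e
      by (rule integrable_continuous_interval, rule cont[OF that], intro continuous_intros)+
    have bound: "\<bar>integral {b \<epsilon>..2} G - 2 * x * integral {c \<epsilon>..1} ?h\<bar> \<le> (a \<epsilon> - b \<epsilon>) * b \<epsilon> powr (- \<alpha>)"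
      if \<epsilon>: "0 < \<epsilon>" "\<epsilon> < 1" for \<epsilon>
    proof -
      have "x * \<epsilon> \<le> 1 * \<epsilon>" using x \<epsilon> by (intro mult_right_mono) auto
      then have "x * \<epsilon> < 1" using \<epsilon> by linarith
      then have p: "0 \<le> x * \<epsilon>" "x * \<epsilon> < 1" using x \<epsilon> by auto
      have b0: "0 < b \<epsilon>" using \<epsilon> p x2 unfolding b_def by (intro divide_pos_pos mult_pos_pos) auto
      have ab: "b \<epsilon> \<le> a \<epsilon>" using \<epsilon> p x2 unfolding a_def b_def by (intro divide_left_mono mult_pos_pos mult_nonneg_nonneg) auto
      have le: "\<epsilon> * d \<le> 1 * d" if "0 \<le> d" for d using \<epsilon> that by (intro mult_right_mono) auto
      have a1: "a \<epsilon> \<le> 1 + x"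
      proof -
        have "(1 + x) * (\<epsilon> * (1 - x)) \<le> (1 + x) * (1 - x * \<epsilon>)"
          using x le[of 1] by (intro mult_left_mono) (auto simp: algebra_simps)
        then show ?thesis using p unfolding a_def by (simp add: divide_le_eq algebra_simps power2_eq_square)
      qed
      have b1: "b \<epsilon> \<le> 1 - x"
      proof -
        have "(1 - x) * (\<epsilon> * (1 + x)) \<le> (1 - x) * (1 + x * \<epsilon>)"
          using x le[of 1] by (intro mult_left_mono) (auto simp: algebra_simps)
        then have "\<epsilon> * (1 - x\<^sup>2) \<le> (1 - x) * (1 + x * \<epsilon>)" by (simp add: algebra_simps power2_eq_square)
        then show ?thesis using p unfolding b_def by (subst pos_divide_le_eq) auto
      qed
      have "integral {b \<epsilon>..2} G = integral {b \<epsilon>..2} ?L - integral {b \<epsilon>..2} ?R"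
        unfolding G_def left_diff_distrib by (rule Henstock_Kurzweil_Integration.integral_diff) (use intL intR b0 in auto)
      also have "integral {b \<epsilon>..2} ?R = integral {b \<epsilon>..1 - x} ?R + integral {1 - x..2} ?R"
        using b1 x intR[OF b0] by (intro Henstock_Kurzweil_Integration.integral_combine[symmetric]) auto
      also have "integral {1 - x..2} ?R = integral {1 - x..2} (\<lambda>r. 0)"
        by (rule Henstock_Kurzweil_Integration.integral_cong) (use x in \<open>auto simp: bump_eq_0\<close>)
      also have "integral {b \<epsilon>..2} ?L = integral {b \<epsilon>..1 + x} ?L + integral {1 + x..2} ?L"
        using a1 ab x intL[OF b0] by (intro Henstock_Kurzweil_Integration.integral_combine[symmetric]) auto
      also have "integral {1 + x..2} ?L = integral {1 + x..2} (\<lambda>r. 0)"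
        by (rule Henstock_Kurzweil_Integration.integral_cong) (use x in \<open>auto simp: bump_eq_0\<close>)
      also have "integral {b \<epsilon>..1 + x} ?L = integral {b \<epsilon>..a \<epsilon>} ?L + integral {a \<epsilon>..1 + x} ?L"
        using a1 ab x intL[OF b0] by (intro Henstock_Kurzweil_Integration.integral_combine[symmetric]) auto
      finally have "integral {b \<epsilon>..2} G - 2 * x * integral {c \<epsilon>..1} ?h = integral {b \<epsilon>..a \<epsilon>} ?L"
        using moebius_identity[of x \<epsilon> \<alpha>] x \<epsilon> \<alpha> unfolding a_def b_def c_def by simp
      moreover have "norm (integral {b \<epsilon>..a \<epsilon>} ?L) \<le> integral {b \<epsilon>..a \<epsilon>} (\<lambda>r. b \<epsilon> powr (- \<alpha>))"
      proof (rule integral_norm_bound_integral)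
        fix r assume r: "r \<in> {b \<epsilon>..a \<epsilon>}"
        have "r powr (- \<alpha>) \<le> b \<epsilon> powr (- \<alpha>)" using r b0 \<alpha> by (intro powr_mono2') auto
        then have "bump (\<alpha>/2) (x - r) * r powr (- \<alpha>) \<le> 1 * b \<epsilon> powr (- \<alpha>)"
          using \<alpha> by (intro mult_mono bump_le_1) auto
        then show "norm (?L r) \<le> b \<epsilon> powr (- \<alpha>)" by (simp add: abs_mult)
      qed (use intL b0 in auto)
      ultimately show ?thesis using ab by simp
    qed
    have "((\<lambda>\<epsilon>. (a \<epsilon> - b \<epsilon>) * b \<epsilon> powr (- \<alpha>)) \<longlongrightarrow> 0) (at_right 0)"
    proof -
      \<comment> \<open>Both cut-offs equal \<epsilon>(1 - x^2) to first order, so their difference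
        is of order \<epsilon>^2. The factor beside the power of \<epsilon> has a finite
        limit.\<close>
      have "(a \<epsilon> - b \<epsilon>) * b \<epsilon> powr (- \<alpha>) = \<epsilon> powr (2 - \<alpha>) * ((1 - x\<^sup>2) * 2 * x / (1 - x\<^sup>2 * \<epsilon>\<^sup>2) * ((1 - x\<^sup>2) / (1 + x * \<epsilon>)) powr (- \<alpha>))"
        if \<epsilon>: "0 < \<epsilon>" "\<epsilon> < 1" for \<epsilon>
      proof -
        have "x * \<epsilon> \<le> 1 * \<epsilon>" using x \<epsilon> by (intro mult_right_mono) auto
        then have "x * \<epsilon> < 1" using \<epsilon> by linarith
        then have p: "0 < 1 + x * \<epsilon>" "0 < 1 - x * \<epsilon>" using x \<epsilon> by (auto intro: add_pos_nonneg)
        have be: "b \<epsilon> = \<epsilon> * ((1 - x\<^sup>2) / (1 + x * \<epsilon>))" by (simp add: b_def)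
        have "b \<epsilon> powr (- \<alpha>) = \<epsilon> powr (- \<alpha>) * ((1 - x\<^sup>2) / (1 + x * \<epsilon>)) powr (- \<alpha>)"
          unfolding be by (subst powr_mult) (use \<epsilon> p x2 in auto)
        moreover have "a \<epsilon> - b \<epsilon> = \<epsilon>\<^sup>2 * ((1 - x\<^sup>2) * 2 * x / (1 - x\<^sup>2 * \<epsilon>\<^sup>2))"
        proof -
          have pp: "1 - x\<^sup>2 * \<epsilon>\<^sup>2 = (1 - x * \<epsilon>) * (1 + x * \<epsilon>)" by (simp add: algebra_simps power2_eq_square)
          show ?thesis unfolding pp a_def b_def using p by (simp add: diff_frac_eq) (simp add: algebra_simps power2_eq_square)
        qed
        moreover have "\<epsilon> powr (2 - \<alpha>) = \<epsilon>\<^sup>2 * \<epsilon> powr (- \<alpha>)" using \<epsilon> by (simp add: powr_diff powr_minus_divide)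
        ultimately show ?thesis by simp
      qed
      then have "\<forall>\<^sub>F \<epsilon> in at_right 0. (a \<epsilon> - b \<epsilon>) * b \<epsilon> powr (- \<alpha>) = \<epsilon> powr (2 - \<alpha>) * ((1 - x\<^sup>2) * 2 * x / (1 - x\<^sup>2 * \<epsilon>\<^sup>2) * ((1 - x\<^sup>2) / (1 + x * \<epsilon>)) powr (- \<alpha>))"
        using eventually_at_right_less[of "0::real"] eventually_at_right_field[of _ "0::real"] by (auto intro!: exI[of _ 1])
      moreover have "((\<lambda>\<epsilon>. \<epsilon> powr (2 - \<alpha>) * ((1 - x\<^sup>2) * 2 * x / (1 - x\<^sup>2 * \<epsilon>\<^sup>2) * ((1 - x\<^sup>2) / (1 + x * \<epsilon>)) powr (- \<alpha>))) \<longlongrightarrow>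
          0 * ((1 - x\<^sup>2) * 2 * x / (1 - x\<^sup>2 * 0\<^sup>2) * ((1 - x\<^sup>2) / (1 + x * 0)) powr (- \<alpha>))) (at_right 0)"
      proof (intro tendsto_mult tendsto_divide tendsto_powr tendsto_intros)
        show "((\<lambda>\<epsilon>. \<epsilon> powr (2 - \<alpha>)) \<longlongrightarrow> 0) (at_right 0)" using \<alpha> by real_asymp
      qed (use x2 in auto)
      ultimately show ?thesis by (simp add: filterlim_cong)
    qed
    then have diff0: "((\<lambda>\<epsilon>. integral {b \<epsilon>..2} G - 2 * x * integral {c \<epsilon>..1} ?h) \<longlongrightarrow> 0) (at_right 0)"
    proof (rule Lim_null_comparison[rotated])
      show "\<forall>\<^sub>F \<epsilon> in at_right 0. norm (integral {b \<epsilon>..2} G - 2 * x * integral {c \<epsilon>..1} ?h) \<le> (a \<epsilon> - b \<epsilon>) * b \<epsilon> powr (- \<alpha>)"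
        using bound by (auto simp: eventually_at_right_field intro!: exI[of _ 1])
    qed
    have lim: "((\<lambda>\<epsilon>. integral {f \<epsilon>..e} F) \<longlongrightarrow> integral {0..e} F) (at_right 0)"
      if F: "F integrable_on {0..e}" and e: "0 < e" and f: "(f \<longlongrightarrow> 0) (at_right 0)" and pos: "\<forall>\<^sub>F \<epsilon> in at_right 0. 0 \<le> f \<epsilon>"
      for f :: "real \<Rightarrow> real" and e and F :: "real \<Rightarrow> real"
    proof -
      have c: "continuous_on {0..e} (\<lambda>y. integral {y..e} F)"
        by (rule indefinite_integral_continuous_1'[OF F])
      have ev: "\<forall>\<^sub>F \<epsilon> in at_right 0. f \<epsilon> \<in> {0..e}"
        using pos order_tendstoD(2)[OF f e] by eventually_elim auto
      show ?thesis
        by (rule continuous_on_tendsto_compose[OF c f _ ev]) (use e in auto)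
    qed
    have bl: "((\<lambda>\<epsilon>. integral {b \<epsilon>..2} G) \<longlongrightarrow> integral {0..2} G) (at_right 0)"
    proof (rule lim)
      show "G integrable_on {0..2}" using set_borel_integral_eq_integral(1)[OF intG] .
      have "(b \<longlongrightarrow> 0 * (1 - x\<^sup>2) / (1 + x * 0)) (at_right 0)"
        unfolding b_def [abs_def] by (intro tendsto_intros) auto
      then show "(b \<longlongrightarrow> 0) (at_right 0)" by simp
      show "\<forall>\<^sub>F \<epsilon> in at_right 0. 0 \<le> b \<epsilon>"
        using x x2 by (auto simp: eventually_at_right_field b_def intro!: exI[of _ 1] divide_nonneg_nonneg)
    qed simp
    have beta: "(?h has_integral Beta (1 - \<alpha>/2) (1 + \<alpha>/2)) {0..1}"
      using has_integral_Beta_real[of "1 - \<alpha>/2" "1 + \<alpha>/2"] \<alpha> by simp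
    have cl: "((\<lambda>\<epsilon>. integral {c \<epsilon>..1} ?h) \<longlongrightarrow> Beta (1 - \<alpha>/2) (1 + \<alpha>/2)) (at_right 0)"
      unfolding integral_unique[OF beta, symmetric]
    proof (rule lim)
      show "?h integrable_on {0..1}" using beta by blast
      have "(c \<longlongrightarrow> 0\<^sup>2 * (1 - x\<^sup>2) / (1 - x\<^sup>2 * 0\<^sup>2)) (at_right 0)"
        unfolding c_def [abs_def] by (intro tendsto_intros) auto
      then show "(c \<longlongrightarrow> 0) (at_right 0)" by simp
      have "0 \<le> c \<epsilon>" if "0 < \<epsilon>" "\<epsilon> < 1" for \<epsilon>
      proof -
        have "x\<^sup>2 * \<epsilon>\<^sup>2 \<le> 1 * 1" using that x x2 by (intro mult_mono) (auto simp: abs_square_le_1)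
        then show ?thesis using x2 by (auto simp: c_def intro!: divide_nonneg_nonneg)
      qed
      then show "\<forall>\<^sub>F \<epsilon> in at_right 0. 0 \<le> c \<epsilon>"
        by (auto simp: eventually_at_right_field intro!: exI[of _ 1])
    qed simp
    have "((\<lambda>\<epsilon>. integral {b \<epsilon>..2} G - 2 * x * integral {c \<epsilon>..1} ?h) \<longlongrightarrow>
        integral {0..2} G - 2 * x * Beta (1 - \<alpha>/2) (1 + \<alpha>/2)) (at_right 0)"
      by (intro tendsto_intros bl cl)
    from tendsto_unique[OF _ this diff0] show ?thesis by simp
  qed
  finally show ?thesis .
qed

text \<open>\<open>bump\<close> is even, so both sides are odd in \<open>x\<close>.\<close>

lemma bump_kernel_integral:
  fixes x \<alpha> :: real
  assumes \<alpha>: "0 < \<alpha>" "\<alpha> < 2" and x: "\<bar>x\<bar> < 1"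
  shows "(LINT r|lborel. indicator {0<..} r * ((bump (\<alpha>/2) (x - r) - bump (\<alpha>/2) (x + r)) / r powr \<alpha>))
           = 2 * x * Beta (1 - \<alpha>/2) (1 + \<alpha>/2)"
proof (cases "0 \<le> x")
  case True
  then show ?thesis using bump_kernel_integral_nonneg[OF \<alpha>, of x] x by simp
next
  case False
  have eq: "bump (\<alpha>/2) (- x - r) - bump (\<alpha>/2) (- x + r) = - (bump (\<alpha>/2) (x - r) - bump (\<alpha>/2) (x + r))" for r
    using bump_even[of "\<alpha>/2" "x + r"] bump_even[of "\<alpha>/2" "x - r"] by simp
  show ?thesis
    using bump_kernel_integral_nonneg[OF \<alpha>, of "- x"] x False
    unfolding eq minus_divide_left[symmetric] mult_minus_right integral_minus by auto
qed

section \<open>From second differences to the derivative\<close>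

lemma has_bochner_integral_powr_tail:
  fixes r \<alpha> :: real
  assumes "0 < r" "0 < \<alpha>"
  shows "has_bochner_integral lborel (\<lambda>z. indicator {r<..} z * z powr (- 1 - \<alpha>)) (r powr (- \<alpha>) / \<alpha>)"
proof -
  have h: "((\<lambda>z. z powr (- 1 - \<alpha>)) has_integral (r powr (- \<alpha>) / \<alpha>)) {r..}"
    using has_integral_powr_to_inf[of "- 1 - \<alpha>" r] assms by simp
  then have "(\<lambda>z. z powr (- 1 - \<alpha>)) absolutely_integrable_on {r..}"
    by (intro nonnegative_absolutely_integrable_1) auto
  then have i: "integrable lborel (\<lambda>z. indicator {r..} z *\<^sub>R z powr (- 1 - \<alpha>))"
    unfolding set_integrable_def by (subst (asm) integrable_completion) auto
  then have "(LINT z|lborel. indicator {r..} z *\<^sub>R z powr (- 1 - \<alpha>)) = r powr (- \<alpha>) / \<alpha>"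
    using set_borel_integral_eq_integral(2)[of "{r..}" "\<lambda>z. z powr (- 1 - \<alpha>)"] integral_unique[OF h]
    by (simp add: set_integrable_def set_lebesgue_integral_def)
  with i have "has_bochner_integral lborel (\<lambda>z. indicator {r..} z *\<^sub>R z powr (- 1 - \<alpha>)) (r powr (- \<alpha>) / \<alpha>)"
    by (simp add: has_bochner_integral_iff)
  then show ?thesis
    by (rule has_bochner_integral_discrete_difference[where X="{r}", THEN iffD1, rotated 4])
       (auto split: split_indicator)
qed

text \<open>The second difference is the integral of f(x - r) - f(x + r) over 0 < r < z. Exchanging
  the order leaves the tail integral of z^(-1-\<alpha>) over z > r, that is r^(-\<alpha>) /
  \<alpha>; \<open>int\<close> is what Fubini then requires.\<close>

lemma sym_op_eq_deriv_kernel: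
  fixes w f :: "real \<Rightarrow> real"
  assumes \<alpha>: "0 < \<alpha>" and w: "\<And>y. (w has_real_derivative f y) (at y)" and f: "continuous_on UNIV f"
    and int: "integrable lborel (\<lambda>r. indicator {0<..} r * ((f (x - r) - f (x + r)) / r powr \<alpha>))"
  shows "sym_op \<alpha> w x = (LINT r|lborel. indicator {0<..} r * ((f (x - r) - f (x + r)) / r powr \<alpha>)) / \<alpha>"
proof -
  define g where "g r = f (x - r) - f (x + r)" for r
  have [measurable]: "f \<in> borel_measurable borel" by (rule borel_measurable_continuous_onI[OF f])
  have gm[measurable]: "g \<in> borel_measurable borel" unfolding g_def [abs_def] by measurable
  have cg: "isCont g r" for r
  proof -
    have "continuous_on UNIV (\<lambda>r. f (x - r) - f (x + r))"
      by (intro continuous_intros continuous_on_compose2[OF f]) auto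
    then show ?thesis unfolding g_def [abs_def] by (simp add: continuous_on_eq_continuous_at)
  qed
  let ?F = "\<lambda>r z. indicator {0<..} r * (g r * (indicator {r<..} z * z powr (- 1 - \<alpha>)))"
  have inner_z: "has_bochner_integral lborel (?F r) (indicator {0<..} r * (g r / r powr \<alpha>) / \<alpha>)" for r
  proof (cases "0 < r")
    case True
    show ?thesis
      using has_bochner_integral_mult_right[OF has_bochner_integral_powr_tail[OF True \<alpha>], of "g r"] True
      by (simp add: powr_minus_divide)
  qed (simp add: has_bochner_integral_zero)
  have "integrable (lborel \<Otimes>\<^sub>M lborel) (\<lambda>(r, z). ?F r z)"
  proof (rule lborel_pair.Fubini_integrable)
    show "(\<lambda>(r, z). ?F r z) \<in> borel_measurable (lborel \<Otimes>\<^sub>M lborel)"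
    proof -
      have "(\<lambda>(r, z). ?F r z) = (\<lambda>p. if 0 < fst p \<and> fst p < snd p then g (fst p) * snd p powr (- 1 - \<alpha>) else 0)"
        by (auto simp: fun_eq_iff split: split_indicator)
      then show ?thesis by simp
    qed
    have nrm: "(LINT z|lborel. norm (?F r z)) = norm (indicator {0<..} r * (g r / r powr \<alpha>)) / \<alpha>" for r
    proof (cases "0 < r")
      case True
      have "norm (?F r z) = \<bar>g r\<bar> * (indicator {r<..} z * z powr (- 1 - \<alpha>))" for z
        using True by (simp add: abs_mult)
      then show ?thesis
        using has_bochner_integral_mult_right[OF has_bochner_integral_powr_tail[OF True \<alpha>], of "\<bar>g r\<bar>"] True
        by (simp add: has_bochner_integral_iff powr_minus_divide abs_mult)
    qed simp
    show "integrable lborel (\<lambda>r. LINT z|lborel. norm (case (r, z) of (r, z) \<Rightarrow> ?F r z))"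
      unfolding split nrm by (intro integrable_divide integrable_norm int[folded g_def])
    show "AE r in lborel. integrable lborel (\<lambda>z. case (r, z) of (r, z) \<Rightarrow> ?F r z)"
      using inner_z by (simp add: has_bochner_integral_iff)
  qed
  from lborel_pair.Fubini_integral[OF this]
  have swap: "(LINT z|lborel. LINT r|lborel. ?F r z) = (LINT r|lborel. LINT z|lborel. ?F r z)" .
  have inner_r: "(LINT r|lborel. ?F r z) = levy_quotient \<alpha> w x z" for z
  proof (cases "0 < z")
    case True
    have "(LINT r|lborel. ?F r z) = (LINT r|lborel. z powr (- 1 - \<alpha>) * (indicator {0..z} r *\<^sub>R g r))"
      by (rule integral_discrete_difference[where X="{0, z}"]) (auto split: split_indicator)
    also have "\<dots> = z powr (- 1 - \<alpha>) * (LINT r|lborel. indicator {0..z} r *\<^sub>R g r)"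
      by (rule integral_mult_right_zero)
    also have "(LINT r|lborel. indicator {0..z} r *\<^sub>R g r) = (- w (x - z) - w (x + z)) - (- w (x - 0) - w (x + 0))"
    proof (rule integral_FTC_Icc)
      show "((\<lambda>r. - w (x - r) - w (x + r)) has_vector_derivative g r) (at r within {0..z})" for r
        unfolding has_real_derivative_iff_has_vector_derivative[symmetric] g_def
        by (auto intro!: derivative_eq_intros DERIV_chain'[OF _ w, THEN DERIV_subset] DERIV_subset[OF DERIV_chain2[OF w]])
      show "continuous_on {0..z} g" using cg by (simp add: continuous_at_imp_continuous_on)
    qed (use True in auto)
    also have "z powr (- 1 - \<alpha>) * \<dots> = second_diff w x z / z powr (1 + \<alpha>)"
    proof -
      have "z powr (- 1 - \<alpha>) = 1 / z powr (1 + \<alpha>)" using powr_minus_divide[of z "1 + \<alpha>"] by simp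
      then show ?thesis by (simp add: second_diff_def)
    qed
    finally show ?thesis using True by simp
  next
    case False
    then have z0: "(\<lambda>r. ?F r z) = (\<lambda>r. 0)" by (auto simp: fun_eq_iff split: split_indicator)
    show ?thesis unfolding z0 using False by simp
  qed
  have "sym_op \<alpha> w x = (LINT z|lborel. LINT r|lborel. ?F r z)"
    unfolding sym_op_def inner_r ..
  also have "\<dots> = (LINT r|lborel. indicator {0<..} r * (g r / r powr \<alpha>) / \<alpha>)"
    unfolding swap using inner_z by (simp add: has_bochner_integral_iff)
  finally show ?thesis unfolding integral_divide_zero g_def .
qed

section \<open>Test functions, envelopes and reflection\<close>

lemma has_derivative_slices:
  assumes "(f has_derivative (\<lambda>(h, k). a * h + b * k)) (at p)"
  shows "((\<lambda>x. f (x, snd p)) has_real_derivative a) (at (fst p))"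
    and "((\<lambda>t. f (fst p, t)) has_real_derivative b) (at (snd p))"
proof -
  have "((\<lambda>x. (x, snd p)) has_derivative (\<lambda>h. (h, 0))) (at (fst p))"
    by (auto intro!: derivative_eq_intros)
  from diff_chain_at[OF this] assms
  have "(f \<circ> (\<lambda>x. (x, snd p)) has_derivative (\<lambda>(h, k). a * h + b * k) \<circ> (\<lambda>h. (h, 0))) (at (fst p))" by simp
  then show "((\<lambda>x. f (x, snd p)) has_real_derivative a) (at (fst p))"
    unfolding has_field_derivative_def comp_def by simp
  have "((\<lambda>t. (fst p, t)) has_derivative (\<lambda>k. (0, k))) (at (snd p))"
    by (auto intro!: derivative_eq_intros)
  from diff_chain_at[OF this] assms
  have "(f \<circ> (\<lambda>t. (fst p, t)) has_derivative (\<lambda>(h, k). a * h + b * k) \<circ> (\<lambda>k. (0, k))) (at (snd p))" by simp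
  then show "((\<lambda>t. f (fst p, t)) has_real_derivative b) (at (snd p))"
    unfolding has_field_derivative_def comp_def by simp
qed

lemma has_derivative_dx_dt:
  assumes "f differentiable (at p)"
  shows "(f has_derivative (\<lambda>(h, k). dx f p * h + dt f p * k)) (at p)"
proof -
  obtain D where D: "(f has_derivative D) (at p)" using assms by (auto simp: differentiable_def)
  then interpret bounded_linear D by (rule has_derivative_bounded_linear)
  have "D = (\<lambda>(h, k). D (1, 0) * h + D (0, 1) * k)"
  proof (rule ext, clarify)
    fix h k
    have "(h, k) = h *\<^sub>R (1, 0) + k *\<^sub>R (0, 1)" by simp
    then have "D (h, k) = h *\<^sub>R D (1, 0) + k *\<^sub>R D (0, 1)" by (metis add scaleR)
    then show "D (h, k) = D (1, 0) * h + D (0, 1) * k" by (simp add: mult.commute)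
  qed
  with D have D': "(f has_derivative (\<lambda>(h, k). D (1, 0) * h + D (0, 1) * k)) (at p)" by simp
  have "dx f p = D (1, 0)" "dt f p = D (0, 1)"
    unfolding dx_def dt_def using has_derivative_slices[OF D'] by (auto intro: DERIV_imp_deriv)
  with D' show ?thesis by simp
qed

lemma dx_dt_eqI:
  assumes "(f has_derivative (\<lambda>(h, k). a * h + b * k)) (at p)"
  shows "dx f p = a" "dt f p = b"
  unfolding dx_def dt_def using has_derivative_slices[OF assms] by (auto intro: DERIV_imp_deriv)

lemma C1_onI:
  assumes "\<And>p. p \<in> S \<Longrightarrow> (f has_derivative (\<lambda>(h, k). fx p * h + ft p * k)) (at p)"
    and "continuous_on S fx" "continuous_on S ft"
  shows "C1_on S f"
proof -
  have eq: "\<And>p. p \<in> S \<Longrightarrow> dx f p = fx p" "\<And>p. p \<in> S \<Longrightarrow> dt f p = ft p"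
    using dx_dt_eqI[OF assms(1)] by auto
  have "continuous_on S (dx f)" "continuous_on S (dt f)"
    using assms(2,3) eq by (simp_all cong: continuous_on_cong)
  moreover have "\<forall>p\<in>S. f differentiable (at p)"
    using assms(1) unfolding differentiable_def by blast
  ultimately show ?thesis unfolding C1_on_def by blast
qed

lemma C1_onD:
  assumes "C1_on S f"
  shows "p \<in> S \<Longrightarrow> (f has_derivative (\<lambda>(h, k). dx f p * h + dt f p * k)) (at p)"
    and "continuous_on S (dx f)" "continuous_on S (dt f)" "continuous_on S f"
  using assms by (auto simp: C1_on_def intro: has_derivative_dx_dt
      differentiable_imp_continuous_within continuous_at_imp_continuous_on)

lemma C1_on_cong:
  assumes "open S" "\<And>p. p \<in> S \<Longrightarrow> f p = g p" "C1_on S g"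
  shows "C1_on S f"
proof (rule C1_onI)
  fix p assume "p \<in> S"
  then show "(f has_derivative (\<lambda>(h, k). dx g p * h + dt g p * k)) (at p)"
    using has_derivative_transform_within_open[OF C1_onD(1)[OF assms(3)] assms(1)] assms(2) by auto
qed (use C1_onD[OF assms(3)] in auto)

lemma C1_on_const [simp]: "C1_on S (\<lambda>p. c)"
  by (rule C1_onI[where fx="\<lambda>p. 0" and ft="\<lambda>p. 0"]) (auto intro!: derivative_eq_intros)

lemma C1_on_add:
  assumes "C1_on S f" "C1_on S g"
  shows "C1_on S (\<lambda>p. f p + g p)"
    and "p \<in> S \<Longrightarrow> dx (\<lambda>p. f p + g p) p = dx f p + dx g p"
    and "p \<in> S \<Longrightarrow> dt (\<lambda>p. f p + g p) p = dt f p + dt g p"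
proof -
  have d: "((\<lambda>p. f p + g p) has_derivative (\<lambda>(h, k). (dx f p + dx g p) * h + (dt f p + dt g p) * k)) (at p)"
    if "p \<in> S" for p
    by (rule has_derivative_eq_rhs[OF has_derivative_add[OF C1_onD(1)[OF assms(1) that] C1_onD(1)[OF assms(2) that]]])
       (auto simp: algebra_simps)
  show "C1_on S (\<lambda>p. f p + g p)"
    by (rule C1_onI[OF d])
       (intro continuous_intros C1_onD(2-4)[OF assms(1)] C1_onD(2-4)[OF assms(2)] | assumption)+
  show "p \<in> S \<Longrightarrow> dx (\<lambda>p. f p + g p) p = dx f p + dx g p" "p \<in> S \<Longrightarrow> dt (\<lambda>p. f p + g p) p = dt f p + dt g p"
    using dx_dt_eqI[OF d] by auto
qed

lemma C1_on_mult:
  assumes "C1_on S f" "C1_on S g"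
  shows "C1_on S (\<lambda>p. f p * g p)"
    and "p \<in> S \<Longrightarrow> dx (\<lambda>p. f p * g p) p = dx f p * g p + f p * dx g p"
    and "p \<in> S \<Longrightarrow> dt (\<lambda>p. f p * g p) p = dt f p * g p + f p * dt g p"
proof -
  have d: "((\<lambda>p. f p * g p) has_derivative (\<lambda>(h, k). (dx f p * g p + f p * dx g p) * h + (dt f p * g p + f p * dt g p) * k)) (at p)"
    if "p \<in> S" for p
    by (rule has_derivative_eq_rhs[OF has_derivative_mult[OF C1_onD(1)[OF assms(1) that] C1_onD(1)[OF assms(2) that]]])
       (auto simp: algebra_simps)
  show "C1_on S (\<lambda>p. f p * g p)"
    by (rule C1_onI[OF d])
       (intro continuous_intros C1_onD(2-4)[OF assms(1)] C1_onD(2-4)[OF assms(2)] | assumption)+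
  show "p \<in> S \<Longrightarrow> dx (\<lambda>p. f p * g p) p = dx f p * g p + f p * dx g p"
    "p \<in> S \<Longrightarrow> dt (\<lambda>p. f p * g p) p = dt f p * g p + f p * dt g p"
    using dx_dt_eqI[OF d] by auto
qed

lemma C1_on_compose:
  assumes f: "C1_on S f" and g: "\<And>p. p \<in> S \<Longrightarrow> (g has_real_derivative g' (f p)) (at (f p))"
    and g': "continuous_on (f ` S) g'"
  shows "C1_on S (\<lambda>p. g (f p))"
    and "p \<in> S \<Longrightarrow> dx (\<lambda>p. g (f p)) p = g' (f p) * dx f p"
    and "p \<in> S \<Longrightarrow> dt (\<lambda>p. g (f p)) p = g' (f p) * dt f p"
proof -
  have d: "((\<lambda>p. g (f p)) has_derivative (\<lambda>(h, k). (g' (f p) * dx f p) * h + (g' (f p) * dt f p) * k)) (at p)"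
    if "p \<in> S" for p
  proof -
    have "(*) (g' (f p)) \<circ> (\<lambda>(h, k). dx f p * h + dt f p * k) = (\<lambda>(h, k). (g' (f p) * dx f p) * h + (g' (f p) * dt f p) * k)"
      by (auto simp: fun_eq_iff algebra_simps)
    with diff_chain_at[OF C1_onD(1)[OF f that] g[OF that, unfolded has_field_derivative_def]]
    show ?thesis unfolding comp_def[of g f] by simp
  qed
  have "continuous_on S (\<lambda>p. g' (f p))"
    using continuous_on_compose[OF C1_onD(4)[OF f] g'] by (simp add: comp_def)
  then show "C1_on S (\<lambda>p. g (f p))"
    by (intro C1_onI[OF d]) (intro continuous_intros C1_onD(2-4)[OF f] | assumption)+
  show "p \<in> S \<Longrightarrow> dx (\<lambda>p. g (f p)) p = g' (f p) * dx f p" "p \<in> S \<Longrightarrow> dt (\<lambda>p. g (f p)) p = g' (f p) * dt f p"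
    using dx_dt_eqI[OF d] by auto
qed

lemma C2_onD: "C2_on S f \<Longrightarrow> C1_on S f" "C2_on S f \<Longrightarrow> C1_on S (dx f)" "C2_on S f \<Longrightarrow> C1_on S (dt f)"
  by (auto simp: C2_on_def)

lemma C2_on_const [simp]: "C2_on S (\<lambda>p. c)"
proof -
  have "dx (\<lambda>p. c) = (\<lambda>p. 0)" "dt (\<lambda>p. c) = (\<lambda>p. 0)" by (auto simp: dx_def dt_def)
  then show ?thesis by (simp add: C2_on_def)
qed

lemma C2_on_fst [simp]: "C2_on S fst" and C2_on_snd [simp]: "C2_on S snd"
proof -
  have d: "(fst has_derivative (\<lambda>(h, k). 1 * h + 0 * k)) (at p)" "(snd has_derivative (\<lambda>(h, k). 0 * h + 1 * k)) (at p)"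
    for p :: "real \<times> real"
    by (auto intro!: derivative_eq_intros)
  have "dx fst = (\<lambda>p. 1)" "dt fst = (\<lambda>p. 0)" "dx snd = (\<lambda>p. 0)" "dt snd = (\<lambda>p. 1)"
    using dx_dt_eqI[OF d(1)] dx_dt_eqI[OF d(2)] by auto
  then show "C2_on S fst" "C2_on S snd"
    using C1_onI[OF d(1), of S] C1_onI[OF d(2), of S] by (auto simp: C2_on_def)
qed

lemma C2_on_add:
  assumes "open S" "C2_on S f" "C2_on S g"
  shows "C2_on S (\<lambda>p. f p + g p)"
  unfolding C2_on_def
proof (intro conjI)
  note f = C2_onD[OF assms(2)] and g = C2_onD[OF assms(3)]
  show "C1_on S (\<lambda>p. f p + g p)" by (rule C1_on_add[OF f(1) g(1)])
  show "C1_on S (dx (\<lambda>p. f p + g p))"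
    by (rule C1_on_cong[OF assms(1) C1_on_add(2)[OF f(1) g(1)] C1_on_add(1)[OF f(2) g(2)]])
  show "C1_on S (dt (\<lambda>p. f p + g p))"
    by (rule C1_on_cong[OF assms(1) C1_on_add(3)[OF f(1) g(1)] C1_on_add(1)[OF f(3) g(3)]])
qed

lemma C2_on_mult:
  assumes "open S" "C2_on S f" "C2_on S g"
  shows "C2_on S (\<lambda>p. f p * g p)"
  unfolding C2_on_def
proof (intro conjI)
  note f = C2_onD[OF assms(2)] and g = C2_onD[OF assms(3)]
  show "C1_on S (\<lambda>p. f p * g p)" by (rule C1_on_mult[OF f(1) g(1)])
  show "C1_on S (dx (\<lambda>p. f p * g p))"
    by (rule C1_on_cong[OF assms(1) C1_on_mult(2)[OF f(1) g(1)]
        C1_on_add(1)[OF C1_on_mult(1)[OF f(2) g(1)] C1_on_mult(1)[OF f(1) g(2)]]])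
  show "C1_on S (dt (\<lambda>p. f p * g p))"
    by (rule C1_on_cong[OF assms(1) C1_on_mult(3)[OF f(1) g(1)]
        C1_on_add(1)[OF C1_on_mult(1)[OF f(3) g(1)] C1_on_mult(1)[OF f(1) g(3)]]])
qed

text \<open>The differentiability assumptions on \<open>g\<close> are pointwise along the range of
  \<open>f\<close>, which admits powers that are singular elsewhere.\<close>

lemma C2_on_compose:
  assumes S: "open S" and "C2_on S f"
    and g: "\<And>p. p \<in> S \<Longrightarrow> (g has_real_derivative g' (f p)) (at (f p))"
    and g': "\<And>p. p \<in> S \<Longrightarrow> (g' has_real_derivative g'' (f p)) (at (f p))"
    and g'': "continuous_on (f ` S) g''"
  shows "C2_on S (\<lambda>p. g (f p))"
  unfolding C2_on_def
proof (intro conjI)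
  note f = C2_onD[OF assms(2)]
  have cg': "continuous_on (f ` S) g'"
    using g' by (auto intro!: continuous_at_imp_continuous_on intro: DERIV_isCont)
  note g'f = C1_on_compose(1)[OF f(1) g' g'']
  show "C1_on S (\<lambda>p. g (f p))" by (rule C1_on_compose[OF f(1) g cg'])
  show "C1_on S (dx (\<lambda>p. g (f p)))"
    by (rule C1_on_cong[OF S C1_on_compose(2)[OF f(1) g cg'] C1_on_mult(1)[OF g'f f(2)]])
  show "C1_on S (dt (\<lambda>p. g (f p)))"
    by (rule C1_on_cong[OF S C1_on_compose(3)[OF f(1) g cg'] C1_on_mult(1)[OF g'f f(3)]])
qed

lemma open_open_half_plane: "open open_half_plane"
  unfolding open_half_plane_def by (intro open_Times) auto

text \<open>On slices of test functions the Levy-Khintchine integral is genuinely absolutely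
  convergent, so it can be replaced by its symmetrised form.\<close>

lemma test_function_slice:
  assumes \<phi>: "test_function \<phi>" and t: "0 < t" and \<alpha>: "0 < \<alpha>" "\<alpha> < 2"
  shows "((\<lambda>x. \<phi> (x, t)) has_real_derivative dx \<phi> (x, t)) (at x)"
    and "((\<lambda>t. \<phi> (x, t)) has_real_derivative dt \<phi> (x, t)) (at t)"
    and "levy_khintchine C \<alpha> (\<lambda>x. \<phi> (x, t)) x = C * sym_op \<alpha> (\<lambda>x. \<phi> (x, t)) x"
    and "integrable lborel (levy_quotient \<alpha> (\<lambda>x. \<phi> (x, t)) x)"
proof -
  have S: "(y, t) \<in> open_half_plane" for y using t by (simp add: open_half_plane_def)
  have C: "C1_on open_half_plane \<phi>" "C1_on open_half_plane (dx \<phi>)"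
    using \<phi> by (auto simp: test_function_def C2_on_def)
  have d1: "((\<lambda>x. \<phi> (x, t)) has_real_derivative dx \<phi> (y, t)) (at y)" for y
    using has_derivative_slices(1)[OF C1_onD(1)[OF C(1) S]] by simp
  have d2: "((\<lambda>x. dx \<phi> (x, t)) has_real_derivative dx (dx \<phi>) (y, t)) (at y)" for y
    using has_derivative_slices(1)[OF C1_onD(1)[OF C(2) S]] by simp
  show "((\<lambda>x. \<phi> (x, t)) has_real_derivative dx \<phi> (x, t)) (at x)" by (rule d1)
  show "((\<lambda>t. \<phi> (x, t)) has_real_derivative dt \<phi> (x, t)) (at t)"
    using has_derivative_slices(2)[OF C1_onD(1)[OF C(1) S]] by simp
  have c: "continuous_on {x - 1..x + 1} (\<lambda>y. dx (dx \<phi>) (y, t))"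
    using S by (intro continuous_on_compose2[OF C1_onD(2)[OF C(2)]] continuous_intros) auto
  obtain A where A: "\<forall>y\<in>{x - 1..x + 1}. \<bar>dx (dx \<phi>) (y, t)\<bar> \<le> A"
    using compact_imp_bounded[OF compact_continuous_image[OF c]] by (auto simp: bounded_iff)
  obtain B where "\<forall>p\<in>open_half_plane. \<bar>\<phi> p\<bar> \<le> B"
    using \<phi> by (auto simp: test_function_def bounded_iff)
  then have B: "\<bar>\<phi> (y, t)\<bar> \<le> B" for y using S by blast
  have m: "(\<lambda>x. \<phi> (x, t)) \<in> borel_measurable borel"
    using d1 by (intro borel_measurable_continuous_onI continuous_at_imp_continuous_on) (auto intro: DERIV_isCont)
  have T: "\<bar>\<phi> (x + z, t) - \<phi> (x, t) - z * deriv (\<lambda>x. \<phi> (x, t)) x\<bar> \<le> A / 2 * z\<^sup>2" if "\<bar>z\<bar> \<le> 1" for z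
    unfolding DERIV_imp_deriv[OF d1]
  proof (rule Taylor_bound[OF d1 d2])
    fix y assume "\<bar>y - x\<bar> \<le> \<bar>z\<bar>"
    with that have "y \<in> {x - 1..x + 1}" by auto
    then show "\<bar>dx (dx \<phi>) (y, t)\<bar> \<le> A" using A by blast
  qed
  show "levy_khintchine C \<alpha> (\<lambda>x. \<phi> (x, t)) x = C * sym_op \<alpha> (\<lambda>x. \<phi> (x, t)) x"
    "integrable lborel (levy_quotient \<alpha> (\<lambda>x. \<phi> (x, t)) x)"
    by (rule levy_khintchine_eq_sym_op[OF \<alpha> m B zero_less_one T], assumption)+
qed

section \<open>Maxima and perturbation estimates for the comparison argument\<close>

text \<open>Without a maximum every point p has a better point g p, and f stays below f(g p) near p.
  A finite subcover leaves finitely many better points, and the best of them lies in a patch where f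
  is below another one.\<close>

lemma usc_on_attains_max:
  assumes f: "usc_on S f" and K: "compact K" "K \<noteq> {}" "K \<subseteq> S"
  shows "\<exists>p\<in>K. \<forall>q\<in>K. f q \<le> f p"
proof (rule ccontr)
  assume "\<not> (\<exists>p\<in>K. \<forall>q\<in>K. f q \<le> f p)"
  then obtain g where g: "\<And>p. p \<in> K \<Longrightarrow> g p \<in> K \<and> f p < f (g p)" by (metis not_le)
  have "\<exists>U. open U \<and> p \<in> U \<and> (\<forall>q\<in>U \<inter> S. f q < f (g p))" if p: "p \<in> K" for p
  proof -
    have "\<forall>\<^sub>F q in at p within S. f q < f (g p)"
      using f g[OF p] p K(3) unfolding usc_on_def by blast
    then obtain U where "open U" "p \<in> U" "\<forall>q\<in>U. q \<noteq> p \<longrightarrow> q \<in> S \<longrightarrow> f q < f (g p)"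
      unfolding eventually_at_topological by blast
    then show ?thesis using g[OF p] by (intro exI[of _ U]) auto
  qed
  then obtain U where U: "\<And>p. p \<in> K \<Longrightarrow> open (U p) \<and> p \<in> U p \<and> (\<forall>q\<in>U p \<inter> S. f q < f (g p))" by metis
  obtain D where D: "D \<subseteq> K" "finite D" "K \<subseteq> (\<Union>p\<in>D. U p)"
    by (rule compactE_image[OF K(1), of K U]) (use U in auto)
  have "D \<noteq> {}" using D(3) K(2) by auto
  have "Max ((\<lambda>q. f (g q)) ` D) \<in> (\<lambda>q. f (g q)) ` D"
    using D(2) \<open>D \<noteq> {}\<close> by (intro Max_in) auto
  then obtain p where "p \<in> D" "Max ((\<lambda>q. f (g q)) ` D) = f (g p)" by auto
  moreover have "f (g q) \<le> Max ((\<lambda>q. f (g q)) ` D)" if "q \<in> D" for q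
    using D(2) that by (intro Max_ge) auto
  ultimately have p: "p \<in> D" "\<And>q. q \<in> D \<Longrightarrow> f (g q) \<le> f (g p)" by auto
  have "g p \<in> K" using p D g by auto
  then obtain q where "q \<in> D" "g p \<in> U q" using D(3) by auto
  then have "f (g p) < f (g q)" using U[of q] D(1) \<open>g p \<in> K\<close> K(3) by auto
  with p(2)[OF \<open>q \<in> D\<close>] show False by simp
qed

lemma usc_on_diff_continuous:
  assumes "usc_on S f" "continuous_on S g"
  shows "usc_on S (\<lambda>p. f p - g p :: real)"
  unfolding usc_on_def
proof (intro ballI allI impI)
  fix p c assume p: "p \<in> S" and c: "f p - g p < c"
  define e where "e = (c - (f p - g p)) / 2"
  have e: "0 < e" using c by (simp add: e_def)
  have "\<forall>\<^sub>F q in at p within S. f q < f p + e"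
    using assms(1) p e unfolding usc_on_def by auto
  moreover have "\<forall>\<^sub>F q in at p within S. g p - e < g q"
    using assms(2) p e by (intro order_tendstoD(1)[of g "g p"]) (auto simp: continuous_on)
  ultimately show "\<forall>\<^sub>F q in at p within S. f q - g q < c"
    by eventually_elim (simp add: e_def field_simps)
qed

text \<open>\<open>A\<close> and \<open>E\<close> stand for the slope and nonlocal term of the
  averaged profile, \<open>b\<close> and \<open>F\<close> for those of the penalty. Since A >= 0,
  replacing |A + b| by A costs at most |b|.\<close>

lemma abs_mult_perturbation:
  fixes A b E F :: real
  assumes "0 \<le> A" "A \<le> cA" "\<bar>b\<bar> \<le> \<beta>" "\<bar>E\<bar> \<le> cE" "\<bar>F\<bar> \<le> cF"
  shows "A * E - \<beta> * cE - (cA + \<beta>) * cF \<le> \<bar>A + b\<bar> * (E + F)"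
proof -
  have "\<bar>(\<bar>A + b\<bar> - A) * E\<bar> \<le> \<beta> * cE"
    unfolding abs_mult using assms by (intro mult_mono) auto
  moreover have "\<bar>\<bar>A + b\<bar> * F\<bar> \<le> (cA + \<beta>) * cF"
    unfolding abs_mult using assms by (intro mult_mono) auto
  moreover have "\<bar>A + b\<bar> * (E + F) = A * E + (\<bar>A + b\<bar> - A) * E + \<bar>A + b\<bar> * F"
    by (simp add: algebra_simps)
  ultimately show ?thesis by linarith
qed

lemma test_function_add:
  assumes "test_function f" "test_function g"
  shows "test_function (\<lambda>p. f p + g p)"
  using assms unfolding test_function_def
  by (auto intro!: C2_on_add[OF open_open_half_plane] bounded_plus_comp)

section \<open>The symmetry exchanging subsolutions and supersolutions\<close>

definition reflect :: "(real \<times> real \<Rightarrow> real) \<Rightarrow> real \<times> real \<Rightarrow> real" where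
  "reflect u p = 1 - u (- fst p, snd p)"

lemma C1_on_reflect:
  assumes "C1_on open_half_plane f"
  shows "C1_on open_half_plane (\<lambda>p. f (- fst p, snd p))"
    and "p \<in> open_half_plane \<Longrightarrow> dx (\<lambda>p. f (- fst p, snd p)) p = - dx f (- fst p, snd p)"
    and "p \<in> open_half_plane \<Longrightarrow> dt (\<lambda>p. f (- fst p, snd p)) p = dt f (- fst p, snd p)"
proof -
  let ?\<rho> = "\<lambda>p::real \<times> real. (- fst p, snd p)"
  have \<rho>: "?\<rho> p \<in> open_half_plane" if "p \<in> open_half_plane" for p
    using that by (auto simp: open_half_plane_def)
  have d: "((\<lambda>p. f (?\<rho> p)) has_derivative (\<lambda>(h, k). (- dx f (?\<rho> p)) * h + dt f (?\<rho> p) * k)) (at p)"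
    if p: "p \<in> open_half_plane" for p
  proof -
    have "(?\<rho> has_derivative (\<lambda>(h, k). (- h, k))) (at p)"
      by (auto intro!: derivative_eq_intros)
    from diff_chain_at[OF this C1_onD(1)[OF assms \<rho>[OF p]]]
    show ?thesis by (simp add: comp_def case_prod_unfold)
  qed
  have c: "continuous_on open_half_plane (\<lambda>p. - dx f (?\<rho> p))" "continuous_on open_half_plane (\<lambda>p. dt f (?\<rho> p))"
    by (intro continuous_intros continuous_on_compose2[OF C1_onD(2)[OF assms]]
        continuous_on_compose2[OF C1_onD(3)[OF assms]]; use \<rho> in blast)+
  show "C1_on open_half_plane (\<lambda>p. f (?\<rho> p))" by (rule C1_onI[OF d c])
  show "p \<in> open_half_plane \<Longrightarrow> dx (\<lambda>p. f (?\<rho> p)) p = - dx f (?\<rho> p)"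
    "p \<in> open_half_plane \<Longrightarrow> dt (\<lambda>p. f (?\<rho> p)) p = dt f (?\<rho> p)"
    using dx_dt_eqI[OF d] by auto
qed

lemma C1_on_minus: "C1_on S f \<Longrightarrow> C1_on S (\<lambda>p. - f p)"
  using C1_on_mult(1)[OF C1_on_const[of S "- 1"], of f] by simp

lemma C2_on_reflect:
  assumes "C2_on open_half_plane f"
  shows "C2_on open_half_plane (\<lambda>p. f (- fst p, snd p))"
proof -
  note f = C2_onD[OF assms]
  note o = open_open_half_plane
  show ?thesis
    unfolding C2_on_def
    using C1_on_reflect(1)[OF f(1)]
      C1_on_cong[OF o C1_on_reflect(2)[OF f(1)] C1_on_minus[OF C1_on_reflect(1)[OF f(2)]]]
      C1_on_cong[OF o C1_on_reflect(3)[OF f(1)] C1_on_reflect(1)[OF f(3)]] by blast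
qed

lemma test_function_reflect:
  assumes "test_function \<phi>"
  shows "test_function (reflect \<phi>)"
proof -
  have "C2_on open_half_plane \<phi>" using assms by (simp add: test_function_def)
  from C2_on_add[OF open_open_half_plane C2_on_const
      C2_on_mult[OF open_open_half_plane C2_on_const C2_on_reflect[OF this]]]
  have "C2_on open_half_plane (\<lambda>p. 1 + (- 1) * \<phi> (- fst p, snd p))" .
  moreover have "bounded (reflect \<phi> ` open_half_plane)"
  proof -
    obtain B where B: "\<And>p. p \<in> open_half_plane \<Longrightarrow> \<bar>\<phi> p\<bar> \<le> B"
      using assms unfolding test_function_def bounded_iff by auto
    have "\<bar>reflect \<phi> p\<bar> \<le> 1 + B" if "p \<in> open_half_plane" for p
      using B[of "(- fst p, snd p)"] that by (auto simp: reflect_def open_half_plane_def)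
    then show ?thesis unfolding bounded_iff by (auto intro!: exI[of _ "1 + B"])
  qed
  ultimately show ?thesis by (simp add: test_function_def reflect_def [abs_def])
qed

text \<open>The two sign changes cancel in the space derivative, while the time derivative and the
  nonlocal term each change sign; the whole operator is odd under the reflection.\<close>

lemma reflect_operator:
  assumes \<phi>: "test_function \<phi>" and t: "0 < t" and \<alpha>: "0 < \<alpha>" "\<alpha> < 2"
  shows "dt (reflect \<phi>) (- x, t) + \<bar>dx (reflect \<phi>) (- x, t)\<bar> * frac_lap \<alpha> (\<lambda>x. reflect \<phi> (x, t)) (- x)
       = - (dt \<phi> (x, t) + \<bar>dx \<phi> (x, t)\<bar> * frac_lap \<alpha> (\<lambda>x. \<phi> (x, t)) x)"
proof -
  note r = test_function_reflect[OF \<phi>]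
  have "((\<lambda>y. 1 - \<phi> (- y, t)) has_real_derivative - (dx \<phi> (x, t) * - 1)) (at (- x))"
    by (rule DERIV_cong[OF DERIV_diff[OF DERIV_const DERIV_chain2[where f="\<lambda>x. \<phi> (x, t)"]]])
       (use test_function_slice(1)[OF \<phi> t \<alpha>, of x] in \<open>auto intro!: derivative_eq_intros\<close>)
  then have 1: "dx (reflect \<phi>) (- x, t) = dx \<phi> (x, t)"
    using DERIV_unique[OF test_function_slice(1)[OF r t \<alpha>, of "- x"]] by (simp add: reflect_def)
  have "((\<lambda>s. 1 - \<phi> (x, s)) has_real_derivative - dt \<phi> (x, t)) (at t)"
    by (rule DERIV_cong[OF DERIV_diff[OF DERIV_const test_function_slice(2)[OF \<phi> t \<alpha>, of x]]]) simp
  then have 2: "dt (reflect \<phi>) (- x, t) = - dt \<phi> (x, t)"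
    using DERIV_unique[OF test_function_slice(2)[OF r t \<alpha>, of "- x"]] by (simp add: reflect_def)
  have 3: "frac_lap \<alpha> (\<lambda>x. reflect \<phi> (x, t)) (- x) = - frac_lap \<alpha> (\<lambda>x. \<phi> (x, t)) x"
    unfolding frac_lap_def test_function_slice(3)[OF \<phi> t \<alpha>] test_function_slice(3)[OF r t \<alpha>]
    unfolding reflect_def fst_conv snd_conv using sym_op_reflect[of \<alpha> 1 "\<lambda>x. \<phi> (x, t)" "- x"] by simp
  show ?thesis unfolding 1 2 3 by simp
qed

lemma eventually_reflect:
  assumes "\<forall>\<^sub>F q in at (- fst p, snd p) within half_plane. P q"
  shows "\<forall>\<^sub>F q in at p within half_plane. P (- fst q, snd q)"
proof -
  obtain d where d: "0 < d" "\<And>q. q \<in> half_plane \<Longrightarrow> q \<noteq> (- fst p, snd p) \<Longrightarrow> dist q (- fst p, snd p) < d \<Longrightarrow> P q"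
    using assms unfolding eventually_at by auto
  have dist: "dist (- fst q, snd q) (- fst p, snd p) = dist q p" for q
    by (cases q; cases p) (simp add: dist_prod_def dist_real_def abs_minus_commute)
  show ?thesis
    unfolding eventually_at
  proof (intro exI[of _ d] conjI ballI impI d(1))
    fix q assume q: "q \<in> half_plane" "q \<noteq> p \<and> dist q p < d"
    show "P (- fst q, snd q)"
      by (rule d(2)) (use q dist[of q] in \<open>auto simp: half_plane_def prod_eq_iff\<close>)
  qed
qed

lemma reflect_usc: "lsc_on half_plane u \<Longrightarrow> usc_on half_plane (reflect u)"
  unfolding usc_on_def lsc_on_def reflect_def
proof (intro ballI allI impI)
  fix p c assume *: "\<forall>p\<in>half_plane. \<forall>c<u p. \<forall>\<^sub>F q in at p within half_plane. c < u q"
    and p: "p \<in> half_plane" and c: "1 - u (- fst p, snd p) < c"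
  have "\<forall>\<^sub>F q in at (- fst p, snd p) within half_plane. 1 - c < u q"
    using * p c by (auto simp: half_plane_def)
  from eventually_reflect[OF this] show "\<forall>\<^sub>F q in at p within half_plane. 1 - u (- fst q, snd q) < c"
    by eventually_elim simp
qed

lemma reflect_lsc: "usc_on half_plane u \<Longrightarrow> lsc_on half_plane (reflect u)"
  unfolding usc_on_def lsc_on_def reflect_def
proof (intro ballI allI impI)
  fix p c assume *: "\<forall>p\<in>half_plane. \<forall>c>u p. \<forall>\<^sub>F q in at p within half_plane. u q < c"
    and p: "p \<in> half_plane" and c: "c < 1 - u (- fst p, snd p)"
  have "\<forall>\<^sub>F q in at (- fst p, snd p) within half_plane. u q < 1 - c"
    using * p c by (auto simp: half_plane_def)
  from eventually_reflect[OF this] show "\<forall>\<^sub>F q in at p within half_plane. c < 1 - u (- fst q, snd q)"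
    by eventually_elim simp
qed

lemma reflect_bounded:
  assumes "bounded (u ` half_plane)"
  shows "bounded (reflect u ` half_plane)"
proof -
  obtain B where B: "\<And>p. p \<in> half_plane \<Longrightarrow> \<bar>u p\<bar> \<le> B"
    using assms unfolding bounded_iff by auto
  have "\<bar>reflect u p\<bar> \<le> 1 + B" if "p \<in> half_plane" for p
    using B[of "(- fst p, snd p)"] that by (auto simp: reflect_def half_plane_def)
  then show ?thesis unfolding bounded_iff by (auto intro!: exI[of _ "1 + B"])
qed

lemma reflect_subsolution:
  assumes \<alpha>: "0 < \<alpha>" "\<alpha> < 2" and u: "viscosity_supersolution \<alpha> u"
  shows "viscosity_subsolution \<alpha> (reflect u)"
  unfolding viscosity_subsolution_def
proof (intro conjI allI impI)
  show "bounded (reflect u ` half_plane)" "usc_on half_plane (reflect u)"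
    using u by (auto simp: viscosity_supersolution_def intro: reflect_bounded reflect_usc)
  fix x0 t0 \<tau> \<phi>
  assume t0: "0 < t0" and \<tau>: "0 < \<tau>" "\<tau> < t0" and \<phi>: "test_function \<phi>"
    and max: "\<forall>x. \<forall>t\<in>{t0 - \<tau><..<t0 + \<tau>}. reflect u (x, t) - \<phi> (x, t) \<le> reflect u (x0, t0) - \<phi> (x0, t0)"
  have "u (x, t) - reflect \<phi> (x, t) \<ge> u (- x0, t0) - reflect \<phi> (- x0, t0)" if "t \<in> {t0 - \<tau><..<t0 + \<tau>}" for x t
    using max[rule_format, OF that, of "- x"] by (simp add: reflect_def)
  then have "dt (reflect \<phi>) (- x0, t0) + \<bar>dx (reflect \<phi>) (- x0, t0)\<bar> * frac_lap \<alpha> (\<lambda>x. reflect \<phi> (x, t0)) (- x0) \<ge> 0"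
    using u t0 \<tau> test_function_reflect[OF \<phi>] unfolding viscosity_supersolution_def by blast
  then show "dt \<phi> (x0, t0) + \<bar>dx \<phi> (x0, t0)\<bar> * frac_lap \<alpha> (\<lambda>x. \<phi> (x, t0)) x0 \<le> 0"
    unfolding reflect_operator[OF \<phi> t0 \<alpha>] by simp
qed

lemma reflect_supersolution:
  assumes \<alpha>: "0 < \<alpha>" "\<alpha> < 2" and u: "viscosity_subsolution \<alpha> u"
  shows "viscosity_supersolution \<alpha> (reflect u)"
  unfolding viscosity_supersolution_def
proof (intro conjI allI impI)
  show "bounded (reflect u ` half_plane)" "lsc_on half_plane (reflect u)"
    using u by (auto simp: viscosity_subsolution_def intro: reflect_bounded reflect_lsc)
  fix x0 t0 \<tau> \<phi>
  assume t0: "0 < t0" and \<tau>: "0 < \<tau>" "\<tau> < t0" and \<phi>: "test_function \<phi>"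
    and min: "\<forall>x. \<forall>t\<in>{t0 - \<tau><..<t0 + \<tau>}. reflect u (x, t) - \<phi> (x, t) \<ge> reflect u (x0, t0) - \<phi> (x0, t0)"
  have "u (x, t) - reflect \<phi> (x, t) \<le> u (- x0, t0) - reflect \<phi> (- x0, t0)" if "t \<in> {t0 - \<tau><..<t0 + \<tau>}" for x t
    using min[rule_format, OF that, of "- x"] by (simp add: reflect_def)
  then have "dt (reflect \<phi>) (- x0, t0) + \<bar>dx (reflect \<phi>) (- x0, t0)\<bar> * frac_lap \<alpha> (\<lambda>x. reflect \<phi> (x, t0)) (- x0) \<le> 0"
    using u t0 \<tau> test_function_reflect[OF \<phi>] unfolding viscosity_subsolution_def by blast
  then show "dt \<phi> (x0, t0) + \<bar>dx \<phi> (x0, t0)\<bar> * frac_lap \<alpha> (\<lambda>x. \<phi> (x, t0)) x0 \<ge> 0"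
    unfolding reflect_operator[OF \<phi> t0 \<alpha>] by simp
qed

lemma usc_on_cong:
  assumes "\<And>p. p \<in> S \<Longrightarrow> u p = v p"
  shows "usc_on S u \<longleftrightarrow> usc_on S v"
proof -
  have "(\<forall>\<^sub>F q in at p within S. u q < c) \<longleftrightarrow> (\<forall>\<^sub>F q in at p within S. v q < c)" for p c
    using assms by (auto simp: eventually_at_filter elim: eventually_mono)
  then show ?thesis unfolding usc_on_def using assms by simp
qed

lemma lsc_on_cong:
  assumes "\<And>p. p \<in> S \<Longrightarrow> u p = v p"
  shows "lsc_on S u \<longleftrightarrow> lsc_on S v"
proof -
  have "(\<forall>\<^sub>F q in at p within S. c < u q) \<longleftrightarrow> (\<forall>\<^sub>F q in at p within S. c < v q)" for p c
    using assms by (auto simp: eventually_at_filter elim: eventually_mono)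
  then show ?thesis unfolding lsc_on_def using assms by simp
qed

text \<open>Envelopes will be identified on the closed half-plane only. The condition \<tau> < t0
  keeps every time occurring in the definitions positive.\<close>

lemma
  assumes eq: "\<And>p. p \<in> half_plane \<Longrightarrow> u p = v p"
  shows viscosity_subsolution_cong: "viscosity_subsolution \<alpha> u \<longleftrightarrow> viscosity_subsolution \<alpha> v"
    and viscosity_supersolution_cong: "viscosity_supersolution \<alpha> u \<longleftrightarrow> viscosity_supersolution \<alpha> v"
proof -
  have img: "u ` half_plane = v ` half_plane" using eq by (intro image_cong) auto
  have e: "u (x, t) = v (x, t)" if "\<tau> < t0" "t \<in> {t0 - \<tau><..<t0 + \<tau>}" for x t t0 \<tau>
    using that by (intro eq) (auto simp: half_plane_def)
  have e0: "u (x, t) = v (x, t)" if "0 < t" for x t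
    using that by (intro eq) (auto simp: half_plane_def)
  have c: "usc_on half_plane u \<longleftrightarrow> usc_on half_plane v" "lsc_on half_plane u \<longleftrightarrow> lsc_on half_plane v"
    using usc_on_cong[of half_plane u v] lsc_on_cong[of half_plane u v] eq by blast+
  show "viscosity_subsolution \<alpha> u \<longleftrightarrow> viscosity_subsolution \<alpha> v"
    unfolding viscosity_subsolution_def img c using e e0 by (simp cong: conj_cong imp_cong)
  show "viscosity_supersolution \<alpha> u \<longleftrightarrow> viscosity_supersolution \<alpha> v"
    unfolding viscosity_supersolution_def img c using e e0 by (simp cong: conj_cong imp_cong)
qed

section \<open>Semicontinuous envelopes\<close>

lemma eventually_inf_nhds_principal:
  assumes "p \<in> S"
  shows "eventually P (inf (nhds p) (principal S)) \<longleftrightarrow> P p \<and> eventually P (at p within S)"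
proof
  assume "eventually P (inf (nhds p) (principal S))"
  then show "P p \<and> eventually P (at p within S)"
    using assms eventually_nhds_x_imp_x[of "\<lambda>q. q \<in> S \<longrightarrow> P q" p]
    by (auto simp: eventually_inf_principal eventually_at_filter elim: eventually_mono)
next
  assume "P p \<and> eventually P (at p within S)"
  then show "eventually P (inf (nhds p) (principal S))"
    by (auto simp: eventually_inf_principal eventually_at_filter elim: eventually_mono)
qed

lemma inf_nhds_principal_neq_bot: "p \<in> S \<Longrightarrow> inf (nhds p) (principal S) \<noteq> bot"
  using eventually_inf_nhds_principal[of p S "\<lambda>_. False"] by (auto simp: trivial_limit_def)

lemma
  assumes "p \<in> S" "(u \<longlongrightarrow> u p) (at p within S)"
  shows usc_envelope_continuous: "usc_envelope S u p = u p"
    and lsc_envelope_continuous: "lsc_envelope S u p = u p"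
proof -
  have "(u \<longlongrightarrow> u p) (inf (nhds p) (principal S))"
    using assms unfolding tendsto_def by (simp add: eventually_inf_nhds_principal)
  then have "((\<lambda>q. ereal (u q)) \<longlongrightarrow> ereal (u p)) (inf (nhds p) (principal S))" by (rule tendsto_ereal)
  from lim_imp_Limsup[OF inf_nhds_principal_neq_bot this] lim_imp_Liminf[OF inf_nhds_principal_neq_bot this] assms(1)
  show "usc_envelope S u p = u p" "lsc_envelope S u p = u p"
    by (simp_all add: usc_envelope_def lsc_envelope_def)
qed

text \<open>The local bounds keep the extended-real limits finite, so that
  \<open>real_of_ereal\<close> does not return its default value 0.\<close>

lemma
  assumes "p \<in> S" "\<forall>\<^sub>F q in inf (nhds p) (principal S). l \<le> u q \<and> u q \<le> b"
  shows usc_envelope_bounds: "u p \<le> usc_envelope S u p" "usc_envelope S u p \<le> b"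
    and lsc_envelope_bounds: "l \<le> lsc_envelope S u p" "lsc_envelope S u p \<le> u p"
proof -
  let ?F = "inf (nhds p) (principal S)"
  have p: "\<forall>\<^sub>F q in ?F. P q \<Longrightarrow> P p" for P using eventually_inf_nhds_principal[OF assms(1)] by blast
  have 1: "Limsup ?F (\<lambda>q. ereal (u q)) \<le> ereal b"
    by (rule Limsup_bounded) (use assms(2) in \<open>auto elim: eventually_mono\<close>)
  have 2: "ereal (u p) \<le> Limsup ?F (\<lambda>q. ereal (u q))"
  proof (rule ccontr)
    assume "\<not> ereal (u p) \<le> Limsup ?F (\<lambda>q. ereal (u q))"
    then have "\<forall>\<^sub>F q in ?F. ereal (u q) < ereal (u p)" by (intro Limsup_lessD) auto
    from p[OF this] show False by simp
  qed
  have 3: "ereal l \<le> Liminf ?F (\<lambda>q. ereal (u q))"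
    by (rule Liminf_bounded) (use assms(2) in \<open>auto elim: eventually_mono\<close>)
  have 4: "Liminf ?F (\<lambda>q. ereal (u q)) \<le> ereal (u p)"
  proof (rule ccontr)
    assume "\<not> Liminf ?F (\<lambda>q. ereal (u q)) \<le> ereal (u p)"
    then have "\<forall>\<^sub>F q in ?F. ereal (u p) < ereal (u q)" by (intro less_LiminfD) auto
    from p[OF this] show False by simp
  qed
  show "u p \<le> usc_envelope S u p" "usc_envelope S u p \<le> b"
    unfolding usc_envelope_def using 1 2 by (cases "Limsup ?F (\<lambda>q. ereal (u q))"; simp)+
  show "l \<le> lsc_envelope S u p" "lsc_envelope S u p \<le> u p"
    unfolding lsc_envelope_def using 3 4 by (cases "Liminf ?F (\<lambda>q. ereal (u q))"; simp)+
qed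

lemma usc_envelope_eq_upper:
  assumes "p \<in> S" "\<And>q. q \<in> S \<Longrightarrow> u q \<le> b" "\<And>U. open U \<Longrightarrow> p \<in> U \<Longrightarrow> \<exists>q\<in>U \<inter> S. u q = b"
  shows "usc_envelope S u p = b"
proof -
  let ?F = "inf (nhds p) (principal S)"
  have "Limsup ?F (\<lambda>q. ereal (u q)) \<le> ereal b"
    by (rule Limsup_bounded) (use assms(2) in \<open>auto simp: eventually_inf_principal\<close>)
  moreover have "\<not> Limsup ?F (\<lambda>q. ereal (u q)) < ereal b"
  proof
    assume "Limsup ?F (\<lambda>q. ereal (u q)) < ereal b"
    then have "\<forall>\<^sub>F q in nhds p. q \<in> S \<longrightarrow> u q < b"
      using Limsup_lessD by (fastforce simp: eventually_inf_principal)
    then obtain U where "open U" "p \<in> U" "\<forall>q\<in>U. q \<in> S \<longrightarrow> u q < b" unfolding eventually_nhds by blast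
    with assms(3)[of U] show False by auto
  qed
  ultimately have "Limsup ?F (\<lambda>q. ereal (u q)) = ereal b" by (simp add: antisym not_less)
  then show ?thesis by (simp add: usc_envelope_def)
qed

lemma lsc_envelope_eq_lower:
  assumes "p \<in> S" "\<And>q. q \<in> S \<Longrightarrow> b \<le> u q" "\<And>U. open U \<Longrightarrow> p \<in> U \<Longrightarrow> \<exists>q\<in>U \<inter> S. u q = b"
  shows "lsc_envelope S u p = b"
proof -
  let ?F = "inf (nhds p) (principal S)"
  have "ereal b \<le> Liminf ?F (\<lambda>q. ereal (u q))"
    by (rule Liminf_bounded) (use assms(2) in \<open>auto simp: eventually_inf_principal\<close>)
  moreover have "\<not> ereal b < Liminf ?F (\<lambda>q. ereal (u q))"
  proof
    assume "ereal b < Liminf ?F (\<lambda>q. ereal (u q))"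
    then have "\<forall>\<^sub>F q in nhds p. q \<in> S \<longrightarrow> b < u q"
      using less_LiminfD by (fastforce simp: eventually_inf_principal)
    then obtain U where "open U" "p \<in> U" "\<forall>q\<in>U. q \<in> S \<longrightarrow> b < u q" unfolding eventually_nhds by blast
    with assms(3)[of U] show False by auto
  qed
  ultimately have "Liminf ?F (\<lambda>q. ereal (u q)) = ereal b" by (simp add: antisym not_less)
  then show ?thesis by (simp add: lsc_envelope_def)
qed

lemma tendsto_heaviside: "x \<noteq> 0 \<Longrightarrow> (heaviside h \<longlongrightarrow> heaviside h x) (at x within S)"
proof -
  assume "x \<noteq> 0"
  then have "\<forall>\<^sub>F y in at x. heaviside h y = heaviside h x"
  proof (cases "x < 0")
    case True
    have "\<forall>\<^sub>F y in at x. y < 0" by (rule order_tendstoD(2)[OF tendsto_ident_at True])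
    then show ?thesis by (rule eventually_mono) (use True in \<open>auto simp: heaviside_def\<close>)
  next
    case False
    then have x: "0 < x" using \<open>x \<noteq> 0\<close> by simp
    have "\<forall>\<^sub>F y in at x. 0 < y" by (rule order_tendstoD(1)[OF tendsto_ident_at x])
    then show ?thesis by (rule eventually_mono) (use x in \<open>auto simp: heaviside_def\<close>)
  qed
  then have "(heaviside h \<longlongrightarrow> heaviside h x) (at x)" by (rule tendsto_eventually)
  then show ?thesis by (rule tendsto_within_subset) simp
qed

lemma open_real_contains:
  assumes "open U" "(0::real) \<in> U"
  obtains e where "0 < e" "e \<in> U" "- e \<in> U"
proof -
  obtain d where d: "0 < d" "ball 0 d \<subseteq> U" using assms openE by blast
  show ?thesis by (rule that[of "d/2"]) (use d in \<open>auto simp: subset_eq dist_real_def\<close>)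
qed

lemma heaviside_envelopes:
  assumes "0 \<le> h" "h \<le> 1"
  shows "usc_envelope UNIV (heaviside h) x = (if x < 0 then 0 else 1)"
    and "lsc_envelope UNIV (heaviside h) x = (if x \<le> 0 then 0 else 1)"
proof -
  have 1: "usc_envelope UNIV (heaviside h) 0 = 1"
  proof (rule usc_envelope_eq_upper)
    fix U :: "real set" assume "open U" "0 \<in> U"
    then obtain e where "0 < e" "e \<in> U" using open_real_contains by metis
    then show "\<exists>q\<in>U \<inter> UNIV. heaviside h q = 1" by (intro bexI[of _ e]) (auto simp: heaviside_def)
  qed (use assms in \<open>auto simp: heaviside_def\<close>)
  have 0: "lsc_envelope UNIV (heaviside h) 0 = 0"
  proof (rule lsc_envelope_eq_lower)
    fix U :: "real set" assume "open U" "0 \<in> U"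
    then obtain e where "0 < e" "- e \<in> U" using open_real_contains by metis
    then show "\<exists>q\<in>U \<inter> UNIV. heaviside h q = 0" by (intro bexI[of _ "- e"]) (auto simp: heaviside_def)
  qed (use assms in \<open>auto simp: heaviside_def\<close>)
  show "usc_envelope UNIV (heaviside h) x = (if x < 0 then 0 else 1)"
    "lsc_envelope UNIV (heaviside h) x = (if x \<le> 0 then 0 else 1)"
    using 0 1 usc_envelope_continuous[OF UNIV_I tendsto_heaviside, of x h]
      lsc_envelope_continuous[OF UNIV_I tendsto_heaviside, of x h]
    by (cases "x = 0"; auto simp: heaviside_def)+
qed

section \<open>Mollification and penalisation\<close>

text \<open>Convolution with the normalised indicator of a symmetric interval. Its derivative is a
  difference quotient of \<open>f\<close>, so one averaging turns a C^1 function into a C^2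
  one.\<close>

definition box_avg :: "real \<Rightarrow> (real \<Rightarrow> real) \<Rightarrow> real \<Rightarrow> real" where
  "box_avg \<eta> f y = (LINT s|lborel. indicator {- \<eta>..\<eta>} s * f (y + s)) / (2 * \<eta>)"

lemma box_avg_integrable:
  assumes "continuous_on UNIV f"
  shows "integrable lborel (\<lambda>s. indicator {- \<eta>..\<eta>::real} s * f (y + s) :: real)"
proof -
  have "continuous_on {- \<eta>..\<eta>} (\<lambda>s. f (y + s))"
    by (intro continuous_on_compose2[OF assms] continuous_intros) auto
  from borel_integrable_atLeastAtMost'[OF this] show ?thesis by (simp add: set_integrable_def)
qed

lemma box_avg_const: "0 < \<eta> \<Longrightarrow> box_avg \<eta> (\<lambda>y. c) y = c"
  by (simp add: box_avg_def)

lemma box_avg_mono: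
  assumes "continuous_on UNIV f" "continuous_on UNIV g" "0 < \<eta>"
    and "\<And>s. \<bar>s\<bar> \<le> \<eta> \<Longrightarrow> f (y + s) \<le> g (y + s)"
  shows "box_avg \<eta> f y \<le> box_avg \<eta> g y"
  unfolding box_avg_def using assms
  by (intro divide_right_mono integral_mono box_avg_integrable) (auto split: split_indicator)

lemma box_avg_bounds:
  assumes "continuous_on UNIV f" "0 < \<eta>" "\<And>s. \<bar>s\<bar> \<le> \<eta> \<Longrightarrow> l \<le> f (y + s) \<and> f (y + s) \<le> u"
  shows "l \<le> box_avg \<eta> f y" "box_avg \<eta> f y \<le> u"
  using box_avg_mono[of "\<lambda>_. l" f \<eta> y] box_avg_mono[of f "\<lambda>_. u" \<eta> y] assms
  by (auto simp: box_avg_const)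

lemma box_avg_diff:
  assumes "continuous_on UNIV f" "continuous_on UNIV g"
  shows "box_avg \<eta> (\<lambda>y. f y - g y) y = box_avg \<eta> f y - box_avg \<eta> g y"
  unfolding box_avg_def using assms
  by (simp add: right_diff_distrib box_avg_integrable diff_divide_distrib)

lemma box_avg_cmult: "box_avg \<eta> (\<lambda>y. c * f y) y = c * box_avg \<eta> f y"
  unfolding box_avg_def by (simp add: mult.left_commute)

lemma box_avg_eq_primitive:
  assumes "continuous_on UNIV f" "0 < \<eta>" "\<And>y. (F has_real_derivative f y) (at y)"
  shows "box_avg \<eta> f y = (F (y + \<eta>) - F (y - \<eta>)) / (2 * \<eta>)"
proof -
  have "(LINT s|lborel. indicator {- \<eta>..\<eta>} s *\<^sub>R f (y + s)) = F (y + \<eta>) - F (y + (- \<eta>))"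
  proof (rule integral_FTC_Icc)
    show "((\<lambda>s. F (y + s)) has_vector_derivative f (y + s)) (at s within {- \<eta>..\<eta>})" for s
    proof -
      have "((\<lambda>s. F (y + s)) has_real_derivative f (y + s) * (0 + 1)) (at s)"
        by (rule DERIV_chain2[OF assms(3)]) (auto intro!: derivative_eq_intros)
      from has_field_derivative_at_within[OF this] show ?thesis
        unfolding has_real_derivative_iff_has_vector_derivative[symmetric] by simp
    qed
    show "continuous_on {- \<eta>..\<eta>} (\<lambda>s. f (y + s))"
      by (intro continuous_on_compose2[OF assms(1)] continuous_intros) auto
  qed (use assms(2) in simp)
  then show ?thesis by (simp add: box_avg_def)
qed

text \<open>Symmetry of the interval: averaging preserves the linear right-hand side of the profile
  equation.\<close>

lemma box_avg_ident: "0 < \<eta> \<Longrightarrow> box_avg \<eta> (\<lambda>y. y) y = y"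
  by (subst box_avg_eq_primitive[where F="\<lambda>y. y\<^sup>2 / 2"])
     (auto intro!: derivative_eq_intros continuous_intros simp: power2_eq_square field_simps)

lemma continuous_primitive:
  fixes f :: "real \<Rightarrow> real"
  assumes "continuous_on UNIV f"
  obtains F where "\<And>y. (F has_real_derivative f y) (at y)"
proof
  fix x
  have "((\<lambda>u. LBINT y=ereal 0..ereal u. f y) has_vector_derivative f x) (at x within {- \<bar>x\<bar> - 1..\<bar>x\<bar> + 1})"
    by (rule interval_integral_FTC2) (auto intro: continuous_on_subset[OF assms])
  then show "((\<lambda>u. LBINT y=ereal 0..ereal u. f y) has_real_derivative f x) (at x)"
    unfolding has_real_derivative_iff_has_vector_derivative by (subst (asm) at_within_interior) auto
qed

lemma DERIV_box_avg:
  assumes "continuous_on UNIV f" "0 < \<eta>"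
  shows "(box_avg \<eta> f has_real_derivative (f (y + \<eta>) - f (y - \<eta>)) / (2 * \<eta>)) (at y)"
proof -
  obtain F where F: "\<And>y. (F has_real_derivative f y) (at y)" using continuous_primitive[OF assms(1)] by blast
  have "((\<lambda>y. (F (y + \<eta>) - F (y - \<eta>)) / (2 * \<eta>)) has_real_derivative (f (y + \<eta>) - f (y - \<eta>)) / (2 * \<eta>)) (at y)"
    using assms(2) by (auto intro!: derivative_eq_intros DERIV_chain2[OF F] simp: field_simps)
  then show ?thesis unfolding box_avg_eq_primitive[OF assms F, abs_def] .
qed

lemma abs_cmult_bounded:
  fixes f :: "real \<Rightarrow> real"
  assumes "\<And>x. \<bar>f x\<bar> \<le> I"
  obtains c where "0 < c" "\<And>x. \<bar>C * f x\<bar> \<le> c"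
proof (rule that)
  show "0 < \<bar>C\<bar> * I + 1" using assms[of 0] by (intro add_nonneg_pos mult_nonneg_nonneg) auto
  show "\<bar>C * f x\<bar> \<le> \<bar>C\<bar> * I + 1" for x
    unfolding abs_mult using assms[of x] by (intro add_increasing2 mult_left_mono) auto
qed

section \<open>The localising penalty\<close>

text \<open>Test functions must be bounded, so localisation cannot rely on growth. This function
  saturates at 1; multiplied by a constant above the bound of the subsolution, it still confines the
  maximum.\<close>

definition penalty :: "real \<Rightarrow> real" where
  "penalty x = x\<^sup>2 / (1 + x\<^sup>2)"

definition penalty' :: "real \<Rightarrow> real" where
  "penalty' x = 2 * x / (1 + x\<^sup>2)\<^sup>2"

definition penalty'' :: "real \<Rightarrow> real" where
  "penalty'' x = (2 - 6 * x\<^sup>2) / (1 + x\<^sup>2) ^ 3"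

lemma one_plus_square_pos: "0 < 1 + (x::real)\<^sup>2"
  by (simp add: add_pos_nonneg)

lemma DERIV_penalty: "(penalty has_real_derivative penalty' x) (at x)"
  unfolding penalty_def [abs_def] penalty'_def using one_plus_square_pos[of x]
  by (auto intro!: derivative_eq_intros simp: power2_eq_square algebra_simps)

lemma DERIV_penalty': "(penalty' has_real_derivative penalty'' x) (at x)"
proof -
  have "(penalty' has_real_derivative (2 * (1 + x\<^sup>2)\<^sup>2 - 2 * x * (2 * (1 + x\<^sup>2) * (2 * x))) / ((1 + x\<^sup>2)\<^sup>2 * (1 + x\<^sup>2)\<^sup>2)) (at x)"
    unfolding penalty'_def [abs_def] using one_plus_square_pos[of x]
    by (auto intro!: derivative_eq_intros)
  also have "2 * (1 + x\<^sup>2)\<^sup>2 - 2 * x * (2 * (1 + x\<^sup>2) * (2 * x)) = (1 + x\<^sup>2) * (2 - 6 * x\<^sup>2)"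
    by (simp add: power2_eq_square algebra_simps)
  also have "(1 + x\<^sup>2) * (2 - 6 * x\<^sup>2) / ((1 + x\<^sup>2)\<^sup>2 * (1 + x\<^sup>2)\<^sup>2) = penalty'' x"
  proof -
    have "(1 + x\<^sup>2)\<^sup>2 * (1 + x\<^sup>2)\<^sup>2 = (1 + x\<^sup>2) * (1 + x\<^sup>2) ^ 3" by (simp add: power2_eq_square power3_eq_cube mult_ac)
    then show ?thesis using one_plus_square_pos[of x] by (simp add: penalty''_def)
  qed
  finally show ?thesis .
qed

lemma continuous_on_penalty'': "continuous_on S penalty''"
  unfolding penalty''_def [abs_def] using one_plus_square_pos
  by (intro continuous_intros) (auto simp: less_imp_neq[symmetric])

lemma penalty_bounds: "0 \<le> penalty x" "penalty x \<le> 1"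
  using one_plus_square_pos[of x] by (auto simp: penalty_def divide_le_eq)

lemma abs_penalty'_le: "\<bar>penalty' x\<bar> \<le> 1"
proof -
  have "2 * \<bar>x\<bar> \<le> 1 + x\<^sup>2" using sum_squares_ge_zero[of "\<bar>x\<bar> - 1" 0] by (simp add: power2_eq_square algebra_simps)
  also have "\<dots> \<le> (1 + x\<^sup>2)\<^sup>2" using self_le_power[of "1 + x\<^sup>2" 2] by simp
  finally show ?thesis using one_plus_square_pos[of x] by (simp add: penalty'_def abs_mult divide_le_eq)
qed

lemma abs_penalty''_le: "\<bar>penalty'' x\<bar> \<le> 6"
proof -
  have "\<bar>2 - 6 * x\<^sup>2\<bar> \<le> 6 * (1 + x\<^sup>2)" using zero_le_power2[of x] by (smt (verit))
  also have "\<dots> \<le> 6 * (1 + x\<^sup>2) ^ 3" using self_le_power[of "1 + x\<^sup>2" 3] by simp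
  finally show ?thesis using one_plus_square_pos[of x] by (simp add: penalty''_def divide_le_eq)
qed

lemma penalty_measurable [measurable]: "penalty \<in> borel_measurable borel"
  unfolding penalty_def [abs_def] by measurable

lemma abs_sym_op_penalty_le:
  assumes \<alpha>: "0 < \<alpha>" "\<alpha> < 2"
  obtains c where "0 < c" "\<And>x. \<bar>riesz_const \<alpha> * sym_op \<alpha> penalty x\<bar> \<le> c"
proof -
  let ?I = "LINT z|lborel. levy_majorant \<alpha> 2 6 4 z"
  have "\<bar>sym_op \<alpha> penalty x\<bar> \<le> ?I" for x
    unfolding sym_op_def
  proof (rule abs_integral_levy_kernel_le)
    show "\<bar>second_diff penalty x z\<bar> \<le> 6 * z powr 2" if "0 < z" for z
      using second_diff_Taylor[OF DERIV_penalty DERIV_penalty' abs_penalty''_le] that by simp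
    show "\<bar>second_diff penalty x z\<bar> \<le> 4" for z
      using second_diff_le[of penalty 1 x z] penalty_bounds by simp
  qed (use \<alpha> in auto)
  then show ?thesis using abs_cmult_bounded[of "sym_op \<alpha> penalty" _ "riesz_const \<alpha>"] that by blast
qed

text \<open>The summand 0 keeps the shape (x + a) / c to which \<open>sym_op_affine\<close>
  applies.\<close>

lemma test_function_penalty:
  assumes "0 < R"
  shows "test_function (\<lambda>p. L * penalty ((fst p + 0) / R))"
  unfolding test_function_def
proof
  have d: "((\<lambda>x. (x + 0) / R) has_real_derivative 1 / R) (at x)" for x
    using assms by (auto intro!: derivative_eq_intros)
  note 1 = DERIV_cmult[OF DERIV_chain2[OF DERIV_penalty d], of L]
  note 2 = DERIV_cmult[OF DERIV_cmult_right[OF DERIV_chain2[OF DERIV_penalty' d]], of L]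
  show "C2_on open_half_plane (\<lambda>p. L * penalty ((fst p + 0) / R))"
    by (rule C2_on_compose[OF open_open_half_plane C2_on_fst 1 2])
       (use assms in \<open>auto intro!: continuous_intros continuous_on_compose2[OF continuous_on_penalty''[of UNIV]]\<close>)
  show "bounded ((\<lambda>p. L * penalty ((fst p + 0) / R)) ` open_half_plane)"
    unfolding bounded_iff using penalty_bounds
    by (intro exI[of _ "\<bar>L\<bar> * 1"]) (auto simp: abs_mult intro!: mult_left_le)
qed

lemma test_function_exp:
  assumes "0 \<le> \<epsilon>"
  shows "test_function (\<lambda>p. L * (1 - exp (- (\<epsilon> * snd p))))"
  unfolding test_function_def
proof
  have 1: "((\<lambda>t. L * (1 - exp (- (\<epsilon> * t)))) has_real_derivative L * \<epsilon> * exp (- (\<epsilon> * t))) (at t)"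
    and 2: "((\<lambda>t. L * \<epsilon> * exp (- (\<epsilon> * t))) has_real_derivative - (L * \<epsilon> * \<epsilon> * exp (- (\<epsilon> * t)))) (at t)" for t
    by (auto intro!: derivative_eq_intros)
  show "C2_on open_half_plane (\<lambda>p. L * (1 - exp (- (\<epsilon> * snd p))))"
    by (rule C2_on_compose[OF open_open_half_plane C2_on_snd 1 2]) (auto intro!: continuous_intros)
  show "bounded ((\<lambda>p. L * (1 - exp (- (\<epsilon> * snd p)))) ` open_half_plane)"
    unfolding bounded_iff
  proof (intro exI ballI)
    fix y assume "y \<in> (\<lambda>p. L * (1 - exp (- (\<epsilon> * snd p)))) ` open_half_plane"
    then obtain t where t: "0 < t" "y = L * (1 - exp (- (\<epsilon> * t)))" by (auto simp: open_half_plane_def)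
    then have "\<bar>1 - exp (- (\<epsilon> * t))\<bar> \<le> 1" using assms by (simp add: abs_le_iff)
    then show "norm y \<le> \<bar>L\<bar> * 1" unfolding t(2) real_norm_def abs_mult by (intro mult_left_mono) auto
  qed
qed

lemma sym_op_add_const:
  assumes "integrable lborel (levy_quotient \<alpha> f x)"
    and "integrable lborel (levy_quotient \<alpha> g x)"
  shows "sym_op \<alpha> (\<lambda>x. f x + (c + g x)) x = sym_op \<alpha> f x + sym_op \<alpha> g x"
proof -
  have "levy_quotient \<alpha> (\<lambda>x. f x + (c + g x)) x z =
      levy_quotient \<alpha> f x z + levy_quotient \<alpha> g x z" for z
  proof -
    have "second_diff (\<lambda>x. f x + (c + g x)) x z = second_diff f x z + second_diff g x z"
      by (simp add: second_diff_def)
    then show ?thesis by (simp add: add_divide_distrib distrib_left)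
  qed
  then show ?thesis unfolding sym_op_def using assms by simp
qed

lemma sym_op_cmult: "sym_op \<alpha> (\<lambda>x. L * f x) x = L * sym_op \<alpha> f x"
proof -
  have ker: "levy_quotient \<alpha> (\<lambda>x. L * f x) x z =
      L * (levy_quotient \<alpha> f x z)" for z
    by (simp add: second_diff_def algebra_simps diff_divide_distrib add_divide_distrib)
  show ?thesis unfolding sym_op_def ker by (rule integral_mult_right_zero)
qed

section \<open>The profile equation\<close>

context
  fixes \<alpha> :: real
  assumes \<alpha>: "0 < \<alpha>" "\<alpha> < 2"
begin

abbreviation "\<Phi> \<equiv> profile_Phi \<alpha>"
abbreviation "y\<^sub>\<alpha> \<equiv> profile_y \<alpha>"
abbreviation "\<gamma> \<equiv> 1 / (\<alpha> + 1)"

lemma profile_const_pos: "0 < profile_const \<alpha>"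
  using \<alpha> by (simp add: profile_const_def)

lemma profile_v_eq: "profile_v \<alpha> y = profile_const \<alpha> * bump (\<alpha>/2) y"
  using \<alpha> abs_square_less_1[of y] bump_eq_0[of y "\<alpha>/2"] by (auto simp: profile_v_def bump_def max_def)

lemma continuous_on_profile_v: "continuous_on S (profile_v \<alpha>)"
  unfolding profile_v_eq [abs_def] using \<alpha> by (intro continuous_intros continuous_on_bump) auto

lemma profile_v_nonneg: "0 \<le> profile_v \<alpha> y"
  unfolding profile_v_eq using profile_const_pos by simp

lemma DERIV_profile_U: "(profile_U \<alpha> has_real_derivative profile_v \<alpha> x) (at x)"
proof -
  have "((\<lambda>u. LBINT y=ereal 0..ereal u. profile_v \<alpha> y) has_vector_derivative profile_v \<alpha> x)
      (at x within {- \<bar>x\<bar> - 1..\<bar>x\<bar> + 1})"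
    by (rule interval_integral_FTC2) (auto intro: continuous_on_profile_v)
  then have "((\<lambda>u. LBINT y=ereal 0..ereal u. profile_v \<alpha> y) has_vector_derivative profile_v \<alpha> x) (at x)"
    by (subst (asm) at_within_interior) auto
  then show ?thesis
    unfolding has_real_derivative_iff_has_vector_derivative profile_U_def [abs_def] .
qed

lemma profile_U_0: "profile_U \<alpha> 0 = 0"
  by (simp add: profile_U_def)

lemma profile_U_1: "profile_U \<alpha> 1 = profile_M \<alpha>"
  by (simp add: profile_U_def profile_M_def)

lemma profile_U_minus: "profile_U \<alpha> (- x) = - profile_U \<alpha> x"
proof -
  have "((\<lambda>x. profile_U \<alpha> x + profile_U \<alpha> (- x)) has_real_derivative 0) (at x)" for x
    by (auto intro!: derivative_eq_intros DERIV_profile_U DERIV_chain2[OF DERIV_profile_U] simp: profile_v_eq)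
  from DERIV_isconst_all[OF allI[OF this], of x 0] show ?thesis by (simp add: profile_U_0)
qed

lemma profile_U_ge_1:
  assumes "1 \<le> x"
  shows "profile_U \<alpha> x = profile_M \<alpha>"
proof -
  have "\<exists>z. 1 < z \<and> z < x \<and> profile_U \<alpha> x - profile_U \<alpha> 1 = (x - 1) * profile_v \<alpha> z" if "1 < x"
    using that DERIV_profile_U by (intro MVT2) auto
  then show ?thesis using assms by (cases "x = 1") (auto simp: profile_U_1 profile_v_def)
qed

lemma profile_M_pos: "0 < profile_M \<alpha>"
proof -
  have "\<exists>z>0. z < 1 \<and> profile_U \<alpha> 1 - profile_U \<alpha> 0 = (1 - 0) * profile_v \<alpha> z"
    using DERIV_profile_U by (intro MVT2) auto
  then show ?thesis using bump_pos profile_const_pos by (auto simp: profile_U_1 profile_U_0 profile_v_eq)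
qed

lemma profile_y_pos: "0 < y\<^sub>\<alpha>"
  using \<alpha> profile_M_pos by (simp add: profile_y_def)

lemma profile_y_powr: "y\<^sub>\<alpha> powr (\<alpha> + 1) = (\<alpha> + 1) / (2 * profile_M \<alpha>)"
  using \<alpha> profile_M_pos by (simp add: profile_y_def powr_powr)

definition profile_dPhi :: "real \<Rightarrow> real" where
  "profile_dPhi y = profile_v \<alpha> (y / y\<^sub>\<alpha>) / (2 * profile_M \<alpha> * y\<^sub>\<alpha>)"

lemma DERIV_profile_Phi: "(\<Phi> has_real_derivative profile_dPhi y) (at y)"
proof -
  have "((\<lambda>y. y / y\<^sub>\<alpha>) has_real_derivative 1 / y\<^sub>\<alpha>) (at y)"
    using profile_y_pos by (auto intro!: derivative_eq_intros)
  from DERIV_chain2[OF DERIV_profile_U this] show ?thesis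
    unfolding profile_Phi_def [abs_def] profile_dPhi_def using profile_y_pos profile_M_pos
    by (auto intro!: derivative_eq_intros)
qed

lemma profile_dPhi_nonneg: "0 \<le> profile_dPhi y"
  unfolding profile_dPhi_def using profile_y_pos profile_M_pos profile_v_nonneg by simp

lemma profile_dPhi_eq_0: "y\<^sub>\<alpha> \<le> \<bar>y\<bar> \<Longrightarrow> profile_dPhi y = 0"
  unfolding profile_dPhi_def profile_v_eq using profile_y_pos by (subst bump_eq_0) auto

lemma continuous_on_profile_dPhi: "continuous_on S profile_dPhi"
  unfolding profile_dPhi_def [abs_def] using profile_y_pos profile_M_pos
  by (intro continuous_intros continuous_on_compose2[OF continuous_on_profile_v[of UNIV]]) auto

lemma profile_dPhi_bounded: obtains m where "0 < m" "\<And>y. profile_dPhi y \<le> m"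
proof
  let ?m = "profile_const \<alpha> * 1 / (2 * profile_M \<alpha> * y\<^sub>\<alpha>)"
  show "0 < ?m" using profile_const_pos profile_M_pos profile_y_pos by simp
  show "profile_dPhi y \<le> ?m" for y
    unfolding profile_dPhi_def profile_v_eq using \<alpha> profile_const_pos profile_M_pos profile_y_pos
    by (intro divide_right_mono mult_left_mono bump_le_1) auto
qed

lemma profile_Phi_minus: "\<Phi> (- y) = 1 - \<Phi> y"
  using profile_M_pos by (simp add: profile_Phi_def profile_U_minus field_simps)

lemma profile_Phi_eq_1: "y\<^sub>\<alpha> \<le> y \<Longrightarrow> \<Phi> y = 1"
  using profile_M_pos profile_y_pos by (simp add: profile_Phi_def profile_U_ge_1)

lemma profile_Phi_eq_0: "y \<le> - y\<^sub>\<alpha> \<Longrightarrow> \<Phi> y = 0"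
  using profile_Phi_eq_1[of "- y"] profile_Phi_minus[of y] by simp

lemma profile_Phi_mono: "x \<le> y \<Longrightarrow> \<Phi> x \<le> \<Phi> y"
  using DERIV_profile_Phi profile_dPhi_nonneg by (meson DERIV_nonneg_imp_nondecreasing)

lemma profile_Phi_le_1: "\<Phi> y \<le> 1"
  using profile_Phi_mono[of y "max y (y\<^sub>\<alpha>)"] profile_Phi_eq_1[of "max y (y\<^sub>\<alpha>)"] by simp

lemma profile_Phi_nonneg: "0 \<le> \<Phi> y"
  using profile_Phi_le_1[of "- y"] by (simp add: profile_Phi_minus)

lemma continuous_on_profile_Phi: "continuous_on S \<Phi>"
  using DERIV_profile_Phi by (intro continuous_at_imp_continuous_on) (auto intro: DERIV_isCont)

lemma isCont_profile_Phi: "isCont \<Phi> y"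
  using DERIV_profile_Phi by (rule DERIV_isCont)

lemma profile_Phi_measurable [measurable]: "\<Phi> \<in> borel_measurable borel"
  by (rule borel_measurable_continuous_onI[OF continuous_on_profile_Phi])

text \<open>The mean value theorem for \<Phi>(y + z) + \<Phi>(y - z) brings in a difference of
  derivatives, which is Hoelder of exponent \<alpha>/2. The constant is the same at every y, free
  boundary included.\<close>

lemma second_diff_profile_Phi_hoelder:
  obtains A where "0 \<le> A" "\<And>y z. 0 < z \<Longrightarrow> \<bar>second_diff \<Phi> y z\<bar> \<le> A * z powr (1 + \<alpha>/2)"
proof
  \<comment> \<open>The 4 combines the factor 2 of \<open>bump_hoelder\<close> with the distance 2s
    between y + s and y - s.\<close>
  let ?A = "profile_const \<alpha> * (4 / y\<^sub>\<alpha>) powr (\<alpha>/2) / (2 * profile_M \<alpha> * y\<^sub>\<alpha>)"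
  show "0 \<le> ?A" using profile_const_pos profile_M_pos profile_y_pos by simp
  fix y z :: real assume z: "0 < z"
  have h: "\<bar>profile_dPhi (y + s) - profile_dPhi (y - s)\<bar> \<le> ?A * z powr (\<alpha>/2)" if "0 < s" "s < z" for s
  proof -
    have "\<bar>bump (\<alpha>/2) ((y + s) / y\<^sub>\<alpha>) - bump (\<alpha>/2) ((y - s) / y\<^sub>\<alpha>)\<bar> \<le> (4 / y\<^sub>\<alpha> * s) powr (\<alpha>/2)"
    proof -
      have "2 * \<bar>(y + s) / y\<^sub>\<alpha> - (y - s) / y\<^sub>\<alpha>\<bar> = 4 / y\<^sub>\<alpha> * s"
        using that profile_y_pos by (simp add: diff_divide_distrib[symmetric])
      then show ?thesis using bump_hoelder[of "\<alpha>/2" "(y + s) / y\<^sub>\<alpha>" "(y - s) / y\<^sub>\<alpha>"] \<alpha> by simp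
    qed
    also have "\<dots> \<le> (4 / y\<^sub>\<alpha> * z) powr (\<alpha>/2)"
      using that \<alpha> profile_y_pos by (intro powr_mono2 mult_left_mono) auto
    also have "\<dots> = (4 / y\<^sub>\<alpha>) powr (\<alpha>/2) * z powr (\<alpha>/2)"
      using z profile_y_pos by (subst powr_mult) auto
    finally have "profile_const \<alpha> * \<bar>bump (\<alpha>/2) ((y + s) / y\<^sub>\<alpha>) - bump (\<alpha>/2) ((y - s) / y\<^sub>\<alpha>)\<bar> / (2 * profile_M \<alpha> * y\<^sub>\<alpha>)
        \<le> profile_const \<alpha> * ((4 / y\<^sub>\<alpha>) powr (\<alpha>/2) * z powr (\<alpha>/2)) / (2 * profile_M \<alpha> * y\<^sub>\<alpha>)"
      using profile_const_pos profile_M_pos profile_y_pos by (intro divide_right_mono mult_left_mono) auto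
    moreover have "\<bar>profile_dPhi (y + s) - profile_dPhi (y - s)\<bar> =
        profile_const \<alpha> * \<bar>bump (\<alpha>/2) ((y + s) / y\<^sub>\<alpha>) - bump (\<alpha>/2) ((y - s) / y\<^sub>\<alpha>)\<bar> / (2 * profile_M \<alpha> * y\<^sub>\<alpha>)"
      using profile_const_pos profile_M_pos profile_y_pos unfolding profile_dPhi_def profile_v_eq
      by (simp add: diff_divide_distrib[symmetric] right_diff_distrib[symmetric] abs_mult)
    ultimately show ?thesis by simp
  qed
  have "\<exists>s. 0 < s \<and> s < z \<and> (\<Phi> (y + z) + \<Phi> (y - z)) - (\<Phi> (y + 0) + \<Phi> (y - 0))
      = (z - 0) * (profile_dPhi (y + s) - profile_dPhi (y - s))"
    using z by (intro MVT2) (auto intro!: derivative_eq_intros DERIV_chain2[OF DERIV_profile_Phi])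
  then obtain s where s: "0 < s" "s < z" "second_diff \<Phi> y z = - (z * (profile_dPhi (y + s) - profile_dPhi (y - s)))"
    unfolding second_diff_def by auto
  have "\<bar>second_diff \<Phi> y z\<bar> = z * \<bar>profile_dPhi (y + s) - profile_dPhi (y - s)\<bar>"
    using s(3) z by (simp add: abs_mult)
  also have "\<dots> \<le> z * (?A * z powr (\<alpha>/2))" using z by (intro mult_left_mono h s) auto
  finally show "\<bar>second_diff \<Phi> y z\<bar> \<le> ?A * z powr (1 + \<alpha>/2)"
    using z by (simp add: powr_add mult_ac)
qed

lemma second_diff_profile_Phi_le: "\<bar>second_diff \<Phi> y z\<bar> \<le> 4"
  using second_diff_le[of "\<Phi>" 1 y z] profile_Phi_nonneg profile_Phi_le_1 by simp

text \<open>The majorant does not depend on y: dominated convergence then makes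
  \<open>sym_op \<alpha> \<Phi>\<close> continuous on the whole line, and Fubini applies to its
  averages.\<close>

lemma profile_majorant:
  obtains h where "integrable lborel h"
    "\<And>y z. \<bar>levy_quotient \<alpha> \<Phi> y z\<bar> \<le> h z"
proof -
  obtain A where A: "\<And>y z. 0 < z \<Longrightarrow> \<bar>second_diff \<Phi> y z\<bar> \<le> A * z powr (1 + \<alpha>/2)"
    using second_diff_profile_Phi_hoelder by metis
  show ?thesis
  proof (rule that)
    show "integrable lborel (levy_majorant \<alpha> (1 + \<alpha>/2) A 4)"
      by (rule integrable_levy_majorant) (use \<alpha> in auto)
    show "\<bar>levy_quotient \<alpha> \<Phi> y z\<bar> \<le> levy_majorant \<alpha> (1 + \<alpha>/2) A 4 z" for y z
      by (rule levy_majorant_bound) (use A second_diff_profile_Phi_le in auto)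
  qed
qed

lemma integrable_sym_op_profile_Phi:
  "integrable lborel (\<lambda>z. levy_quotient \<alpha> \<Phi> y z)"
proof -
  obtain h where h: "integrable lborel h"
    "\<And>y z. \<bar>levy_quotient \<alpha> \<Phi> y z\<bar> \<le> h z"
    using profile_majorant by blast
  show ?thesis
    by (rule Bochner_Integration.integrable_bound[OF h(1)]) (use h(2) in \<open>auto intro: order_trans[OF _ abs_ge_self]\<close>)
qed

lemma isCont_sym_op_profile_Phi: "isCont (sym_op \<alpha> \<Phi>) y"
proof -
  obtain h where h: "integrable lborel h"
    "\<And>y z. \<bar>levy_quotient \<alpha> \<Phi> y z\<bar> \<le> h z"
    using profile_majorant by blast
  show ?thesis
    unfolding continuous_at_sequentially comp_def
  proof (intro allI impI)
    fix Y :: "nat \<Rightarrow> real" assume Y: "Y \<longlonglongrightarrow> y"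
    show "(\<lambda>n. sym_op \<alpha> \<Phi> (Y n)) \<longlonglongrightarrow> sym_op \<alpha> \<Phi> y"
      unfolding sym_op_def
    proof (rule integral_dominated_convergence[where w=h])
      show "AE z in lborel. (\<lambda>n. levy_quotient \<alpha> \<Phi> (Y n) z)
          \<longlonglongrightarrow> levy_quotient \<alpha> \<Phi> y z"
      proof (intro AE_I2)
        fix z :: real
        have c: "(\<lambda>n. \<Phi> (Z n)) \<longlonglongrightarrow> \<Phi> l" if "Z \<longlonglongrightarrow> l" for Z l
          using isCont_tendsto_compose[OF isCont_profile_Phi that] .
        have d: "(\<lambda>n. second_diff \<Phi> (Y n) z) \<longlonglongrightarrow> second_diff \<Phi> y z"
          unfolding second_diff_def by (intro tendsto_intros c Y)
        show "(\<lambda>n. levy_quotient \<alpha> \<Phi> (Y n) z)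
          \<longlonglongrightarrow> levy_quotient \<alpha> \<Phi> y z"
          by (cases "0 < z") (auto intro!: tendsto_intros d)
      qed
    qed (use h in auto)
  qed
qed

lemma sym_op_profile_U:
  assumes "\<bar>x\<bar> < 1"
  shows "sym_op \<alpha> (profile_U \<alpha>) x = 2 * profile_const \<alpha> * Beta (1 - \<alpha>/2) (1 + \<alpha>/2) / \<alpha> * x"
proof -
  have eq: "indicator {0<..} r * ((profile_v \<alpha> (x - r) - profile_v \<alpha> (x + r)) / r powr \<alpha>) =
      profile_const \<alpha> * (indicator {0<..} r * ((bump (\<alpha>/2) (x - r) - bump (\<alpha>/2) (x + r)) / r powr \<alpha>))" for r
    unfolding profile_v_eq by (simp add: right_diff_distrib[symmetric])
  show ?thesis
    by (subst sym_op_eq_deriv_kernel[OF \<alpha>(1) DERIV_profile_U continuous_on_profile_v])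
       (use bump_kernel_integrable[OF \<alpha>, of x] bump_kernel_integral[OF \<alpha> assms] in \<open>simp_all only: eq integral_mult_right_zero integrable_mult_right, simp\<close>)
qed

text \<open>This is what \<open>profile_const\<close> is made for: the operator applied to
  \<open>profile_U\<close> gives x itself on (-1,1).\<close>

lemma riesz_const_profile: "riesz_const \<alpha> * (2 * profile_const \<alpha> * Beta (1 - \<alpha>/2) (1 + \<alpha>/2) / \<alpha>) = 1"
proof -
  have two: "2 * 2 powr (\<alpha> - 1) = 2 powr \<alpha>" by (simp add: powr_diff)
  have pos: "0 < Gamma (1 - \<alpha>/2)" "0 < Gamma (1 + \<alpha>/2)" "0 < Gamma ((1 + \<alpha>)/2)" using \<alpha> by simp_all
  have B: "Beta (1 - \<alpha>/2) (1 + \<alpha>/2) = Gamma (1 - \<alpha>/2) * Gamma (1 + \<alpha>/2)"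
    using Gamma_fact[of 1, where 'a=real] by (simp add: Beta_def)
  have "riesz_const \<alpha> * (2 * profile_const \<alpha> * Beta (1 - \<alpha>/2) (1 + \<alpha>/2) / \<alpha>)
      = (2 * 2 powr (\<alpha> - 1)) / 2 powr \<alpha>"
    unfolding riesz_const_def profile_const_def B Gamma_one_half_real using pos[THEN less_imp_neq] \<alpha>
    by (simp add: divide_simps)
  then show ?thesis unfolding two by simp
qed

text \<open>Inside, scaling by \<open>y\<^sub>\<alpha>\<close> produces the factor 1 / (2 M
  \<open>y\<^sub>\<alpha>\<close>^(\<alpha>+1)), and \<open>y\<^sub>\<alpha>\<close> is defined so
  that this is 1 / (\<alpha>+1). The endpoints follow because the set of solutions of the equation
  is closed.\<close>

lemma sym_op_profile_Phi:
  assumes "\<bar>y\<bar> \<le> y\<^sub>\<alpha>"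
  shows "riesz_const \<alpha> * sym_op \<alpha> \<Phi> y = y / (\<alpha> + 1)"
proof -
  have interior: "riesz_const \<alpha> * sym_op \<alpha> \<Phi> y = y / (\<alpha> + 1)" if y: "\<bar>y\<bar> < y\<^sub>\<alpha>" for y
  proof -
    let ?U = "\<lambda>x. profile_U \<alpha> ((x + 0) / y\<^sub>\<alpha>)"
    have "second_diff \<Phi> y z = 1 / (2 * profile_M \<alpha>) * second_diff ?U y z" for z
    proof -
      have "2 * (c * (a + m)) - c * (b + m) - c * (d + m) = c * (2 * a - b - d)" for a b c d m :: real
        by (simp add: algebra_simps)
      then show ?thesis unfolding second_diff_def profile_Phi_def add_0_right .
    qed
    then have "sym_op \<alpha> \<Phi> y = 1 / (2 * profile_M \<alpha>) * sym_op \<alpha> ?U y"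
      unfolding sym_op_def integral_mult_right_zero[symmetric] by (simp add: mult_ac)
    also have "sym_op \<alpha> ?U y = y\<^sub>\<alpha> powr (- \<alpha>) * sym_op \<alpha> (profile_U \<alpha>) ((y + 0) / y\<^sub>\<alpha>)"
      by (rule sym_op_affine[OF profile_y_pos])
    also have "sym_op \<alpha> (profile_U \<alpha>) ((y + 0) / y\<^sub>\<alpha>) =
        2 * profile_const \<alpha> * Beta (1 - \<alpha>/2) (1 + \<alpha>/2) / \<alpha> * ((y + 0) / y\<^sub>\<alpha>)"
      by (rule sym_op_profile_U) (use y profile_y_pos in auto)
    finally have "riesz_const \<alpha> * sym_op \<alpha> \<Phi> y =
        (riesz_const \<alpha> * (2 * profile_const \<alpha> * Beta (1 - \<alpha>/2) (1 + \<alpha>/2) / \<alpha>)) *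
        (y / (2 * profile_M \<alpha> * (y\<^sub>\<alpha> / y\<^sub>\<alpha> powr (- \<alpha>))))"
      by (simp add: mult_ac)
    also have "y\<^sub>\<alpha> / y\<^sub>\<alpha> powr (- \<alpha>) = y\<^sub>\<alpha> powr (\<alpha> + 1)"
      using profile_y_pos by (simp add: powr_add powr_minus divide_simps)
    finally show ?thesis
      unfolding riesz_const_profile profile_y_powr using profile_M_pos by simp
  qed
  have "closedin (top_of_set UNIV) {y. riesz_const \<alpha> * sym_op \<alpha> \<Phi> y = y / (\<alpha> + 1)}"
    using isCont_sym_op_profile_Phi \<alpha>
    by (auto intro!: closed_Collect_eq continuous_intros continuous_at_imp_continuous_on)
  then have "closed {y. riesz_const \<alpha> * sym_op \<alpha> \<Phi> y = y / (\<alpha> + 1)}" by simp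
  moreover have "{- y\<^sub>\<alpha><..<y\<^sub>\<alpha>} \<subseteq> {y. riesz_const \<alpha> * sym_op \<alpha> \<Phi> y = y / (\<alpha> + 1)}"
    using interior by (auto simp: abs_less_iff)
  ultimately have "closure {- y\<^sub>\<alpha><..<y\<^sub>\<alpha>} \<subseteq> {y. riesz_const \<alpha> * sym_op \<alpha> \<Phi> y = y / (\<alpha> + 1)}"
    by (rule closure_minimal[rotated])
  moreover have "y \<in> closure {- y\<^sub>\<alpha><..<y\<^sub>\<alpha>}"
    using assms profile_y_pos by (auto simp: abs_le_iff)
  ultimately show ?thesis by blast
qed

lemma continuous_on_sym_op_profile_Phi: "continuous_on S (sym_op \<alpha> \<Phi>)"
  using isCont_sym_op_profile_Phi by (intro continuous_at_imp_continuous_on) auto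

text \<open>The operator commutes with translations, hence with averages of them; the interchange of
  integrals rests on the translation-independent majorant.\<close>

lemma sym_op_box_avg:
  assumes \<eta>: "0 < \<eta>"
  shows "sym_op \<alpha> (box_avg \<eta> \<Phi>) y = box_avg \<eta> (sym_op \<alpha> \<Phi>) y"
proof -
  note [measurable] = profile_Phi_measurable
  obtain H where H: "integrable lborel H"
    "\<And>y z. \<bar>levy_quotient \<alpha> \<Phi> y z\<bar> \<le> H z"
    using profile_majorant by blast
  let ?K = "\<lambda>s z. indicator {- \<eta>..\<eta>} s * (levy_quotient \<alpha> \<Phi> (y + s) z)"
  have intz: "integrable lborel (?K s)" for s
    by (intro integrable_mult_right integrable_sym_op_profile_Phi)
  have "integrable (lborel \<Otimes>\<^sub>M lborel) (\<lambda>(s, z). ?K s z)"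
  proof (rule lborel_pair.Fubini_integrable)
    show m: "(\<lambda>(s, z). ?K s z) \<in> borel_measurable (lborel \<Otimes>\<^sub>M lborel)"
      unfolding second_diff_def by measurable
    show "integrable lborel (\<lambda>s. LINT z|lborel. norm (case (s, z) of (s, z) \<Rightarrow> ?K s z))"
    proof (rule Bochner_Integration.integrable_bound)
      show "integrable lborel (\<lambda>s. indicator {- \<eta>..\<eta>} s * (LINT z|lborel. H z))"
        using box_avg_integrable[of "\<lambda>_. LINT z|lborel. H z" \<eta> 0] by simp
      show "(\<lambda>s. LINT z|lborel. norm (case (s, z) of (s, z) \<Rightarrow> ?K s z)) \<in> borel_measurable lborel"
        unfolding second_diff_def by measurable
      have le: "(LINT z|lborel. norm (?K s z)) \<le> indicator {- \<eta>..\<eta>} s * (LINT z|lborel. H z)" for s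
      proof -
        have "(LINT z|lborel. norm (?K s z)) \<le> (LINT z|lborel. indicator {- \<eta>..\<eta>} s * H z)"
        proof (rule integral_mono)
          show "integrable lborel (\<lambda>z. norm (?K s z))" by (rule integrable_norm[OF intz])
          show "integrable lborel (\<lambda>z. indicator {- \<eta>..\<eta>} s * H z)" using H(1) by simp
          show "norm (?K s z) \<le> indicator {- \<eta>..\<eta>} s * H z" for z
            using H(2)[of z "y + s"] by (simp split: split_indicator)
        qed
        then show ?thesis by simp
      qed
      show "AE s in lborel. norm (LINT z|lborel. norm (case (s, z) of (s, z) \<Rightarrow> ?K s z))
          \<le> norm (indicator {- \<eta>..\<eta>} s * (LINT z|lborel. H z))"
        unfolding split
      proof (rule AE_I2)
        fix s
        have "0 \<le> (LINT z|lborel. norm (?K s z))" by (rule Bochner_Integration.integral_nonneg) (rule norm_ge_zero)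
        from order_trans[OF eq_refl[OF abs_of_nonneg[OF this]] order_trans[OF le abs_ge_self]]
        show "norm (LINT z|lborel. norm (?K s z)) \<le> norm (indicator {- \<eta>..\<eta>} s * (LINT z|lborel. H z))"
          unfolding real_norm_def[of "integral\<^sup>L _ _"] real_norm_def[of "_ * integral\<^sup>L lborel H"] .
      qed
    qed
    show "AE s in lborel. integrable lborel (\<lambda>z. case (s, z) of (s, z) \<Rightarrow> ?K s z)"
      using intz by simp
  qed
  from lborel_pair.Fubini_integral[OF this]
  have swap: "(LINT z|lborel. LINT s|lborel. ?K s z) = (LINT s|lborel. LINT z|lborel. ?K s z)" .
  have sd: "second_diff (box_avg \<eta> \<Phi>) y z = (LINT s|lborel. indicator {- \<eta>..\<eta>} s * second_diff \<Phi> (y + s) z) / (2 * \<eta>)" for z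
  proof -
    note i = box_avg_integrable[OF continuous_on_profile_Phi, of \<eta>]
    have "(\<lambda>s. indicator {- \<eta>..\<eta>} s * second_diff \<Phi> (y + s) z) = (\<lambda>s. 2 * (indicator {- \<eta>..\<eta>} s * \<Phi> (y + s))
        - indicator {- \<eta>..\<eta>} s * \<Phi> (y + z + s) - indicator {- \<eta>..\<eta>} s * \<Phi> (y - z + s))"
      by (auto simp: fun_eq_iff second_diff_def algebra_simps)
    then show ?thesis
      using i[of y] i[of "y + z"] i[of "y - z"]
      by (simp add: second_diff_def[of "box_avg \<eta> \<Phi>"] box_avg_def diff_divide_distrib)
  qed
  have ker: "levy_quotient \<alpha> (box_avg \<eta> \<Phi>) y z = (LINT s|lborel. ?K s z) / (2 * \<eta>)" for z
  proof -
    have K: "?K s z = (indicator {0<..} z / z powr (1 + \<alpha>)) * (indicator {- \<eta>..\<eta>} s * second_diff \<Phi> (y + s) z)" for s by simp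
    have K': "(LINT s|lborel. ?K s z) = (indicator {0<..} z / z powr (1 + \<alpha>)) * (LINT s|lborel. indicator {- \<eta>..\<eta>} s * second_diff \<Phi> (y + s) z)"
      unfolding K by (rule integral_mult_right_zero)
    show ?thesis unfolding sd K' by simp
  qed
  have "sym_op \<alpha> (box_avg \<eta> \<Phi>) y = (LINT z|lborel. LINT s|lborel. ?K s z) / (2 * \<eta>)"
    unfolding sym_op_def ker by (rule integral_divide_zero)
  also have "\<dots> = box_avg \<eta> (sym_op \<alpha> \<Phi>) y"
    unfolding swap box_avg_def sym_op_def integral_mult_right_zero ..
  finally show ?thesis .
qed

lemma abs_sym_op_profile_Phi_le: obtains c where "0 < c" "\<And>y. \<bar>riesz_const \<alpha> * sym_op \<alpha> \<Phi> y\<bar> \<le> c"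
proof -
  obtain H where H: "integrable lborel H"
    "\<And>y z. \<bar>levy_quotient \<alpha> \<Phi> y z\<bar> \<le> H z"
    using profile_majorant by blast
  have "\<bar>sym_op \<alpha> \<Phi> y\<bar> \<le> (LINT z|lborel. H z)" for y
    unfolding sym_op_def
    using Bochner_Integration.integral_norm_bound_integral[OF integrable_sym_op_profile_Phi H(1)] H(2) by simp
  then show ?thesis using abs_cmult_bounded[of "sym_op \<alpha> \<Phi>" _ "riesz_const \<alpha>"] that by blast
qed

text \<open>\<open>\<Lambda>\<^sup>\<alpha>\<Phi>\<close> is continuous across the free boundary, so mollifying the profile destroys the
  profile equation only by a small amount, and only near the free boundary.\<close>

lemma box_avg_almost_profile_equation:
  assumes "0 < \<omega>" "0 < \<eta>0"
  obtains \<eta> where "0 < \<eta>" "\<eta> < \<eta>0"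
    "\<And>y. \<bar>y\<bar> \<le> y\<^sub>\<alpha> + \<eta> \<Longrightarrow> \<bar>riesz_const \<alpha> * sym_op \<alpha> (box_avg \<eta> \<Phi>) y - \<gamma> * y\<bar> \<le> \<omega>"
proof -
  define D where "D y = riesz_const \<alpha> * sym_op \<alpha> \<Phi> y - \<gamma> * y" for y
  have cD: "continuous_on S D" for S
    unfolding D_def [abs_def] using \<alpha> by (intro continuous_intros continuous_on_sym_op_profile_Phi)
  have D0: "D y = 0" if "\<bar>y\<bar> \<le> y\<^sub>\<alpha>" for y
    using sym_op_profile_Phi[OF that] by (simp add: D_def)
  have "uniformly_continuous_on {- y\<^sub>\<alpha> - 1..y\<^sub>\<alpha> + 1} D"
    by (rule compact_uniformly_continuous[OF cD]) auto
  then obtain d where d: "0 < d"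
    "\<And>x x'. x \<in> {- y\<^sub>\<alpha> - 1..y\<^sub>\<alpha> + 1} \<Longrightarrow> x' \<in> {- y\<^sub>\<alpha> - 1..y\<^sub>\<alpha> + 1} \<Longrightarrow> dist x' x < d \<Longrightarrow> dist (D x') (D x) < \<omega>"
    unfolding uniformly_continuous_on_def using assms(1) by blast
  \<comment> \<open>The bound 1/2 keeps y + s in the compact interval of uniform continuity, and d/4
    keeps 2\<eta> below d.\<close>
  define \<eta> where "\<eta> = min (\<eta>0 / 2) (min (1/2) (d / 4))"
  have \<eta>: "0 < \<eta>" "\<eta> < \<eta>0" "2 * \<eta> \<le> 1" "2 * \<eta> < d"
    using assms d(1) by (auto simp: \<eta>_def min_def)
  have y0: "0 < y\<^sub>\<alpha>" by (rule profile_y_pos)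
  show ?thesis
  proof (rule that[OF \<eta>(1,2)])
    fix y assume y: "\<bar>y\<bar> \<le> y\<^sub>\<alpha> + \<eta>"
    have "- \<omega> \<le> D (y + s) \<and> D (y + s) \<le> \<omega>" if s: "\<bar>s\<bar> \<le> \<eta>" for s
    proof -
      \<comment> \<open>The nearest point of the transition interval, at distance at most 2\<eta>;
        the defect \<open>D\<close> vanishes there.\<close>
      define y' where "y' = max (- y\<^sub>\<alpha>) (min y\<^sub>\<alpha> (y + s))"
      have y': "\<bar>y'\<bar> \<le> y\<^sub>\<alpha>" using y0 by (auto simp: y'_def max_def min_def)
      have "dist (y + s) y' < d" "y + s \<in> {- y\<^sub>\<alpha> - 1..y\<^sub>\<alpha> + 1}" "y' \<in> {- y\<^sub>\<alpha> - 1..y\<^sub>\<alpha> + 1}"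
        using y s \<eta> y0 by (auto simp: y'_def max_def min_def dist_real_def)
      from d(2)[OF this(3,2,1)] D0[OF y'] show ?thesis by (simp add: dist_real_def abs_less_iff)
    qed
    from box_avg_bounds[of D \<eta> "- \<omega>" y \<omega>, OF cD \<eta>(1) this]
    have "\<bar>box_avg \<eta> D y\<bar> \<le> \<omega>" by (simp add: abs_le_iff)
    moreover have "box_avg \<eta> D y = riesz_const \<alpha> * sym_op \<alpha> (box_avg \<eta> \<Phi>) y - \<gamma> * y"
      unfolding D_def [abs_def] sym_op_box_avg[OF \<eta>(1)]
      by (subst box_avg_diff)
         (use \<alpha> in \<open>auto intro!: continuous_intros continuous_on_sym_op_profile_Phi
           simp: box_avg_cmult box_avg_ident[OF \<eta>(1)] simp del: times_divide_eq_left\<close>)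
    ultimately show "\<bar>riesz_const \<alpha> * sym_op \<alpha> (box_avg \<eta> \<Phi>) y - \<gamma> * y\<bar> \<le> \<omega>" by simp
  qed
qed

section \<open>Comparison with the self-similar solution\<close>

definition smooth_slope :: "real \<Rightarrow> real \<Rightarrow> real" where
  "smooth_slope \<eta> y = (\<Phi> (y + \<eta>) - \<Phi> (y - \<eta>)) / (2 * \<eta>)"

lemma DERIV_smooth_profile: "0 < \<eta> \<Longrightarrow> (box_avg \<eta> \<Phi> has_real_derivative smooth_slope \<eta> y) (at y)"
  unfolding smooth_slope_def by (rule DERIV_box_avg[OF continuous_on_profile_Phi])

lemma smooth_slope_nonneg: "0 < \<eta> \<Longrightarrow> 0 \<le> smooth_slope \<eta> y"
  unfolding smooth_slope_def using profile_Phi_mono[of "y - \<eta>" "y + \<eta>"] by simp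

lemma smooth_slope_eq_0:
  assumes "0 < \<eta>" "y\<^sub>\<alpha> + \<eta> < \<bar>y\<bar>"
  shows "smooth_slope \<eta> y = 0"
proof (cases "0 \<le> y")
  case True
  then show ?thesis unfolding smooth_slope_def using assms by (simp add: profile_Phi_eq_1)
next
  case False
  then show ?thesis unfolding smooth_slope_def using assms by (simp add: profile_Phi_eq_0)
qed

lemma smooth_slope_le:
  assumes "0 < \<eta>" and m: "\<And>y. profile_dPhi y \<le> m"
  shows "smooth_slope \<eta> y \<le> m"
proof -
  have "\<exists>z>y - \<eta>. z < y + \<eta> \<and> \<Phi> (y + \<eta>) - \<Phi> (y - \<eta>) = ((y + \<eta>) - (y - \<eta>)) * profile_dPhi z"
    using assms(1) DERIV_profile_Phi by (intro MVT2) auto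
  then obtain z where "\<Phi> (y + \<eta>) - \<Phi> (y - \<eta>) = (2 * \<eta>) * profile_dPhi z" by auto
  then show ?thesis unfolding smooth_slope_def using assms(1) m[of z] by simp
qed

lemma smooth_profile_bounds:
  assumes "0 < \<eta>"
  shows "0 \<le> box_avg \<eta> \<Phi> y" "box_avg \<eta> \<Phi> y \<le> 1" "box_avg \<eta> \<Phi> y \<le> \<Phi> (y + \<eta>)"
    and "y\<^sub>\<alpha> + \<eta> \<le> y \<Longrightarrow> box_avg \<eta> \<Phi> y = 1"
proof -
  note c = continuous_on_profile_Phi[of UNIV]
  show "0 \<le> box_avg \<eta> \<Phi> y" "box_avg \<eta> \<Phi> y \<le> 1"
    using profile_Phi_nonneg profile_Phi_le_1 by (auto intro: box_avg_bounds[OF c assms])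
  show "box_avg \<eta> \<Phi> y \<le> \<Phi> (y + \<eta>)"
    by (rule box_avg_bounds(2)[OF c assms, of 0]) (auto intro!: profile_Phi_nonneg profile_Phi_mono)
  assume "y\<^sub>\<alpha> + \<eta> \<le> y"
  then have "1 \<le> \<Phi> (y + s) \<and> \<Phi> (y + s) \<le> 1" if "\<bar>s\<bar> \<le> \<eta>" for s
    using that by (simp add: profile_Phi_eq_1)
  from box_avg_bounds[OF c assms this] show "box_avg \<eta> \<Phi> y = 1" by auto
qed

text \<open>Written in terms of s = t + \<delta>, so that it serves the barrier with \<delta> > 0
  and the self-similar solution with \<delta> = 0.\<close>

lemma self_similar_time_derivative:
  assumes "0 < s"
  shows "((\<lambda>t. (x + a) / (t + \<delta>) powr \<gamma>) has_real_derivative - (\<gamma> * ((x + a) / s powr \<gamma>) / s)) (at (s - \<delta>))"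
proof -
  have "((\<lambda>t. (x + a) * (t + \<delta>) powr (- \<gamma>)) has_real_derivative (x + a) * (- \<gamma> * (s - \<delta> + \<delta>) powr (- \<gamma> - 1) * 1)) (at (s - \<delta>))"
    by (intro DERIV_cmult DERIV_fun_powr[where g="\<lambda>t. t + \<delta>", THEN DERIV_cong]) (use assms in \<open>auto intro!: derivative_eq_intros\<close>)
  moreover have "(x + a) * (- \<gamma> * (s - \<delta> + \<delta>) powr (- \<gamma> - 1) * 1) = - (\<gamma> * ((x + a) / s powr \<gamma>) / s)"
    using assms by (simp add: powr_diff powr_minus_divide del: minus_divide_left)
  ultimately show ?thesis by (simp add: powr_minus_divide)
qed

text \<open>C^2 because \<open>smooth_slope\<close> is a difference quotient of the C^1 function
  \<Phi>; \<delta> > 0 keeps the power of t + \<delta> away from its singularity.\<close>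

lemma test_function_smooth_profile:
  assumes "0 < \<eta>" "0 < \<delta>"
  shows "test_function (\<lambda>p. box_avg \<eta> \<Phi> ((fst p + a) / (snd p + \<delta>) powr \<gamma>))"
  unfolding test_function_def
proof
  have y: "C2_on open_half_plane (\<lambda>p. (fst p + a) / (snd p + \<delta>) powr \<gamma>)"
  proof -
    have "C2_on open_half_plane (\<lambda>p. (snd p + \<delta>) powr (- \<gamma>))"
    proof (rule C2_on_compose[OF open_open_half_plane C2_on_snd, where g="\<lambda>t. (t + \<delta>) powr (- \<gamma>)"
        and g'="\<lambda>t. - \<gamma> * (t + \<delta>) powr (- \<gamma> - 1)" and g''="\<lambda>t. - \<gamma> * ((- \<gamma> - 1) * (t + \<delta>) powr (- \<gamma> - 1 - 1))"])
      fix p assume "p \<in> open_half_plane"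
      then have s: "0 < snd p + \<delta>" using assms by (auto simp: open_half_plane_def)
      have d: "((\<lambda>t. (t + \<delta>) powr r) has_real_derivative r * (snd p + \<delta>) powr (r - 1)) (at (snd p))" for r
        using DERIV_fun_powr[where g="\<lambda>t. t + \<delta>" and m=1 and x="snd p" and r=r] s
        by (auto intro!: derivative_eq_intros)
      show "((\<lambda>t. (t + \<delta>) powr (- \<gamma>)) has_real_derivative - \<gamma> * (snd p + \<delta>) powr (- \<gamma> - 1)) (at (snd p))"
        by (rule d)
      show "((\<lambda>t. - \<gamma> * (t + \<delta>) powr (- \<gamma> - 1)) has_real_derivative - \<gamma> * ((- \<gamma> - 1) * (snd p + \<delta>) powr (- \<gamma> - 1 - 1))) (at (snd p))"
        by (intro DERIV_cmult d)
    next
      show "continuous_on (snd ` open_half_plane) (\<lambda>t. - \<gamma> * ((- \<gamma> - 1) * (t + \<delta>) powr (- \<gamma> - 1 - 1)))"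
        using assms by (intro continuous_on_mult continuous_on_powr continuous_intros) (auto simp: open_half_plane_def)
    qed
    then have "C2_on open_half_plane (\<lambda>p. (fst p + a) * (snd p + \<delta>) powr (- \<gamma>))"
      by (intro C2_on_mult C2_on_add open_open_half_plane) auto
    then show ?thesis by (simp add: powr_minus_divide)
  qed
  show "C2_on open_half_plane (\<lambda>p. box_avg \<eta> \<Phi> ((fst p + a) / (snd p + \<delta>) powr \<gamma>))"
  proof (rule C2_on_compose[OF open_open_half_plane y, where g="box_avg \<eta> \<Phi>" and g'="smooth_slope \<eta>"
        and g''="\<lambda>y. (profile_dPhi (y + \<eta>) - profile_dPhi (y - \<eta>)) / (2 * \<eta>)"])
    show "(box_avg \<eta> \<Phi> has_real_derivative smooth_slope \<eta> y) (at y)" for y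
      by (rule DERIV_smooth_profile[OF assms(1)])
    show "(smooth_slope \<eta> has_real_derivative (profile_dPhi (y + \<eta>) - profile_dPhi (y - \<eta>)) / (2 * \<eta>)) (at y)" for y
      unfolding smooth_slope_def [abs_def] using assms(1)
      by (intro DERIV_cdivide DERIV_diff DERIV_chain2[OF DERIV_profile_Phi, THEN DERIV_cong])
         (auto intro!: derivative_eq_intros)
    show "continuous_on S (\<lambda>y. (profile_dPhi (y + \<eta>) - profile_dPhi (y - \<eta>)) / (2 * \<eta>))" for S
      using assms(1) by (intro continuous_intros continuous_on_compose2[OF continuous_on_profile_dPhi[of UNIV]]) auto
  qed
  show "bounded ((\<lambda>p. box_avg \<eta> \<Phi> ((fst p + a) / (snd p + \<delta>) powr \<gamma>)) ` open_half_plane)"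
    unfolding bounded_iff using smooth_profile_bounds(1,2)[OF assms(1)] by (intro exI[of _ 1]) auto
qed

text \<open>Given \<delta>, e and L, first \<eta> and then R is chosen, each error taking at most
  e/2. The estimate is uniform in x, s and y, which are treated as unrelated variables, since only s
  >= \<delta> and global bounds enter.\<close>

lemma barrier_strict:
  assumes \<delta>: "0 < \<delta>" and e: "0 < e" and L: "0 < L" and \<eta>0: "0 < \<eta>0"
  obtains \<eta> R where "0 < \<eta>" "\<eta> < \<eta>0" "R0 < R" "0 < R"
    and "\<And>x s y. \<delta> \<le> s \<Longrightarrow>
      - e < - (\<gamma> * y / s * smooth_slope \<eta> y) + \<bar>smooth_slope \<eta> y / s powr \<gamma> + L * (penalty' (x / R) / R)\<bar> *
        ((s powr \<gamma>) powr (- \<alpha>) * (riesz_const \<alpha> * sym_op \<alpha> (box_avg \<eta> \<Phi>) y)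
          + L * (R powr (- \<alpha>) * (riesz_const \<alpha> * sym_op \<alpha> penalty (x / R))))"
proof -
  obtain m where m: "0 < m" "\<And>y. profile_dPhi y \<le> m" using profile_dPhi_bounded by blast
  obtain cP where cP: "0 < cP" "\<And>x. \<bar>riesz_const \<alpha> * sym_op \<alpha> penalty x\<bar> \<le> cP" using abs_sym_op_penalty_le[OF \<alpha>] by blast
  obtain cS where cS: "0 < cS" "\<And>y. \<bar>riesz_const \<alpha> * sym_op \<alpha> \<Phi> y\<bar> \<le> cS" using abs_sym_op_profile_Phi_le by blast
  \<comment> \<open>Makes the slope bound m / \<delta> times the defect \<omega> equal to
    e/2.\<close>
  define \<omega> where "\<omega> = e * \<delta> / (2 * m)"
  have \<omega>: "0 < \<omega>" using e \<delta> m by (simp add: \<omega>_def)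
  obtain \<eta> where \<eta>: "0 < \<eta>" "\<eta> < \<eta>0"
    "\<And>y. \<bar>y\<bar> \<le> y\<^sub>\<alpha> + \<eta> \<Longrightarrow> \<bar>riesz_const \<alpha> * sym_op \<alpha> (box_avg \<eta> \<Phi>) y - \<gamma> * y\<bar> \<le> \<omega>"
    using box_avg_almost_profile_equation[OF \<omega> \<eta>0] by blast
  have cSb: "\<bar>riesz_const \<alpha> * sym_op \<alpha> (box_avg \<eta> \<Phi>) y\<bar> \<le> cS" for y
  proof -
    have "- cS \<le> box_avg \<eta> (\<lambda>y. riesz_const \<alpha> * sym_op \<alpha> \<Phi> y) y" "box_avg \<eta> (\<lambda>y. riesz_const \<alpha> * sym_op \<alpha> \<Phi> y) y \<le> cS"
      using cS(2) by (auto intro!: box_avg_bounds[OF _ \<eta>(1)] continuous_intros continuous_on_sym_op_profile_Phi simp: abs_le_iff minus_le_iff)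
    then show ?thesis unfolding box_avg_cmult sym_op_box_avg[OF \<eta>(1)] by (simp add: abs_le_iff minus_le_iff)
  qed
  define cA where "cA = m / \<delta> powr \<gamma>"
  define cE where "cE = (\<delta> powr \<gamma>) powr (- \<alpha>) * cS"
  \<comment> \<open>The contribution of the penalty: its slope, of order L/R, against a bounded
    nonlocal term, and its nonlocal term, of order R^(-\<alpha>), against a bounded slope.\<close>
  have "((\<lambda>R. L / R * cE + (cA + L / R) * (L * (R powr (- \<alpha>) * cP))) \<longlongrightarrow> 0 * cE + (cA + 0) * (L * (0 * cP))) at_top"
  proof -
    have 1: "((\<lambda>R::real. L / R) \<longlongrightarrow> 0) at_top"
      by (rule tendsto_divide_0[OF tendsto_const filterlim_at_top_imp_at_infinity[OF filterlim_ident]])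
    have 2: "((\<lambda>R::real. R powr (- \<alpha>)) \<longlongrightarrow> 0) at_top" using \<alpha> by real_asymp
    show ?thesis by (intro tendsto_intros 1 2)
  qed
  then have "\<forall>\<^sub>F R in at_top. L / R * cE + (cA + L / R) * (L * (R powr (- \<alpha>) * cP)) < e / 2"
    using e by (intro order_tendstoD(2)) auto
  then have "\<forall>\<^sub>F R in at_top. L / R * cE + (cA + L / R) * (L * (R powr (- \<alpha>) * cP)) < e / 2 \<and> R0 < R \<and> 0 < R"
    using eventually_gt_at_top[of R0] eventually_gt_at_top[of "0::real"] by eventually_elim auto
  then obtain R where R: "L / R * cE + (cA + L / R) * (L * (R powr (- \<alpha>) * cP)) < e / 2" "R0 < R" "0 < R"
    using eventually_happens'[OF trivial_limit_at_top_linorder] by blast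
  show ?thesis
  proof (rule that[OF \<eta>(1,2) R(2,3)])
    fix x s y :: real assume s: "\<delta> \<le> s"
    then have s0: "0 < s" using \<delta> by simp
    define A where "A = smooth_slope \<eta> y / s powr \<gamma>"
    define Z where "Z = riesz_const \<alpha> * sym_op \<alpha> (box_avg \<eta> \<Phi>) y"
    define E where "E = (s powr \<gamma>) powr (- \<alpha>) * Z"
    define b where "b = L * (penalty' (x / R) / R)"
    define F where "F = L * (R powr (- \<alpha>) * (riesz_const \<alpha> * sym_op \<alpha> penalty (x / R)))"
    have sp: "\<delta> powr \<gamma> \<le> s powr \<gamma>" using s \<delta> \<alpha> by (intro powr_mono2) auto
    have "0 \<le> A" using smooth_slope_nonneg[OF \<eta>(1)] by (simp add: A_def)
    moreover have "A \<le> cA"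
      unfolding A_def cA_def using smooth_slope_le[OF \<eta>(1) m(2)] smooth_slope_nonneg[OF \<eta>(1)] m(1) sp \<delta> by (intro frac_le) auto
    moreover have "\<bar>b\<bar> \<le> L / R"
      using L R(3) abs_penalty'_le[of "x / R"] by (simp add: b_def abs_mult divide_le_eq mult_left_le)
    moreover have "\<bar>E\<bar> \<le> cE"
    proof -
      have "(s powr \<gamma>) powr (- \<alpha>) \<le> (\<delta> powr \<gamma>) powr (- \<alpha>)" by (rule powr_mono2') (use sp \<delta> \<alpha> in auto)
      then show ?thesis unfolding E_def cE_def Z_def abs_mult using cSb[of y] by (intro mult_mono) (auto simp: abs_mult)
    qed
    moreover have "\<bar>F\<bar> \<le> L * (R powr (- \<alpha>) * cP)"
      unfolding F_def abs_mult[of L] abs_mult[of "_ powr _"] using cP(2)[of "x / R"] L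
      by (intro mult_mono) (auto simp: abs_mult)
    ultimately have "A * E - L / R * cE - (cA + L / R) * (L * (R powr (- \<alpha>) * cP)) \<le> \<bar>A + b\<bar> * (E + F)"
      by (rule abs_mult_perturbation)
    moreover have "- (e / 2) \<le> - (\<gamma> * y / s * smooth_slope \<eta> y) + A * E"
    proof -
      \<comment> \<open>The self-similar exponent at work: slope times nonlocal term has total power
        s^(-1), so it combines with the time derivative into a single multiple of the
        defect.\<close>
      have "s powr \<gamma> * (s powr \<gamma>) powr \<alpha> = s powr (\<gamma> * (1 + \<alpha>))"
        by (simp add: powr_powr powr_add[symmetric] distrib_left)
      also have "\<gamma> * (1 + \<alpha>) = 1" using \<alpha> by simp
      finally have ss: "s powr \<gamma> * (s powr \<gamma>) powr \<alpha> = s" using s0 by simp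
      have "A * E = smooth_slope \<eta> y / (s powr \<gamma> * (s powr \<gamma>) powr \<alpha>) * Z"
        by (simp add: A_def E_def powr_minus_divide)
      then have eq: "- (\<gamma> * y / s * smooth_slope \<eta> y) + A * E = smooth_slope \<eta> y / s * (Z - \<gamma> * y)"
        unfolding ss by (simp add: algebra_simps)
      show ?thesis
      proof (cases "\<bar>y\<bar> \<le> y\<^sub>\<alpha> + \<eta>")
        case True
        have "\<bar>smooth_slope \<eta> y / s * (Z - \<gamma> * y)\<bar> \<le> m / \<delta> * \<omega>"
          unfolding abs_mult
        proof (rule mult_mono)
          show "\<bar>smooth_slope \<eta> y / s\<bar> \<le> m / \<delta>"
            using smooth_slope_le[OF \<eta>(1) m(2)] smooth_slope_nonneg[OF \<eta>(1)] m(1) s \<delta> s0 by (simp add: frac_le)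
          show "\<bar>Z - \<gamma> * y\<bar> \<le> \<omega>" using \<eta>(3)[OF True] by (simp add: Z_def)
        qed (use m \<delta> in auto)
        also have "m / \<delta> * \<omega> = e / 2" using m(1) \<delta> by (simp add: \<omega>_def)
        finally show ?thesis unfolding eq by (simp only: abs_le_iff) linarith
      next
        \<comment> \<open>Outside the widened interval the averaged slope vanishes, and with it both
          terms, whatever the value of the defect.\<close>
        case False
        then show ?thesis unfolding eq using smooth_slope_eq_0[OF \<eta>(1), of y] e by simp
      qed
    qed
    ultimately show "- e < - (\<gamma> * y / s * smooth_slope \<eta> y) + \<bar>smooth_slope \<eta> y / s powr \<gamma> + L * (penalty' (x / R) / R)\<bar> *
        ((s powr \<gamma>) powr (- \<alpha>) * (riesz_const \<alpha> * sym_op \<alpha> (box_avg \<eta> \<Phi>) y)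
          + L * (R powr (- \<alpha>) * (riesz_const \<alpha> * sym_op \<alpha> penalty (x / R))))"
      using R(1) unfolding A_def[symmetric] Z_def[symmetric] E_def[symmetric] F_def[symmetric] b_def[symmetric] by linarith
  qed
qed

text \<open>The shift \<open>(y\<^sub>\<alpha> + 1) \<delta>\<^sup>\<gamma>\<close> lifts the averaged profile above the Heaviside function at time
  \<open>0\<close>. The exponential term makes the barrier a strict supersolution; it and the penalty
  exceed a bound smaller than \<open>L\<close> for large \<open>t\<close> and large \<open>\<bar>x\<bar>\<close> respectively.\<close>

definition barrier :: "real \<Rightarrow> real \<Rightarrow> real \<Rightarrow> real \<Rightarrow> real \<Rightarrow> real \<times> real \<Rightarrow> real" where
  "barrier \<eta> \<delta> L R \<epsilon> = (\<lambda>p.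
     box_avg \<eta> \<Phi> ((fst p + (y\<^sub>\<alpha> + 1) * \<delta> powr \<gamma>) / (snd p + \<delta>) powr \<gamma>)
       + (L * (1 - exp (- (\<epsilon> * snd p))) + L * penalty ((fst p + 0) / R)))"

lemma test_function_barrier:
  assumes "0 < \<eta>" "0 < \<delta>" "0 < R" "0 \<le> \<epsilon>"
  shows "test_function (barrier \<eta> \<delta> L R \<epsilon>)"
  unfolding barrier_def
  by (intro test_function_add test_function_smooth_profile test_function_exp test_function_penalty assms)

lemma continuous_on_barrier:
  assumes "0 < \<eta>" "0 < \<delta>" "0 < R"
  shows "continuous_on half_plane (barrier \<eta> \<delta> L R \<epsilon>)"
proof -
  have c1: "continuous_on UNIV (box_avg \<eta> \<Phi>)" and c2: "continuous_on UNIV penalty"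
    using DERIV_smooth_profile[OF assms(1)] DERIV_penalty
    by (auto intro!: continuous_at_imp_continuous_on intro: DERIV_isCont)
  have "continuous_on half_plane (\<lambda>p. (snd p + \<delta>) powr \<gamma>)"
    using assms by (intro continuous_on_powr continuous_intros) (auto simp: half_plane_def)
  then show ?thesis
    unfolding barrier_def using assms
    by (intro continuous_intros continuous_on_compose2[OF c1] continuous_on_compose2[OF c2])
       (auto simp: half_plane_def)
qed

text \<open>Brings the three ingredients of the equation into the exact form estimated in
  \<open>barrier_strict\<close>. The nonlocal term splits because each summand is integrable as a
  slice of a test function, and the time term cancels in second differences.\<close>

lemma barrier_operator:
  fixes x t :: real
  assumes "0 < \<eta>" "0 < \<delta>" "0 < R" "0 \<le> \<epsilon>" "0 < t"
  defines "s \<equiv> t + \<delta>"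
  defines "y \<equiv> (x + (y\<^sub>\<alpha> + 1) * \<delta> powr \<gamma>) / s powr \<gamma>"
  shows "dt (barrier \<eta> \<delta> L R \<epsilon>) (x, t) = - (\<gamma> * y / s * smooth_slope \<eta> y) + L * (\<epsilon> * exp (- (\<epsilon> * t)))"
    and "dx (barrier \<eta> \<delta> L R \<epsilon>) (x, t) = smooth_slope \<eta> y / s powr \<gamma> + L * (penalty' (x / R) / R)"
    and "frac_lap \<alpha> (\<lambda>x. barrier \<eta> \<delta> L R \<epsilon> (x, t)) x =
      (s powr \<gamma>) powr (- \<alpha>) * (riesz_const \<alpha> * sym_op \<alpha> (box_avg \<eta> \<Phi>) y)
          + L * (R powr (- \<alpha>) * (riesz_const \<alpha> * sym_op \<alpha> penalty (x / R)))"
proof -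
  let ?a = "(y\<^sub>\<alpha> + 1) * \<delta> powr \<gamma>"
  have s: "0 < s" using assms by simp
  note T = test_function_barrier[OF assms(1-4), of L]
  have "((\<lambda>t. box_avg \<eta> \<Phi> ((x + ?a) / (t + \<delta>) powr \<gamma>) + (L * (1 - exp (- (\<epsilon> * t))) + L * penalty ((x + 0) / R)))
      has_real_derivative smooth_slope \<eta> y * (- (\<gamma> * y / s)) + L * (\<epsilon> * exp (- (\<epsilon> * t)))) (at t)"
  proof (rule DERIV_cong[OF DERIV_add])
    show "((\<lambda>t. box_avg \<eta> \<Phi> ((x + ?a) / (t + \<delta>) powr \<gamma>)) has_real_derivative smooth_slope \<eta> y * (- (\<gamma> * y / s))) (at t)"
      using DERIV_chain2[OF DERIV_smooth_profile[OF assms(1)] self_similar_time_derivative[OF s, of x ?a \<delta>]]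
      by (simp add: s_def y_def)
    show "((\<lambda>t. L * (1 - exp (- (\<epsilon> * t))) + L * penalty ((x + 0) / R)) has_real_derivative L * (\<epsilon> * exp (- (\<epsilon> * t)))) (at t)"
      by (auto intro!: derivative_eq_intros)
  qed simp
  with test_function_slice(2)[OF T assms(5) \<alpha>, of x]
  show "dt (barrier \<eta> \<delta> L R \<epsilon>) (x, t) = - (\<gamma> * y / s * smooth_slope \<eta> y) + L * (\<epsilon> * exp (- (\<epsilon> * t)))"
    unfolding barrier_def fst_conv snd_conv by (simp add: DERIV_unique mult.commute)
  have "((\<lambda>x. box_avg \<eta> \<Phi> ((x + ?a) / (t + \<delta>) powr \<gamma>) + (L * (1 - exp (- (\<epsilon> * t))) + L * penalty ((x + 0) / R)))
      has_real_derivative smooth_slope \<eta> y * (1 / s powr \<gamma>) + (0 + L * (penalty' ((x + 0) / R) * (1 / R)))) (at x)"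
  proof (intro DERIV_add DERIV_cmult DERIV_const)
    have "((\<lambda>x. (x + ?a) / s powr \<gamma>) has_real_derivative 1 / s powr \<gamma>) (at x)"
      using s by (auto intro!: derivative_eq_intros)
    from DERIV_chain2[OF DERIV_smooth_profile[OF assms(1)] this]
    show "((\<lambda>x. box_avg \<eta> \<Phi> ((x + ?a) / (t + \<delta>) powr \<gamma>)) has_real_derivative smooth_slope \<eta> y * (1 / s powr \<gamma>)) (at x)"
      by (simp add: s_def y_def)
    have "((\<lambda>x. (x + 0) / R) has_real_derivative 1 / R) (at x)"
      using assms(3) by (auto intro!: derivative_eq_intros)
    from DERIV_chain2[OF DERIV_penalty this]
    show "((\<lambda>x. penalty ((x + 0) / R)) has_real_derivative penalty' ((x + 0) / R) * (1 / R)) (at x)" .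
  qed
  with test_function_slice(1)[OF T assms(5) \<alpha>, of x]
  show "dx (barrier \<eta> \<delta> L R \<epsilon>) (x, t) = smooth_slope \<eta> y / s powr \<gamma> + L * (penalty' (x / R) / R)"
    unfolding barrier_def fst_conv snd_conv by (simp add: DERIV_unique)
  have 1: "integrable lborel (\<lambda>z. levy_quotient \<alpha> (\<lambda>x. box_avg \<eta> \<Phi> ((x + ?a) / (t + \<delta>) powr \<gamma>)) x z)"
    using test_function_slice(4)[OF test_function_smooth_profile[OF assms(1,2), of ?a] assms(5) \<alpha>, of x] by simp
  have 2: "integrable lborel (\<lambda>z. levy_quotient \<alpha> (\<lambda>x. L * penalty ((x + 0) / R)) x z)"
    using test_function_slice(4)[OF test_function_penalty[OF assms(3), of L] assms(5) \<alpha>, of x] by simp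
  have "frac_lap \<alpha> (\<lambda>x. barrier \<eta> \<delta> L R \<epsilon> (x, t)) x = riesz_const \<alpha> * sym_op \<alpha> (\<lambda>x. barrier \<eta> \<delta> L R \<epsilon> (x, t)) x"
    unfolding frac_lap_def levy_const_eq[OF \<alpha>] by (rule test_function_slice(3)[OF T assms(5) \<alpha>])
  also have "sym_op \<alpha> (\<lambda>x. barrier \<eta> \<delta> L R \<epsilon> (x, t)) x =
      sym_op \<alpha> (\<lambda>x. box_avg \<eta> \<Phi> ((x + ?a) / (t + \<delta>) powr \<gamma>)) x + sym_op \<alpha> (\<lambda>x. L * penalty ((x + 0) / R)) x"
    unfolding barrier_def fst_conv snd_conv by (rule sym_op_add_const[OF 1 2])
  also have "sym_op \<alpha> (\<lambda>x. box_avg \<eta> \<Phi> ((x + ?a) / (t + \<delta>) powr \<gamma>)) x = (s powr \<gamma>) powr (- \<alpha>) * sym_op \<alpha> (box_avg \<eta> \<Phi>) y"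
    unfolding y_def s_def using s by (intro sym_op_affine) (simp add: s_def)
  also have "sym_op \<alpha> (\<lambda>x. L * penalty ((x + 0) / R)) x = L * (R powr (- \<alpha>) * sym_op \<alpha> penalty ((x + 0) / R))"
    unfolding sym_op_cmult using sym_op_affine[OF assms(3), of \<alpha> penalty 0 x] by simp
  finally show "frac_lap \<alpha> (\<lambda>x. barrier \<eta> \<delta> L R \<epsilon> (x, t)) x =
      (s powr \<gamma>) powr (- \<alpha>) * (riesz_const \<alpha> * sym_op \<alpha> (box_avg \<eta> \<Phi>) y)
          + L * (R powr (- \<alpha>) * (riesz_const \<alpha> * sym_op \<alpha> penalty (x / R)))"
    by (simp add: algebra_simps)
qed

text \<open>A positive maximum of W minus the barrier is attained, and at a positive time; there the
  barrier is an admissible test function, contradicting its strictness.\<close>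

lemma subsolution_le_barrier:
  assumes W: "viscosity_subsolution \<alpha> W" and W0: "\<And>x. W (x, 0) \<le> (if x < 0 then 0 else 1)"
    and B: "\<And>p. p \<in> half_plane \<Longrightarrow> W p \<le> B" and B0: "0 \<le> B"
    and pos: "0 < \<delta>" "0 < \<epsilon>" "0 < \<eta>0"
  obtains \<eta> R where "0 < \<eta>" "\<eta> < \<eta>0" "R0 < R" "0 < R"
    and "\<And>p. p \<in> half_plane \<Longrightarrow> W p \<le> barrier \<eta> \<delta> (B + 1) R \<epsilon> p"
proof -
  have L: "0 < B + 1" using B0 by simp
  \<comment> \<open>Averaging width below 1, so that the spatial shift still lifts the averaged
    profile to 1 on x >= 0 at time 0.\<close>
  have \<eta>01: "0 < min 1 \<eta>0" using pos by simp
  obtain \<eta> R where \<eta>: "0 < \<eta>" "\<eta> < min 1 \<eta>0" and R: "R0 < R" "0 < R"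
    and strict: "\<And>x s y. \<delta> \<le> s \<Longrightarrow>
      - \<epsilon> < - (\<gamma> * y / s * smooth_slope \<eta> y) + \<bar>smooth_slope \<eta> y / s powr \<gamma> + (B + 1) * (penalty' (x / R) / R)\<bar> *
        ((s powr \<gamma>) powr (- \<alpha>) * (riesz_const \<alpha> * sym_op \<alpha> (box_avg \<eta> \<Phi>) y)
          + (B + 1) * (R powr (- \<alpha>) * (riesz_const \<alpha> * sym_op \<alpha> penalty (x / R))))"
    using barrier_strict[OF pos(1,2) L \<eta>01, of R0] by blast
  let ?\<phi> = "barrier \<eta> \<delta> (B + 1) R \<epsilon>"
  have T: "test_function ?\<phi>" using pos \<eta> R by (intro test_function_barrier) auto
  note sb = smooth_profile_bounds[OF \<eta>(1)]
  have "W p \<le> ?\<phi> p" if p: "p \<in> half_plane" for p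
  proof (rule ccontr)
    assume "\<not> W p \<le> ?\<phi> p"
    then have c: "0 < W p - ?\<phi> p" by simp
    \<comment> \<open>Where W exceeds the barrier, both penalising terms are below B, with prefactor
      B + 1. The exponential one gives exp(\<epsilon> t) < B + 1, the spatial one (x/R)^2 < B <= (B
      + 1)^2.\<close>
    define K where "K = {- (R * (B + 1))..R * (B + 1)} \<times> {0..ln (B + 1) / \<epsilon>}"
    have "compact K" unfolding K_def by (intro compact_Times) auto
    have KS: "K \<subseteq> half_plane" by (auto simp: K_def half_plane_def)
    have inK: "q \<in> K" if q: "q \<in> half_plane" "0 < W q - ?\<phi> q" for q
    proof -
      obtain x t where xt: "q = (x, t)" "0 \<le> t" using q by (cases q) (auto simp: half_plane_def)
      have e1: "0 \<le> (B + 1) * (1 - exp (- (\<epsilon> * t)))" using xt pos L by simp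
      have e2: "0 \<le> (B + 1) * penalty (x / R)" using penalty_bounds L by simp
      have le: "(B + 1) * (1 - exp (- (\<epsilon> * t))) + (B + 1) * penalty (x / R) < B"
        using q(2) B[OF q(1)] sb(1)[of "(x + (y\<^sub>\<alpha> + 1) * \<delta> powr \<gamma>) / (t + \<delta>) powr \<gamma>"]
        unfolding xt(1) barrier_def by simp
      then have "(B + 1) * (1 - exp (- (\<epsilon> * t))) < B" using e2 by linarith
      then have "1 < (B + 1) * exp (- (\<epsilon> * t))" by (simp add: algebra_simps)
      then have "exp (\<epsilon> * t) < B + 1" by (simp add: exp_minus field_simps)
      then have "\<epsilon> * t < ln (B + 1)" using L by (metis exp_less_cancel_iff exp_ln)
      then have t: "t \<le> ln (B + 1) / \<epsilon>" using pos by (simp add: pos_le_divide_eq mult.commute)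
      have "(B + 1) * penalty (x / R) < B" using le e1 by linarith
      then have "(B + 1) * (x / R)\<^sup>2 < B * (1 + (x / R)\<^sup>2)"
        using one_plus_square_pos[of "x / R"] by (simp add: penalty_def pos_divide_less_eq)
      then have "(x / R)\<^sup>2 < B" by (simp add: algebra_simps)
      also have "B \<le> (B + 1)\<^sup>2" using B0 by (simp add: power2_eq_square algebra_simps)
      finally have "\<bar>x / R\<bar>\<^sup>2 < (B + 1)\<^sup>2" by (simp only: power2_abs)
      then have "\<bar>x / R\<bar> < B + 1" by (rule power2_less_imp_less) (use L in simp)
      then have "\<bar>x\<bar> \<le> R * (B + 1)" using R L by (simp add: field_simps)
      with t xt show ?thesis by (simp add: K_def abs_le_iff minus_le_iff)
    qed
    have usc: "usc_on half_plane (\<lambda>q. W q - ?\<phi> q)"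
      using W continuous_on_barrier[OF \<eta>(1) pos(1) R(2)] unfolding viscosity_subsolution_def
      by (intro usc_on_diff_continuous) auto
    obtain q where q: "q \<in> K" "\<And>q'. q' \<in> K \<Longrightarrow> W q' - ?\<phi> q' \<le> W q - ?\<phi> q"
      using usc_on_attains_max[OF usc \<open>compact K\<close> _ KS] inK[OF p c] by blast
    obtain x0 t0 where xt: "q = (x0, t0)" "0 \<le> t0" using q KS by (cases q) (auto simp: half_plane_def)
    have max0: "0 < W q - ?\<phi> q" using q(2)[OF inK[OF p c]] c by linarith
    have max: "W q' - ?\<phi> q' \<le> W q - ?\<phi> q" if "q' \<in> half_plane" for q'
      using q(2)[of q'] inK[OF that] max0 by (cases "0 < W q' - ?\<phi> q'") auto
    have t0: "0 < t0"
    proof (rule ccontr)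
      assume "\<not> 0 < t0"
      then have t: "t0 = 0" using xt by simp
      have lo: "box_avg \<eta> \<Phi> ((x0 + (y\<^sub>\<alpha> + 1) * \<delta> powr \<gamma>) / \<delta> powr \<gamma>) \<le> ?\<phi> (x0, 0)"
        using penalty_bounds L by (simp add: barrier_def)
      have "W (x0, 0) \<le> ?\<phi> (x0, 0)"
      proof (cases "x0 < 0")
        case True
        then show ?thesis using W0[of x0] lo sb(1)[of "(x0 + (y\<^sub>\<alpha> + 1) * \<delta> powr \<gamma>) / \<delta> powr \<gamma>"] by simp
      next
        case False
        \<comment> \<open>After division by \<delta>^\<gamma> the shift alone is
          \<open>y\<^sub>\<alpha>\<close> + 1, beyond the point from which the averaged profile
          equals 1.\<close>
        have "(y\<^sub>\<alpha> + 1) * \<delta> powr \<gamma> / \<delta> powr \<gamma> \<le> (x0 + (y\<^sub>\<alpha> + 1) * \<delta> powr \<gamma>) / \<delta> powr \<gamma>"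
          using False by (intro divide_right_mono) auto
        then have "y\<^sub>\<alpha> + \<eta> \<le> (x0 + (y\<^sub>\<alpha> + 1) * \<delta> powr \<gamma>) / \<delta> powr \<gamma>" using \<eta> pos by simp
        then show ?thesis using W0[of x0] lo sb(4) False by simp
      qed
      then show False using max0 xt t by simp
    qed
    have "dt ?\<phi> (x0, t0) + \<bar>dx ?\<phi> (x0, t0)\<bar> * frac_lap \<alpha> (\<lambda>x. ?\<phi> (x, t0)) x0 \<le> 0"
    proof -
      have "\<forall>x. \<forall>t\<in>{t0 - t0/2<..<t0 + t0/2}. W (x, t) - ?\<phi> (x, t) \<le> W (x0, t0) - ?\<phi> (x0, t0)"
        using max t0 unfolding xt(1) by (auto simp: half_plane_def)
      moreover have "0 < t0/2" "t0/2 < t0" using t0 by auto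
      ultimately show ?thesis
        using W T t0 unfolding viscosity_subsolution_def by blast
    qed
    \<comment> \<open>Strictness at the maximum: since the exponential term is still below B there,
      its time derivative exceeds \<epsilon>, the amount by which \<open>barrier_strict\<close> may
      fall short.\<close>
    moreover have "\<epsilon> < (B + 1) * (\<epsilon> * exp (- (\<epsilon> * t0)))"
    proof -
      have "(B + 1) * (1 - exp (- (\<epsilon> * t0))) < B"
        using max0 B[of q] q(1) KS sb(1)[of "(x0 + (y\<^sub>\<alpha> + 1) * \<delta> powr \<gamma>) / (t0 + \<delta>) powr \<gamma>"]
          mult_nonneg_nonneg[OF less_imp_le[OF L] penalty_bounds(1)[of "x0 / R"]]
        unfolding xt(1) barrier_def by auto
      then have "1 < (B + 1) * exp (- (\<epsilon> * t0))" by (simp add: algebra_simps)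
      then have "\<epsilon> * 1 < \<epsilon> * ((B + 1) * exp (- (\<epsilon> * t0)))" using pos by (intro mult_strict_left_mono) auto
      then show ?thesis by (simp add: mult_ac)
    qed
    moreover have "\<delta> \<le> t0 + \<delta>" "0 \<le> \<epsilon>" using t0 pos by auto
    ultimately show False
      using strict[of "t0 + \<delta>" "(x0 + (y\<^sub>\<alpha> + 1) * \<delta> powr \<gamma>) / (t0 + \<delta>) powr \<gamma>" x0]
      unfolding barrier_operator[OF \<eta>(1) pos(1) R(2) \<open>0 \<le> \<epsilon>\<close> t0] by linarith
  qed
  with \<eta> R show ?thesis by (intro that[of \<eta> R]) auto
qed

text \<open>All parameters of the barrier tend to their limits along one sequence, and continuity of
  \<Phi> absorbs the shifts and the averaging.\<close>

lemma subsolution_le_self_similar: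
  assumes W: "viscosity_subsolution \<alpha> W" and W0: "\<And>x. W (x, 0) \<le> (if x < 0 then 0 else 1)" and t: "0 < t"
  shows "W (x, t) \<le> \<Phi> (x / t powr \<gamma>)"
proof -
  obtain B where B: "0 \<le> B" "\<And>p. p \<in> half_plane \<Longrightarrow> W p \<le> B"
  proof -
    obtain B where "\<And>p. p \<in> half_plane \<Longrightarrow> \<bar>W p\<bar> \<le> B"
      using W unfolding viscosity_subsolution_def bounded_iff by auto
    then have "\<And>p. p \<in> half_plane \<Longrightarrow> W p \<le> \<bar>B\<bar>" by (meson abs_ge_self order_trans)
    then show ?thesis using that[of "\<bar>B\<bar>"] by simp
  qed
  \<comment> \<open>One null sequence plays the part of \<delta>, \<epsilon> and the bound on
    \<eta>; its reciprocal is the lower bound for R.\<close>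
  define k where "k n = 1 / real (Suc n)" for n
  have k: "0 < k n" for n by (simp add: k_def)
  have k0: "k \<longlonglongrightarrow> 0" unfolding k_def using LIMSEQ_inverse_real_of_nat by (simp add: inverse_eq_divide)
  have le: "W (x, t) \<le> \<Phi> ((x + (y\<^sub>\<alpha> + 1) * k n powr \<gamma>) / (t + k n) powr \<gamma> + k n)
      + ((B + 1) * (1 - exp (- (k n * t))) + (B + 1) * (x * k n)\<^sup>2)" for n
  proof -
    obtain \<eta> R where \<eta>: "0 < \<eta>" "\<eta> < k n" and R: "1 / k n < R" "0 < R"
      and le: "\<And>p. p \<in> half_plane \<Longrightarrow> W p \<le> barrier \<eta> (k n) (B + 1) R (k n) p"
      using subsolution_le_barrier[OF W W0 B(2,1) k[of n] k[of n] k[of n], of "1 / k n"] by blast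
    have "W (x, t) \<le> barrier \<eta> (k n) (B + 1) R (k n) (x, t)"
      using t by (intro le) (simp add: half_plane_def)
    also have "\<dots> \<le> \<Phi> ((x + (y\<^sub>\<alpha> + 1) * k n powr \<gamma>) / (t + k n) powr \<gamma> + k n)
      + ((B + 1) * (1 - exp (- (k n * t))) + (B + 1) * (x * k n)\<^sup>2)"
      unfolding barrier_def fst_conv snd_conv
    proof (intro add_mono mult_left_mono order_refl)
      show "box_avg \<eta> \<Phi> ((x + (y\<^sub>\<alpha> + 1) * k n powr \<gamma>) / (t + k n) powr \<gamma>) \<le> \<Phi> ((x + (y\<^sub>\<alpha> + 1) * k n powr \<gamma>) / (t + k n) powr \<gamma> + k n)"
        using smooth_profile_bounds(3)[OF \<eta>(1)] profile_Phi_mono \<eta>(2) by (meson add_left_mono less_imp_le order_trans)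
      have "penalty ((x + 0) / R) \<le> (x / R)\<^sup>2"
        using one_plus_square_pos[of "x / R"] by (simp add: penalty_def pos_divide_le_eq distrib_left)
      also have "\<dots> = x\<^sup>2 * (1 / R)\<^sup>2" by (simp add: power_divide)
      also have "\<dots> \<le> x\<^sup>2 * (k n)\<^sup>2"
        using R k[of n] by (intro mult_left_mono power_mono) (auto simp: field_simps)
      finally show "penalty ((x + 0) / R) \<le> (x * k n)\<^sup>2" by (simp add: power_mult_distrib)
    qed (use B in auto)
    finally show ?thesis .
  qed
  have "(\<lambda>n. \<Phi> ((x + (y\<^sub>\<alpha> + 1) * k n powr \<gamma>) / (t + k n) powr \<gamma> + k n)
      + ((B + 1) * (1 - exp (- (k n * t))) + (B + 1) * (x * k n)\<^sup>2)) \<longlonglongrightarrow>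
      \<Phi> ((x + (y\<^sub>\<alpha> + 1) * 0) / (t + 0) powr \<gamma> + 0) + ((B + 1) * (1 - exp (- (0 * t))) + (B + 1) * (x * 0)\<^sup>2)"
  proof -
    have k_powr: "(\<lambda>n. k n powr \<gamma>) \<longlonglongrightarrow> 0"
      using \<alpha> tendsto_powr'[OF k0 tendsto_const[of "\<gamma>"]] k by (simp add: less_imp_le)
    have lim: "(\<lambda>n. (x + (y\<^sub>\<alpha> + 1) * k n powr \<gamma>) / (t + k n) powr \<gamma> + k n) \<longlonglongrightarrow> (x + (y\<^sub>\<alpha> + 1) * 0) / (t + 0) powr \<gamma> + 0"
      using t by (intro tendsto_intros k0 k_powr) auto
    show ?thesis
      by (intro tendsto_add isCont_tendsto_compose[OF isCont_profile_Phi lim] tendsto_intros k0)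
  qed
  from LIMSEQ_le_const[OF this] le show ?thesis by simp
qed

section \<open>The self-similar solution\<close>

text \<open>At positive times a composition of continuous maps. At an initial point with x nonzero
  the function is locally constant, because a neighbourhood stays outside the region |x| <=
  \<open>y\<^sub>\<alpha>\<close> t^\<gamma>.\<close>

lemma tendsto_self_similar:
  assumes p: "p \<in> half_plane" "p \<noteq> (0, 0)"
  shows "(self_similar \<alpha> h \<longlongrightarrow> self_similar \<alpha> h p) (at p within half_plane)"
proof -
  obtain x t where xt: "p = (x, t)" "0 \<le> t" using p by (cases p) (auto simp: half_plane_def)
  show ?thesis
  proof (cases "0 < t")
    case True
    have "((\<lambda>q. fst q / snd q powr \<gamma>) \<longlongrightarrow> fst p / snd p powr \<gamma>) (at p within half_plane)"
      using True by (intro tendsto_intros) (auto simp: xt)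
    from isCont_tendsto_compose[OF isCont_profile_Phi this]
    have "((\<lambda>q. \<Phi> (fst q / snd q powr \<gamma>)) \<longlongrightarrow> self_similar \<alpha> h p) (at p within half_plane)"
      using True by (simp add: self_similar_def xt)
    moreover have "\<forall>\<^sub>F q in at p within half_plane. self_similar \<alpha> h q = \<Phi> (fst q / snd q powr \<gamma>)"
    proof -
      have "\<forall>\<^sub>F q in at p within half_plane. 0 < snd q"
        using True by (intro order_tendstoD(1)[OF tendsto_snd[OF tendsto_ident_at]]) (simp add: xt)
      then show ?thesis by (rule eventually_mono) (auto simp: self_similar_def)
    qed
    ultimately show ?thesis by (simp cong: tendsto_cong)
  next
    case False
    with xt p have t: "t = 0" and x: "x \<noteq> 0" by auto
    have c: "continuous_on half_plane (\<lambda>q. y\<^sub>\<alpha> * snd q powr \<gamma>)"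
      using \<alpha> by (intro continuous_intros continuous_on_powr') (auto simp: half_plane_def)
    have c': "((\<lambda>q. y\<^sub>\<alpha> * snd q powr \<gamma>) \<longlongrightarrow> y\<^sub>\<alpha> * snd p powr \<gamma>) (at p within half_plane)"
      using c p(1) unfolding continuous_on_def by blast
    have "((\<lambda>q. \<bar>fst q\<bar> - y\<^sub>\<alpha> * snd q powr \<gamma>) \<longlongrightarrow> \<bar>fst p\<bar> - y\<^sub>\<alpha> * snd p powr \<gamma>) (at p within half_plane)"
      by (intro tendsto_diff tendsto_rabs tendsto_fst tendsto_ident_at c')
    then have 1: "\<forall>\<^sub>F q in at p within half_plane. 0 < \<bar>fst q\<bar> - y\<^sub>\<alpha> * snd q powr \<gamma>"
      by (rule order_tendstoD(1)) (use x in \<open>simp add: xt t\<close>)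
    \<comment> \<open>Positivity of this product says that nearby points lie on the same side of the
      origin as x, covering both signs at once.\<close>
    have "((\<lambda>q. fst q * x) \<longlongrightarrow> fst p * x) (at p within half_plane)" by (intro tendsto_intros)
    then have 2: "\<forall>\<^sub>F q in at p within half_plane. 0 < fst q * x"
      by (rule order_tendstoD(1)) (use x in \<open>auto simp: xt zero_less_mult_iff linorder_neq_iff\<close>)
    have 3: "\<forall>\<^sub>F q in at p within half_plane. 0 \<le> snd q"
      unfolding eventually_at_filter by (rule always_eventually) (auto simp: half_plane_def)
    have "\<forall>\<^sub>F q in at p within half_plane. self_similar \<alpha> h q = self_similar \<alpha> h p"
      using 1 2 3
    proof eventually_elim
      case (elim q)
      obtain y s where q: "q = (y, s)" by (cases q)
      show ?case
      proof (cases "0 < x")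
        case True
        then have "0 < y" "y\<^sub>\<alpha> * s powr \<gamma> < y" using elim q by (auto simp: zero_less_mult_iff)
        then have "0 < s \<Longrightarrow> \<Phi> (y / s powr \<gamma>) = 1" by (intro profile_Phi_eq_1) (simp add: pos_le_divide_eq)
        then show ?thesis using True \<open>0 < y\<close> by (simp add: self_similar_def q xt t heaviside_def)
      next
        case False
        then have "x < 0" using x by simp
        then have "y < 0" "y < - (y\<^sub>\<alpha> * s powr \<gamma>)" using elim q by (auto simp: zero_less_mult_iff)
        then have "0 < s \<Longrightarrow> \<Phi> (y / s powr \<gamma>) = 0" by (intro profile_Phi_eq_0) (simp add: pos_divide_le_eq)
        then show ?thesis using \<open>x < 0\<close> \<open>y < 0\<close> by (simp add: self_similar_def q xt t heaviside_def)
      qed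
    qed
    then show ?thesis by (rule tendsto_eventually)
  qed
qed

lemma self_similar_bounds:
  assumes "0 \<le> h" "h \<le> 1"
  shows "0 \<le> self_similar \<alpha> h p" "self_similar \<alpha> h p \<le> 1"
  using assms profile_Phi_nonneg profile_Phi_le_1
  by (auto simp: self_similar_def heaviside_def split: prod.split)

text \<open>Away from the origin continuity decides. At the origin the extreme values 1 and 0 are
  already taken at the initial points (e, 0) and (-e, 0).\<close>

lemma self_similar_envelopes:
  assumes h: "0 \<le> h" "h \<le> 1" and p: "p \<in> half_plane"
  shows "usc_envelope half_plane (self_similar \<alpha> h) p = self_similar \<alpha> 1 p"
    and "lsc_envelope half_plane (self_similar \<alpha> h) p = self_similar \<alpha> 0 p"
proof -
  have near: "\<exists>e>0. (e, 0) \<in> U \<and> (- e, 0) \<in> U" if U: "open U" "(0, 0) \<in> U" for U :: "(real \<times> real) set"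
  proof -
    have "open ((\<lambda>x. (x, 0)) -` U)"
      using U(1) by (intro continuous_open_vimage continuous_intros) auto
    then obtain e where "0 < e" "e \<in> (\<lambda>x. (x, 0)) -` U" "- e \<in> (\<lambda>x. (x, 0)) -` U"
      using U(2) by (elim open_real_contains) auto
    then show ?thesis by auto
  qed
  have eq: "self_similar \<alpha> h p = self_similar \<alpha> h' p" if "p \<noteq> (0, 0)" for h'
    using that p by (auto simp: self_similar_def heaviside_def half_plane_def split: prod.split)
  have U: "usc_envelope half_plane (self_similar \<alpha> h) (0, 0) = 1"
  proof (rule usc_envelope_eq_upper)
    fix U :: "(real \<times> real) set" assume "open U" "(0, 0) \<in> U"
    then obtain e where "0 < e" "(e, 0) \<in> U" using near by blast
    then show "\<exists>q\<in>U \<inter> half_plane. self_similar \<alpha> h q = 1"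
      by (intro bexI[of _ "(e, 0)"]) (auto simp: self_similar_def heaviside_def half_plane_def)
  qed (use self_similar_bounds[OF h] in \<open>auto simp: half_plane_def\<close>)
  have L: "lsc_envelope half_plane (self_similar \<alpha> h) (0, 0) = 0"
  proof (rule lsc_envelope_eq_lower)
    fix U :: "(real \<times> real) set" assume "open U" "(0, 0) \<in> U"
    then obtain e where "0 < e" "(- e, 0) \<in> U" using near by blast
    then show "\<exists>q\<in>U \<inter> half_plane. self_similar \<alpha> h q = 0"
      by (intro bexI[of _ "(- e, 0)"]) (auto simp: self_similar_def heaviside_def half_plane_def)
  qed (use self_similar_bounds[OF h] in \<open>auto simp: half_plane_def\<close>)
  show "usc_envelope half_plane (self_similar \<alpha> h) p = self_similar \<alpha> 1 p"
  proof (cases "p = (0, 0)")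
    case True
    then show ?thesis using U by (simp add: self_similar_def heaviside_def)
  next
    case False
    then show ?thesis using usc_envelope_continuous[OF p tendsto_self_similar[OF p False]] eq by metis
  qed
  show "lsc_envelope half_plane (self_similar \<alpha> h) p = self_similar \<alpha> 0 p"
  proof (cases "p = (0, 0)")
    case True
    then show ?thesis using L by (simp add: self_similar_def heaviside_def)
  next
    case False
    then show ?thesis using lsc_envelope_continuous[OF p tendsto_self_similar[OF p False]] eq by metis
  qed
qed

lemma reflect_self_similar: "reflect (self_similar \<alpha> 1) = self_similar \<alpha> 0"
  using profile_Phi_minus by (auto simp: fun_eq_iff reflect_def self_similar_def heaviside_def)

lemma self_similar_space_derivative:
  assumes "0 < t"
  shows "((\<lambda>x. \<Phi> ((x + a) / t powr \<gamma>)) has_real_derivative profile_dPhi ((x + a) / t powr \<gamma>) / t powr \<gamma>) (at x)"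
proof -
  have "((\<lambda>x. (x + a) / t powr \<gamma>) has_real_derivative 1 / t powr \<gamma>) (at x)"
    using assms by (auto intro!: derivative_eq_intros)
  from DERIV_chain2[OF DERIV_profile_Phi this] show ?thesis by simp
qed

lemma integrable_sym_op_scaled_profile:
  assumes "0 < c"
  shows "integrable lborel (\<lambda>z. levy_quotient \<alpha> (\<lambda>x. \<Phi> ((x + a) / c)) x z)"
proof -
  note [measurable] = profile_Phi_measurable
  obtain A where A: "0 \<le> A" "\<And>y z. 0 < z \<Longrightarrow> \<bar>second_diff \<Phi> y z\<bar> \<le> A * z powr (1 + \<alpha>/2)"
    using second_diff_profile_Phi_hoelder by blast
  have sd: "second_diff (\<lambda>x. \<Phi> ((x + a) / c)) x z = second_diff \<Phi> ((x + a) / c) (z / c)" for z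
    unfolding second_diff_def by (simp add: add_divide_distrib diff_divide_distrib algebra_simps)
  show ?thesis
  proof (rule integrable_levy_kernel[where q="1 + \<alpha>/2" and A="A * (1 / c) powr (1 + \<alpha>/2)" and B=4])
    fix z :: real assume "0 < z"
    then have "\<bar>second_diff \<Phi> ((x + a) / c) (z / c)\<bar> \<le> A * (z / c) powr (1 + \<alpha>/2)"
      using assms by (intro A) simp
    also have "(z / c) powr (1 + \<alpha>/2) = (1 / c) powr (1 + \<alpha>/2) * z powr (1 + \<alpha>/2)"
      using \<open>0 < z\<close> assms by (simp add: powr_divide)
    finally show "\<bar>second_diff (\<lambda>x. \<Phi> ((x + a) / c)) x z\<bar> \<le> A * (1 / c) powr (1 + \<alpha>/2) * z powr (1 + \<alpha>/2)"
      unfolding sd by (simp add: mult.assoc)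
  next
    show "\<bar>second_diff (\<lambda>x. \<Phi> ((x + a) / c)) x z\<bar> \<le> 4" for z
      unfolding sd by (rule second_diff_profile_Phi_le)
  qed (use \<alpha> in auto)
qed

text \<open>At a contact point the test function has the gradient of the profile. On the free boundary
  and outside it that gradient vanishes, and with it the nonlocal term.\<close>

lemma viscosity_subsolution_self_similar: "viscosity_subsolution \<alpha> (self_similar \<alpha> 1)"
  unfolding viscosity_subsolution_def
proof (intro conjI allI impI)
  note bds = self_similar_bounds[of 1]
  show "bounded (self_similar \<alpha> 1 ` half_plane)"
    unfolding bounded_iff by (rule exI[of _ 1]) (use bds in auto)
  show "usc_on half_plane (self_similar \<alpha> 1)"
    unfolding usc_on_def
  proof (intro ballI allI impI)
    fix p c assume p: "p \<in> half_plane" and c: "self_similar \<alpha> 1 p < c"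
    show "\<forall>\<^sub>F q in at p within half_plane. self_similar \<alpha> 1 q < c"
    proof (cases "p = (0, 0)")
      case True
      then have "1 < c" using c by (simp add: self_similar_def heaviside_def)
      then have "self_similar \<alpha> 1 q < c" for q using bds(2)[of q] by linarith
      then show ?thesis by simp
    next
      case False
      from order_tendstoD(2)[OF tendsto_self_similar[OF p False] c] show ?thesis .
    qed
  qed
  fix x0 t0 \<tau> \<phi>
  assume t0: "0 < t0" and \<tau>: "0 < \<tau>" "\<tau> < t0" and \<phi>: "test_function \<phi>"
    and max: "\<forall>x. \<forall>t\<in>{t0 - \<tau><..<t0 + \<tau>}. self_similar \<alpha> 1 (x, t) - \<phi> (x, t) \<le> self_similar \<alpha> 1 (x0, t0) - \<phi> (x0, t0)"
  define c where "c = t0 powr \<gamma>"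
  define y where "y = (x0 + 0) / c"
  have c: "0 < c" using t0 by (simp add: c_def)
  have max': "\<Phi> ((x + 0) / (t + 0) powr \<gamma>) - \<phi> (x, t) \<le> \<Phi> ((x0 + 0) / (t0 + 0) powr \<gamma>) - \<phi> (x0, t0)"
    if "\<bar>t - t0\<bar> < \<tau>" for x t
    using max[rule_format, of t x] that \<tau> t0 by (simp add: self_similar_def abs_less_iff)
  have dx: "dx \<phi> (x0, t0) = profile_dPhi y / c"
  proof -
    have "((\<lambda>x. \<Phi> ((x + 0) / t0 powr \<gamma>) - \<phi> (x, t0)) has_real_derivative profile_dPhi y / c - dx \<phi> (x0, t0)) (at x0)"
      unfolding y_def c_def by (intro DERIV_diff self_similar_space_derivative t0 test_function_slice(1)[OF \<phi> t0 \<alpha>])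
    then have "profile_dPhi y / c - dx \<phi> (x0, t0) = 0"
      by (rule DERIV_local_max[OF _ zero_less_one]) (use max'[of t0] \<tau> in auto)
    then show ?thesis by simp
  qed
  have dt: "dt \<phi> (x0, t0) = profile_dPhi y * - (\<gamma> * y / t0)"
  proof -
    have "((\<lambda>t. \<Phi> ((x0 + 0) / (t + 0) powr \<gamma>)) has_real_derivative profile_dPhi y * - (\<gamma> * y / t0)) (at t0)"
      using DERIV_chain2[OF DERIV_profile_Phi self_similar_time_derivative[OF t0, of x0 0 0]]
      by (simp add: y_def c_def)
    from DERIV_diff[OF this test_function_slice(2)[OF \<phi> t0 \<alpha>]]
    have "profile_dPhi y * - (\<gamma> * y / t0) - dt \<phi> (x0, t0) = 0"
      by (rule DERIV_local_max[OF _ \<tau>(1)]) (use max' in \<open>auto simp: abs_minus_commute\<close>)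
    then show ?thesis by simp
  qed
  show "dt \<phi> (x0, t0) + \<bar>dx \<phi> (x0, t0)\<bar> * frac_lap \<alpha> (\<lambda>x. \<phi> (x, t0)) x0 \<le> 0"
  proof (cases "profile_dPhi y = 0")
    \<comment> \<open>Both first derivatives of the test function contain the factor
      \<open>profile_dPhi y\<close>, so the left-hand side is 0.\<close>
    case True
    then show ?thesis by (simp add: dx dt)
  next
    case False
    then have y: "\<bar>y\<bar> \<le> y\<^sub>\<alpha>" using profile_dPhi_eq_0[of y] by linarith
    \<comment> \<open>At a maximum of u - \<phi> the second differences of \<phi> are at most those
      of the profile, for every z.\<close>
    have "sym_op \<alpha> (\<lambda>x. \<phi> (x, t0)) x0 \<le> sym_op \<alpha> (\<lambda>x. \<Phi> ((x + 0) / c)) x0"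
      unfolding sym_op_def
    proof (rule integral_mono[OF test_function_slice(4)[OF \<phi> t0 \<alpha>] integrable_sym_op_scaled_profile[OF c]])
      fix z :: real
      have "second_diff (\<lambda>x. \<phi> (x, t0)) x0 z \<le> second_diff (\<lambda>x. \<Phi> ((x + 0) / c)) x0 z"
        using max'[of t0 "x0 + z"] max'[of t0 "x0 - z"] \<tau> by (simp add: second_diff_def c_def)
      then show "levy_quotient \<alpha> (\<lambda>x. \<phi> (x, t0)) x0 z
          \<le> levy_quotient \<alpha> (\<lambda>x. \<Phi> ((x + 0) / c)) x0 z"
        by (intro mult_left_mono divide_right_mono) auto
    qed
    also have "\<dots> = c powr (- \<alpha>) * sym_op \<alpha> \<Phi> y"
      unfolding y_def by (rule sym_op_affine[OF c])
    finally have "frac_lap \<alpha> (\<lambda>x. \<phi> (x, t0)) x0 \<le> riesz_const \<alpha> * (c powr (- \<alpha>) * sym_op \<alpha> \<Phi> y)"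
      unfolding frac_lap_def levy_const_eq[OF \<alpha>] test_function_slice(3)[OF \<phi> t0 \<alpha>]
      using riesz_const_pos[OF \<alpha>] by (intro mult_left_mono) auto
    also have "\<dots> = c powr (- \<alpha>) * (\<gamma> * y)"
      unfolding mult.left_commute[of "riesz_const \<alpha>"] sym_op_profile_Phi[OF y] by simp
    finally have fl: "frac_lap \<alpha> (\<lambda>x. \<phi> (x, t0)) x0 \<le> c powr (- \<alpha>) * (\<gamma> * y)" .
    have d0: "0 \<le> profile_dPhi y / c" using profile_dPhi_nonneg[of y] c by simp
    have le: "\<bar>dx \<phi> (x0, t0)\<bar> * frac_lap \<alpha> (\<lambda>x. \<phi> (x, t0)) x0 \<le> profile_dPhi y / c * (c powr (- \<alpha>) * (\<gamma> * y))"
      unfolding dx abs_of_nonneg[OF d0] by (rule mult_left_mono[OF fl d0])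
    \<comment> \<open>The same power count as for the barrier; it makes the bound on the nonlocal
      term cancel the time derivative exactly.\<close>
    have "c * c powr \<alpha> = t0 powr (\<gamma> * (1 + \<alpha>))"
      by (simp add: c_def powr_powr powr_add[symmetric] distrib_left)
    also have "\<gamma> * (1 + \<alpha>) = 1" using \<alpha> by simp
    finally have "c * c powr \<alpha> = t0" using t0 by simp
    then have "profile_dPhi y / c * (c powr (- \<alpha>) * (\<gamma> * y)) = profile_dPhi y * (\<gamma> * y / t0)"
      by (simp add: powr_minus_divide)
    with le show ?thesis unfolding dt by simp
  qed
qed

lemma viscosity_supersolution_self_similar: "viscosity_supersolution \<alpha> (self_similar \<alpha> 0)"
  using reflect_supersolution[OF \<alpha> viscosity_subsolution_self_similar] by (simp add: reflect_self_similar)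

lemma viscosity_solution_self_similar:
  assumes h: "0 \<le> h" "h \<le> 1"
  shows "viscosity_solution_ivp \<alpha> (heaviside h) (self_similar \<alpha> h)"
  unfolding viscosity_solution_ivp_def viscosity_subsolution_ivp_def viscosity_supersolution_ivp_def
proof (intro conjI allI)
  show "locally_bounded_on half_plane (self_similar \<alpha> h)"
    unfolding locally_bounded_on_def bounded_iff
    using self_similar_bounds[OF h] by (intro ballI exI[of _ UNIV]) (auto intro!: exI[of _ 1])
  show "viscosity_subsolution \<alpha> (usc_envelope half_plane (self_similar \<alpha> h))"
    using viscosity_subsolution_self_similar self_similar_envelopes(1)[OF h]
    by (subst viscosity_subsolution_cong[where v="self_similar \<alpha> 1"]) auto
  show "viscosity_supersolution \<alpha> (lsc_envelope half_plane (self_similar \<alpha> h))"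
    using viscosity_supersolution_self_similar self_similar_envelopes(2)[OF h]
    by (subst viscosity_supersolution_cong[where v="self_similar \<alpha> 0"]) auto
  fix x
  have p: "(x, 0) \<in> half_plane" by (simp add: half_plane_def)
  show "usc_envelope half_plane (self_similar \<alpha> h) (x, 0) \<le> usc_envelope UNIV (heaviside h) x"
    "lsc_envelope UNIV (heaviside h) x \<le> lsc_envelope half_plane (self_similar \<alpha> h) (x, 0)"
    unfolding self_similar_envelopes[OF h p] heaviside_envelopes[OF h] by (auto simp: self_similar_def heaviside_def)
qed

text \<open>u lies between its envelopes, and both are squeezed against the self-similar solution.
  At t = 0 and x nonzero the two envelopes of the Heaviside datum agree and pin u directly.\<close>

lemma viscosity_solution_unique:
  assumes h: "0 \<le> h" "h \<le> 1" and u: "viscosity_solution_ivp \<alpha> (heaviside h) u"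
    and t: "0 \<le> t" "(x, t) \<noteq> (0, 0)"
  shows "u (x, t) = self_similar \<alpha> h (x, t)"
proof -
  let ?U = "usc_envelope half_plane u" and ?L = "lsc_envelope half_plane u"
  have lb: "locally_bounded_on half_plane u" and sub: "viscosity_subsolution \<alpha> ?U" and sup: "viscosity_supersolution \<alpha> ?L"
    and U0: "\<And>x. ?U (x, 0) \<le> (if x < 0 then 0 else 1)" and L0: "\<And>x. (if x \<le> 0 then 0 else 1) \<le> ?L (x, 0)"
    using u unfolding viscosity_solution_ivp_def viscosity_subsolution_ivp_def viscosity_supersolution_ivp_def
      heaviside_envelopes[OF h] by auto
  have p: "(x, t) \<in> half_plane" using t by (simp add: half_plane_def)
  obtain V B where V: "open V" "(x, t) \<in> V" "\<forall>q\<in>V \<inter> half_plane. \<bar>u q\<bar> \<le> B"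
    using lb p unfolding locally_bounded_on_def bounded_iff by (metis (no_types, lifting) image_eqI real_norm_def)
  have "\<forall>\<^sub>F q in inf (nhds (x, t)) (principal half_plane). - B \<le> u q \<and> u q \<le> B"
    unfolding eventually_inf_principal eventually_nhds using V by (intro exI[of _ V]) (auto simp: abs_le_iff minus_le_iff)
  from usc_envelope_bounds(1)[OF p this] lsc_envelope_bounds(2)[OF p this]
  have env: "?L (x, t) \<le> u (x, t)" "u (x, t) \<le> ?U (x, t)" by auto
  show ?thesis
  proof (cases "0 < t")
    case True
    have "?U (x, t) \<le> \<Phi> (x / t powr \<gamma>)"
      by (rule subsolution_le_self_similar[OF sub U0 True])
    \<comment> \<open>With \<Phi>(-y) = 1 - \<Phi>(y), this upper bound for the reflected lower
      envelope is the missing lower bound for u.\<close>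
    moreover have "reflect ?L (- x, t) \<le> \<Phi> (- x / t powr \<gamma>)"
    proof (rule subsolution_le_self_similar[OF reflect_subsolution[OF \<alpha> sup] _ True])
      show "reflect ?L (x, 0) \<le> (if x < 0 then 0 else 1)" for x
        using L0[of "- x"] by (auto simp: reflect_def split: if_splits)
    qed
    ultimately show ?thesis
      using env True profile_Phi_minus[of "x / t powr \<gamma>"] by (simp add: reflect_def self_similar_def)
  next
    case False
    then have "t = 0" "x \<noteq> 0" using t by auto
    then show ?thesis
      using env U0[of x] L0[of x] by (auto simp: self_similar_def heaviside_def split: if_splits)
  qed
qed

end

theorem theorem1p4:
  fixes \<alpha> h :: real
  assumes "0 < \<alpha>" and "\<alpha> < 2"
    and "0 \<le> h" and "h \<le> 1"
  shows "viscosity_solution_ivp \<alpha> (heaviside h) (self_similar \<alpha> h) \<and>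
    (\<forall>u. viscosity_solution_ivp \<alpha> (heaviside h) u \<longrightarrow>
       (\<forall>x t. t \<ge> 0 \<longrightarrow> (x, t) \<noteq> (0, 0) \<longrightarrow> u (x, t) = self_similar \<alpha> h (x, t)))"
  using viscosity_solution_self_similar[OF assms] viscosity_solution_unique[OF assms] by blast

end
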